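(* The category $\mathbf{Fsk}$ (objects the triples $(\mathbf m,u,S)$, morphisms the $\mathbf{Fsk}$-morphisms), equipped with the tensor product, unit and constraints described in the context, is the free skew monoidal category generated by a single object, with generator $X=(\mathbf 1,\mathbf 1,* )$. That is, $\mathbf{Fsk}$ is a skew monoidal category, and for every skew monoidal category $\mathcal C$ and every object $C$ of $\mathcal C$ there is a unique functor $F\colon\mathbf{Fsk}\to\mathcal C$ which strictly preserves the skew monoidal structure (tensor, unit, $\alpha$, $\lambda$, $\rho$) and satisfies $F(X)=C$.
   Context: **Skew monoidal categories.** A (left) skew monoidal category is a category $\mathcal C$ with an object $I$, a functor $\otimes\colon\mathcal C\times\mathcal C\to\mathcal C$, and natural families (not necessarily invertible) $\alpha_{X,Y,Z}\colon (X\otimes Y)\otimes Z\to X\otimes(Y\otimes Z)$, $\lambda_X\colon I\otimes X\to X$, $\rho_X\colon X\to X\otimes I$ such that (1) $(1_W\otimes\alpha_{X,Y,Z})\circ\alpha_{W,X\otimes Y,Z}\circ(\alpha_{W,X,Y}\otimes 1_Z)=\alpha_{W,X,Y\otimes Z}\circ\alpha_{W\otimes X,Y,Z}$; (2) $\lambda_{X\otimes Y}\circ\alpha_{I,X,Y}=\lambda_X\otimes 1_Y$; (3) $(1_X\otimes\lambda_Y)\circ\alpha_{X,I,Y}\circ(\rho_X\otimes 1_Y)=1_{X\otimes Y}$; (4) $\alpha_{X,Y,I}\circ\rho_{X\otimes Y}=1_X\otimes\rho_Y$; (5) $\lambda_I\circ\rho_I=1_I$. **Ordinals and adjoints.** $\mathbf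 m=\{0,1,\dots,m-1\}$ with its usual order. An order-preserving surjection $\sigma\colon\mathbf m\to\mathbf n$ has right adjoint $\sigma^*(j)=\max\{i:\sigma(i)\le j\}$. An order-preserving injection $\delta\colon\mathbf n\to\mathbf m$ between non-empty ordinals has a right adjoint iff $\delta(0)=0$, namely $\delta^*(j)=\max\{i:\delta(i)\le j\}$. $\sigma_0\colon\mathbf{m+1}\to\mathbf m$ is the order-preserving surjection identifying $0$ and $1$; $\delta_m\colon\mathbf m\to\mathbf{m+1}$ is the order-preserving injection whose image omits $m$. **Bracketing functions.** A left bracketing function (lbf) on $\mathbf m$ ($m\ge1$) is a function $\ell\colon\mathbf m\to\mathbf m$ with (i) $\ell(j)\le j$ for all $j$; (ii) $\ell(j)\le i\le j$ implies $\ell(j)\le\ell(i)$; (iii) $\ell(m-1)=m-1$. $\mathrm{Tam}_m$ is the poset of lbfs on $\mathbf m$ under pointwise order; for $S\in\mathrm{Tam}_m$ we write $\ell_S$ for the lbf, and $r_S\colon\mathbf m\to\mathbf m$ for the function with $r_S(0)=0$, $r_S(m-1)=m-1$, and, for $0<i<m-1$, $r_S(i)=\min\{j:\ell_S(j)<i\le j\}$ (with $\min\varnothing=m-1$). $\mathrm{Tam}_1$ has a unique element $*$. **Objects.** Triples $(\mathbf m,u,S)$ with $m\ge1$, $u\subseteq\mathbf m$, $S\in\mathrm{Tam}_m$. **Shrink morphisms and $\mathbf{Fsk}$-surjections.** A shrink morphism $(\mathbf m,u,S)\to(\mathbf n,v,T)$ is an order-preserving surjection $\sigma\colon\mathbf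 m\to\mathbf n$ such that (a) $\sigma^*$ induces a bijection from $v$ to $u$; (b) if $\sigma(j)=\sigma(j+1)$ then $\sigma\ell_S(j)=\sigma(j)$; (c) $\ell_T=\sigma\ell_S\sigma^*$. An $\mathbf{Fsk}$-surjection $(\mathbf m,u,S)\to(\mathbf n,v,T)$ is an order-preserving surjection $\sigma$ which is a shrink morphism $(\mathbf m,u,L)\to(\mathbf n,v,T)$ for some $L\in\mathrm{Tam}_m$ with $S\le L$. **Swell morphisms and $\mathbf{Fsk}$-injections.** A swell morphism $(\mathbf n,v,T)\to(\mathbf m,u,S)$ is an order-preserving injection $\delta\colon\mathbf n\to\mathbf m$ with $\delta(0)=0$ such that (a) $\delta$ induces a bijection from $v$ to $u$; (b) if $j<\delta(k)\le r_S(j)$ then $j\in\mathrm{im}(\delta)$; (c) $r_T=\delta^*r_S\delta$. An $\mathbf{Fsk}$-injection $(\mathbf n,v,T)\to(\mathbf m,u,S)$ is such a $\delta$ which is a swell morphism $(\mathbf n,v,T)\to(\mathbf m,u,S')$ for some $S'\in\mathrm{Tam}_m$ with $S'\le S$. **$\mathbf{Fsk}$-morphisms.** An $\mathbf{Fsk}$-morphism $(\mathbf m,u,S)\to(\mathbf n,v,T)$ is an order-preserving function $\varphi\colon\mathbf m\to\mathbf n$ which can be written as $\delta\sigma$ with $\sigma\colon(\mathbf m,u,S)\to(\mathbf p,w,R)$ an $\mathbf{Fsk}$-surjection and $\delta\colon(\mathbf p,w,R)\to(\mathbf n,v,T)$ an $\mathbf{Fsk}$-injection, for some object $(\mathbf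 p,w,R)$. Composition is composition of functions (the $\mathbf{Fsk}$-morphisms are closed under composition). **Skew monoidal structure on $\mathbf{Fsk}$.** $(\mathbf m,u,S)\otimes(\mathbf n,v,T)=(\mathbf{m+n},u\star v,S\star T)$, where $u\star v=u\cup\{m+j:j\in v\}$ and $\ell_{S\star T}(i)=\ell_S(i)$ for $i<m-1$, $\ell_{S\star T}(m-1)=0$, $\ell_{S\star T}(i)=m+\ell_T(i-m)$ for $i\ge m$. On morphisms, the tensor product is ordinal sum: for $\varphi\colon\mathbf m\to\mathbf m'$ and $\psi\colon\mathbf n\to\mathbf n'$, $(\varphi+\psi)(i)=\varphi(i)$ for $i<m$ and $(\varphi+\psi)(m+j)=m'+\psi(j)$. The unit is $I=(\mathbf 1,\varnothing,* )$. The components of $\alpha$ are identity functions; $\lambda$ at $(\mathbf m,u,S)$ is $\sigma_0\colon\mathbf{m+1}\to\mathbf m$; $\rho$ at $(\mathbf m,u,S)$ is $\delta_m\colon\mathbf m\to\mathbf{m+1}$. *)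

theory Defs
  imports "HOL-Library.FuncSet"
begin

section \<open>Skew monoidal categories\<close>

text \<open>
  Objects and arrows live in carrier sets; the operations are only meaningful (and only
  constrained by the axioms) on those carriers. \<open>Comp g f\<close> is \<open>g\<close> after \<open>f\<close>.
\<close>

record ('o, 'a) cat =
  Obj :: "'o set"
  Arr :: "'a set"
  Dom :: "'a \<Rightarrow> 'o"
  Cod :: "'a \<Rightarrow> 'o"
  Id :: "'o \<Rightarrow> 'a"
  Comp :: "'a \<Rightarrow> 'a \<Rightarrow> 'a"  (infixr "\<cdot>\<index>" 60)

definition Hom :: "('o, 'a, 'z) cat_scheme \<Rightarrow> 'o \<Rightarrow> 'o \<Rightarrow> 'a set" where
  "Hom C a b = {f \<in> Arr C. Dom C f = a \<and> Cod C f = b}"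

locale category =
  fixes C :: "('o, 'a, 'z) cat_scheme" (structure)
  assumes dom_obj: "f \<in> Arr C \<Longrightarrow> Dom C f \<in> Obj C"
    and cod_obj: "f \<in> Arr C \<Longrightarrow> Cod C f \<in> Obj C"
    and id_hom: "a \<in> Obj C \<Longrightarrow> Id C a \<in> Hom C a a"
    and comp_hom: "f \<in> Hom C a b \<Longrightarrow> g \<in> Hom C b c \<Longrightarrow> g \<cdot> f \<in> Hom C a c"
    and comp_id: "f \<in> Hom C a b \<Longrightarrow> f \<cdot> Id C a = f"
    and id_comp: "f \<in> Hom C a b \<Longrightarrow> Id C b \<cdot> f = f"
    and comp_assoc: "f \<in> Hom C a b \<Longrightarrow> g \<in> Hom C b c \<Longrightarrow> h \<in> Hom C c d \<Longrightarrow>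
      (h \<cdot> g) \<cdot> f = h \<cdot> (g \<cdot> f)"

record ('o, 'a) skew_monoidal = "('o, 'a) cat" +
  Tensor :: "'o \<Rightarrow> 'o \<Rightarrow> 'o"  (infixl "\<otimes>\<index>" 70)
  Tensor_Arr :: "'a \<Rightarrow> 'a \<Rightarrow> 'a"  (infixl "\<boxtimes>\<index>" 70)
  Unit :: "'o"
  Assoc :: "'o \<Rightarrow> 'o \<Rightarrow> 'o \<Rightarrow> 'a"
  Lunit :: "'o \<Rightarrow> 'a"
  Runit :: "'o \<Rightarrow> 'a"

locale skew_monoidal_category = category C
  for C :: "('o, 'a, 'z) skew_monoidal_scheme" (structure) +
  assumes tensor_obj: "x \<in> Obj C \<Longrightarrow> y \<in> Obj C \<Longrightarrow> x \<otimes> y \<in> Obj C"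
    and tensor_hom: "f \<in> Hom C x x' \<Longrightarrow> g \<in> Hom C y y' \<Longrightarrow>
      f \<boxtimes> g \<in> Hom C (x \<otimes> y) (x' \<otimes> y')"
    and tensor_id: "x \<in> Obj C \<Longrightarrow> y \<in> Obj C \<Longrightarrow> Id C x \<boxtimes> Id C y = Id C (x \<otimes> y)"
    and tensor_comp: "f \<in> Hom C x x' \<Longrightarrow> f' \<in> Hom C x' x'' \<Longrightarrow>
      g \<in> Hom C y y' \<Longrightarrow> g' \<in> Hom C y' y'' \<Longrightarrow>
      (f' \<cdot> f) \<boxtimes> (g' \<cdot> g) = (f' \<boxtimes> g') \<cdot> (f \<boxtimes> g)"
    and unit_obj: "Unit C \<in> Obj C"
    and assoc_hom: "x \<in> Obj C \<Longrightarrow> y \<in> Obj C \<Longrightarrow> z \<in> Obj C \<Longrightarrow>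
      Assoc C x y z \<in> Hom C ((x \<otimes> y) \<otimes> z) (x \<otimes> (y \<otimes> z))"
    and lunit_hom: "x \<in> Obj C \<Longrightarrow> Lunit C x \<in> Hom C (Unit C \<otimes> x) x"
    and runit_hom: "x \<in> Obj C \<Longrightarrow> Runit C x \<in> Hom C x (x \<otimes> Unit C)"
    and assoc_natural: "f \<in> Hom C x x' \<Longrightarrow> g \<in> Hom C y y' \<Longrightarrow> h \<in> Hom C z z' \<Longrightarrow>
      Assoc C x' y' z' \<cdot> ((f \<boxtimes> g) \<boxtimes> h) = (f \<boxtimes> (g \<boxtimes> h)) \<cdot> Assoc C x y z"
    and lunit_natural: "f \<in> Hom C x x' \<Longrightarrow>
      Lunit C x' \<cdot> (Id C (Unit C) \<boxtimes> f) = f \<cdot> Lunit C x"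
    and runit_natural: "f \<in> Hom C x x' \<Longrightarrow>
      Runit C x' \<cdot> f = (f \<boxtimes> Id C (Unit C)) \<cdot> Runit C x"
    and pentagon: "w \<in> Obj C \<Longrightarrow> x \<in> Obj C \<Longrightarrow> y \<in> Obj C \<Longrightarrow> z \<in> Obj C \<Longrightarrow>
      (Id C w \<boxtimes> Assoc C x y z) \<cdot> Assoc C w (x \<otimes> y) z \<cdot> (Assoc C w x y \<boxtimes> Id C z)
        = Assoc C w x (y \<otimes> z) \<cdot> Assoc C (w \<otimes> x) y z"
    and lunit_assoc: "x \<in> Obj C \<Longrightarrow> y \<in> Obj C \<Longrightarrow>
      Lunit C (x \<otimes> y) \<cdot> Assoc C (Unit C) x y = Lunit C x \<boxtimes> Id C y"
    and runit_assoc_lunit: "x \<in> Obj C \<Longrightarrow> y \<in> Obj C \<Longrightarrow>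
      (Id C x \<boxtimes> Lunit C y) \<cdot> Assoc C x (Unit C) y \<cdot> (Runit C x \<boxtimes> Id C y)
        = Id C (x \<otimes> y)"
    and assoc_runit: "x \<in> Obj C \<Longrightarrow> y \<in> Obj C \<Longrightarrow>
      Assoc C x y (Unit C) \<cdot> Runit C (x \<otimes> y) = Id C x \<boxtimes> Runit C y"
    and lunit_runit: "Lunit C (Unit C) \<cdot> Runit C (Unit C) = Id C (Unit C)"

text \<open>
  A functor is a pair of an object map and an arrow map. Both are required to be extensional
  (equal to \<^const>\<open>undefined\<close> off the carrier), so that equality of such pairs is equality of
  functors.
\<close>

definition is_functor ::
  "('o, 'a, 'z) cat_scheme \<Rightarrow> ('p, 'b, 'y) cat_scheme \<Rightarrow> ('o \<Rightarrow> 'p) \<times> ('a \<Rightarrow> 'b) \<Rightarrow> bool" where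
  "is_functor C D F \<longleftrightarrow>
     fst F \<in> Obj C \<rightarrow>\<^sub>E Obj D \<and>
     snd F \<in> Arr C \<rightarrow>\<^sub>E Arr D \<and>
     (\<forall>f \<in> Arr C. Dom D (snd F f) = fst F (Dom C f) \<and> Cod D (snd F f) = fst F (Cod C f)) \<and>
     (\<forall>x \<in> Obj C. snd F (Id C x) = Id D (fst F x)) \<and>
     (\<forall>f \<in> Arr C. \<forall>g \<in> Arr C. Dom C g = Cod C f \<longrightarrow>
        snd F (g \<cdot>\<^bsub>C\<^esub> f) = snd F g \<cdot>\<^bsub>D\<^esub> snd F f)"

definition strict_skew_monoidal_functor ::
  "('o, 'a, 'z) skew_monoidal_scheme \<Rightarrow> ('p, 'b, 'y) skew_monoidal_scheme \<Rightarrow>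
     ('o \<Rightarrow> 'p) \<times> ('a \<Rightarrow> 'b) \<Rightarrow> bool" where
  "strict_skew_monoidal_functor C D F \<longleftrightarrow>
     is_functor C D F \<and>
     (\<forall>x \<in> Obj C. \<forall>y \<in> Obj C. fst F (x \<otimes>\<^bsub>C\<^esub> y) = fst F x \<otimes>\<^bsub>D\<^esub> fst F y) \<and>
     (\<forall>f \<in> Arr C. \<forall>g \<in> Arr C. snd F (f \<boxtimes>\<^bsub>C\<^esub> g) = snd F f \<boxtimes>\<^bsub>D\<^esub> snd F g) \<and>
     fst F (Unit C) = Unit D \<and>
     (\<forall>x \<in> Obj C. \<forall>y \<in> Obj C. \<forall>z \<in> Obj C.
        snd F (Assoc C x y z) = Assoc D (fst F x) (fst F y) (fst F z)) \<and>
     (\<forall>x \<in> Obj C. snd F (Lunit C x) = Lunit D (fst F x)) \<and>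
     (\<forall>x \<in> Obj C. snd F (Runit C x) = Runit D (fst F x))"


section \<open>Bracketing functions\<close>

text \<open>
  The ordinal \<open>m\<close> is \<open>{..<m}\<close>. A function between ordinals is represented by the extensional
  function \<open>nat \<Rightarrow> nat\<close> with that domain, so that HOL equality is equality of functions.
\<close>

definition Tam :: "nat \<Rightarrow> (nat \<Rightarrow> nat) set" where
  "Tam m = {l \<in> {..<m} \<rightarrow>\<^sub>E {..<m}.
     (\<forall>j<m. l j \<le> j) \<and>
     (\<forall>j<m. \<forall>i<m. l j \<le> i \<and> i \<le> j \<longrightarrow> l j \<le> l i) \<and>
     l (m - 1) = m - 1}"

definition tam_le :: "nat \<Rightarrow> (nat \<Rightarrow> nat) \<Rightarrow> (nat \<Rightarrow> nat) \<Rightarrow> bool" where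
  "tam_le m S T \<longleftrightarrow> (\<forall>i<m. S i \<le> T i)"

text \<open>The function \<open>r\<^sub>S\<close>; here \<open>S\<close> is the left bracketing function \<open>\<ell>\<^sub>S\<close> itself.\<close>

definition rbf :: "nat \<Rightarrow> (nat \<Rightarrow> nat) \<Rightarrow> nat \<Rightarrow> nat" where
  "rbf m S = (\<lambda>i\<in>{..<m}.
     if i = 0 then 0
     else if i = m - 1 then m - 1
     else if \<exists>j<m. S j < i \<and> i \<le> j then Min {j. j < m \<and> S j < i \<and> i \<le> j}
     else m - 1)"

definition tam_star :: "nat \<Rightarrow> (nat \<Rightarrow> nat) \<Rightarrow> nat \<Rightarrow> (nat \<Rightarrow> nat) \<Rightarrow> nat \<Rightarrow> nat" where
  "tam_star m S n T = (\<lambda>i\<in>{..<m + n}.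
     if i < m - 1 then S i else if i = m - 1 then 0 else m + T (i - m))"


section \<open>Shrink and swell morphisms\<close>

definition order_surj :: "nat \<Rightarrow> nat \<Rightarrow> (nat \<Rightarrow> nat) \<Rightarrow> bool" where
  "order_surj m n s \<longleftrightarrow>
     s \<in> {..<m} \<rightarrow>\<^sub>E {..<n} \<and> mono_on {..<m} s \<and> s ` {..<m} = {..<n}"

definition order_inj :: "nat \<Rightarrow> nat \<Rightarrow> (nat \<Rightarrow> nat) \<Rightarrow> bool" where
  "order_inj n m d \<longleftrightarrow>
     d \<in> {..<n} \<rightarrow>\<^sub>E {..<m} \<and> mono_on {..<n} d \<and> inj_on d {..<n}"

text \<open>
  The right adjoint of an order-preserving function \<open>f\<close> with domain \<open>m\<close>. It is used only for
  surjections and for injections with \<open>f 0 = 0\<close>, where the set below is nonempty.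
\<close>

definition radj :: "nat \<Rightarrow> (nat \<Rightarrow> nat) \<Rightarrow> nat \<Rightarrow> nat" where
  "radj m f j = Max {i. i < m \<and> f i \<le> j}"

type_synonym fsk_obj = "nat \<times> nat set \<times> (nat \<Rightarrow> nat)"

definition fsk_objects :: "fsk_obj set" where
  "fsk_objects = {(m, u, S). m \<ge> 1 \<and> u \<subseteq> {..<m} \<and> S \<in> Tam m}"

fun shrink_morphism :: "fsk_obj \<Rightarrow> fsk_obj \<Rightarrow> (nat \<Rightarrow> nat) \<Rightarrow> bool" where
  "shrink_morphism (m, u, S) (n, v, T) s \<longleftrightarrow>
     order_surj m n s \<and>
     bij_betw (radj m s) v u \<and>
     (\<forall>j. j + 1 < m \<and> s j = s (j + 1) \<longrightarrow> s (S j) = s j) \<and>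
     (\<forall>j<n. T j = s (S (radj m s j)))"

fun fsk_surjection :: "fsk_obj \<Rightarrow> fsk_obj \<Rightarrow> (nat \<Rightarrow> nat) \<Rightarrow> bool" where
  "fsk_surjection (m, u, S) (n, v, T) s \<longleftrightarrow>
     (\<exists>L \<in> Tam m. tam_le m S L \<and> shrink_morphism (m, u, L) (n, v, T) s)"

fun swell_morphism :: "fsk_obj \<Rightarrow> fsk_obj \<Rightarrow> (nat \<Rightarrow> nat) \<Rightarrow> bool" where
  "swell_morphism (n, v, T) (m, u, S) d \<longleftrightarrow>
     order_inj n m d \<and> d 0 = 0 \<and>
     bij_betw d v u \<and>
     (\<forall>j<m. \<forall>k<n. j < d k \<and> d k \<le> rbf m S j \<longrightarrow> j \<in> d ` {..<n}) \<and>
     (\<forall>j<n. rbf n T j = radj n d (rbf m S (d j)))"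

fun fsk_injection :: "fsk_obj \<Rightarrow> fsk_obj \<Rightarrow> (nat \<Rightarrow> nat) \<Rightarrow> bool" where
  "fsk_injection (n, v, T) (m, u, S) d \<longleftrightarrow>
     (\<exists>S' \<in> Tam m. tam_le m S' S \<and> swell_morphism (n, v, T) (m, u, S') d)"

definition fsk_morphism :: "fsk_obj \<Rightarrow> fsk_obj \<Rightarrow> (nat \<Rightarrow> nat) \<Rightarrow> bool" where
  "fsk_morphism A B f \<longleftrightarrow>
     (\<exists>P \<in> fsk_objects. \<exists>s d. fsk_surjection A P s \<and> fsk_injection P B d \<and>
        f = compose {..<fst A} d s)"


section \<open>The skew monoidal category Fsk\<close>

text \<open>An arrow is a function together with its source and target. In \<open>Lunit\<close>, truncated subtraction
  \<open>i - 1\<close> is the surjection \<open>\<sigma>\<^sub>0\<close> identifying \<open>0\<close> and \<open>1\<close>.\<close>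

type_synonym fsk_arr = "fsk_obj \<times> (nat \<Rightarrow> nat) \<times> fsk_obj"

fun fsk_tensor :: "fsk_obj \<Rightarrow> fsk_obj \<Rightarrow> fsk_obj" where
  "fsk_tensor (m, u, S) (n, v, T) = (m + n, u \<union> (\<lambda>j. m + j) ` v, tam_star m S n T)"

definition ordinal_sum :: "nat \<Rightarrow> nat \<Rightarrow> (nat \<Rightarrow> nat) \<Rightarrow> nat \<Rightarrow> (nat \<Rightarrow> nat) \<Rightarrow> nat \<Rightarrow> nat" where
  "ordinal_sum m m' f n g = (\<lambda>i\<in>{..<m + n}. if i < m then f i else m' + g (i - m))"

definition fsk_unit :: fsk_obj where
  "fsk_unit = (1, {}, \<lambda>i\<in>{..<1}. 0)"

definition fsk_generator :: fsk_obj where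
  "fsk_generator = (1, {..<1}, \<lambda>i\<in>{..<1}. 0)"

definition Fsk :: "(fsk_obj, fsk_arr) skew_monoidal" where
  "Fsk = \<lparr>
     Obj = fsk_objects,
     Arr = {(A, f, B). A \<in> fsk_objects \<and> B \<in> fsk_objects \<and> fsk_morphism A B f},
     Dom = (\<lambda>(A, f, B). A),
     Cod = (\<lambda>(A, f, B). B),
     Id = (\<lambda>A. (A, \<lambda>i\<in>{..<fst A}. i, A)),
     Comp = (\<lambda>(B', g, C) (A, f, B). (A, compose {..<fst A} g f, C)),
     Tensor = fsk_tensor,
     Tensor_Arr = (\<lambda>(A, f, A') (B, g, B').
       (fsk_tensor A B, ordinal_sum (fst A) (fst A') f (fst B) g, fsk_tensor A' B')),
     Unit = fsk_unit,
     Assoc = (\<lambda>A B C. (fsk_tensor (fsk_tensor A B) C,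
       \<lambda>i\<in>{..<fst A + fst B + fst C}. i, fsk_tensor A (fsk_tensor B C))),
     Lunit = (\<lambda>A. (fsk_tensor fsk_unit A, \<lambda>i\<in>{..<fst A + 1}. i - 1, A)),
     Runit = (\<lambda>A. (A, \<lambda>i\<in>{..<fst A}. i, fsk_tensor A fsk_unit)) \<rparr>"

end

theory Submission
  imports Defs
begin

text \<open>
  An order-preserving function \<open>f\<close> with \<open>f 0 = 0\<close> and the evident behaviour on the marked points
  is an Fsk-morphism exactly when \<open>f (S i) \<le> T j\<close> whenever \<open>f i \<le> j < f (i + 1)\<close>, a condition that
  is visibly stable under composition and tensor. Objects of Fsk are binary trees with two kinds of
  leaves. Given an object \<open>c\<close> of a skew monoidal category, the focused derivations of the sequent
  calculus of skew monoidal categories are interpreted as arrows between the interpretations of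
  trees; these arrows are closed under composition (cut elimination), tensor and contain the
  structure maps. A derivation can be reconstructed rule by rule from its underlying function on
  leaves: the last rule is the left unit rule if and only if the function identifies the leaves 0 and 1,
  and otherwise the function determines how the context is split. Hence each
  Fsk-morphism is the underlying function of exactly one interpreted arrow, and this assignment is
  the required functor. Tracking arrows and functions simultaneously amounts to working in the
  product of the given category with Fsk.
\<close>

section \<open>Intrinsic description of the morphisms\<close>

text \<open>An arrow into \<open>Ten t w\<close> is cut along its source, but \<alpha> is not
  invertible, so a left comb cannot be taken apart directly. What is available is
  \<open>split_arr\<close>: \<rho> plants a unit behind the chosen head, and \<alpha> gathers the
  rest behind this unit. Hence the right premise of \<open>nf_ten\<close> starts with a unit leaf,
  and functions on it are shifted by one. The coherence axioms enter the calculus at one place each: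
  \<open>lunit_runit\<close> and \<open>lunit_assoc\<close> let \<lambda> remove the planted unit,
  \<open>assoc_runit\<close> and \<open>pentagon\<close> regroup two successive splittings, and
  \<open>runit_assoc_lunit\<close> makes identities derivable. Derivations are not unique, because
  the left unit rule permutes with the tensor rule; only the resulting arrow is. Naturality of
  \<open>split_arr\<close> resolves this by moving the left unit rule to the end. When that rule is
  excluded, the bracketing functions decide: unless the source ends there, the lax inequality at the
  last leaf sent into \<open>t\<close> forces a zero of the bracketing function of the source, and
  such a zero ends the head of a comb decomposition.\<close>

text \<open>In the last clause \<open>i\<close> is the right adjoint of \<open>f\<close> at
  \<open>j\<close>, so the bracketing function transported along \<open>f\<close> is required to lie
  below \<open>T\<close>. The guard \<open>i + 1 < m\<close> leaves out the last leaf, whose value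
  \<open>m - 1\<close> is a convention. The clause on \<open>u\<close> makes a marked leaf the last
  one of its fibre, hence \<open>f\<close> injective on \<open>u\<close>.\<close>

fun lax_map :: "fsk_obj \<Rightarrow> fsk_obj \<Rightarrow> (nat \<Rightarrow> nat) \<Rightarrow> bool" where
  "lax_map (m, u, S) (n, v, T) f \<longleftrightarrow>
     f \<in> {..<m} \<rightarrow>\<^sub>E {..<n} \<and> mono_on {..<m} f \<and> f 0 = 0 \<and>
     f ` u = v \<and> (\<forall>i\<in>u. i + 1 < m \<longrightarrow> f i < f (i + 1)) \<and>
     (\<forall>i j. i + 1 < m \<and> f i \<le> j \<and> j < f (i + 1) \<longrightarrow> f (S i) \<le> T j)"

section \<open>Bracketing functions, right adjoints and right bracketing values\<close>

lemma TamD: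
  assumes "S \<in> Tam m"
  shows "\<And>j. j < m \<Longrightarrow> S j \<le> j" "\<And>i j. S j \<le> i \<Longrightarrow> i \<le> j \<Longrightarrow> j < m \<Longrightarrow> S j \<le> S i"
    "S (m - 1) = m - 1" "S \<in> extensional {..<m}"
  using assms by (auto simp: Tam_def PiE_def)

lemma TamI:
  assumes "S \<in> extensional {..<m}" "m \<ge> 1" "\<And>j. j < m \<Longrightarrow> S j \<le> j"
    "\<And>i j. S j \<le> i \<Longrightarrow> i \<le> j \<Longrightarrow> j < m \<Longrightarrow> S j \<le> S i"
    "S (m - 1) = m - 1"
  shows "S \<in> Tam m"
proof -
  have "\<And>j. j < m \<Longrightarrow> S j < m" using assms(3) le_less_trans by blast
  then show ?thesis using assms by (auto simp: Tam_def PiE_def)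
qed

lemma mono_lessThan: "mono_on {..<m} f \<Longrightarrow> i \<le> j \<Longrightarrow> j < m \<Longrightarrow> f i \<le> f j"
  for f :: "nat \<Rightarrow> nat"
  by (auto intro: mono_onD)

lemma radj_le:
  assumes "mono_on {..<m} f" "f 0 \<le> j" "0 < m"
  shows "radj m f j < m" "f (radj m f j) \<le> j"
    "\<And>i. i < m \<Longrightarrow> i \<le> radj m f j \<longleftrightarrow> f i \<le> j"
proof -
  let ?A = "{i. i < m \<and> f i \<le> j}"
  have fin: "finite ?A" and ne: "?A \<noteq> {}" using assms by auto
  have "Max ?A \<in> ?A" using Max_in[OF fin ne] .
  then show 1: "radj m f j < m" "f (radj m f j) \<le> j" by (auto simp: radj_def)
  fix i assume i: "i < m"
  show "i \<le> radj m f j \<longleftrightarrow> f i \<le> j"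
  proof
    assume "i \<le> radj m f j"
    then have "f i \<le> f (radj m f j)" using mono_lessThan[OF assms(1)] 1 by blast
    then show "f i \<le> j" using 1 by simp
  next
    assume "f i \<le> j"
    then show "i \<le> radj m f j" unfolding radj_def using fin i by (auto intro!: Max_ge)
  qed
qed

lemma radj_eqI:
  assumes "mono_on {..<m} f" "k < m" "f k \<le> j" "k + 1 < m \<Longrightarrow> j < f (k + 1)"
  shows "radj m f j = k"
proof -
  have 0: "0 < m" "f 0 \<le> j"
    using assms mono_onD[of "{..<m}" f 0 k] by auto
  note r = radj_le[OF assms(1) 0(2) 0(1)]
  have "k \<le> radj m f j" using r(3) assms by auto
  moreover have "radj m f j \<le> k"
  proof (rule ccontr)
    assume "\<not> radj m f j \<le> k"
    then have "k + 1 \<le> radj m f j" by simp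
    then have "k + 1 < m" "f (k + 1) \<le> j" using r(1) r(3)[of "k+1"] by auto
    then show False using assms(4) by simp
  qed
  ultimately show ?thesis by simp
qed

lemma radj_next:
  assumes "mono_on {..<m} f" "f 0 \<le> j" "radj m f j + 1 < m"
  shows "j < f (radj m f j + 1)"
  using radj_le(3)[OF assms(1,2), of "radj m f j + 1"] assms(3) by linarith

lemma rbf_le: "i < m \<Longrightarrow> i \<le> rbf m S i"
proof -
  assume i: "i < m"
  have "Min {j. j < m \<and> S j < i \<and> i \<le> j} \<ge> i" if "\<exists>j<m. S j < i \<and> i \<le> j"
  proof -
    have "finite {j. j < m \<and> S j < i \<and> i \<le> j}" "{j. j < m \<and> S j < i \<and> i \<le> j} \<noteq> {}"
      using that by auto
    from Min_in[OF this] show ?thesis by auto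
  qed
  then show ?thesis using i by (auto simp: rbf_def)
qed

text \<open>Replaces the minimum in \<open>rbf\<close> by a local test: \<open>k\<close> is the
  first index from \<open>i\<close> on whose value drops below \<open>i\<close>. The second disjunct
  covers the default \<open>m - 1\<close> for the case that no value drops.\<close>

lemma rbf_eqI:
  assumes "0 < i" "i < m - 1" "i \<le> k" "k < m" "S k < i \<or> k = m - 1"
    "\<And>j. i \<le> j \<Longrightarrow> j < k \<Longrightarrow> i \<le> S j" "S (m - 1) = m - 1"
  shows "rbf m S i = k"
proof (cases "S k < i")
  case True
  have "Min {j. j < m \<and> S j < i \<and> i \<le> j} = k"
  proof (rule Min_eqI)
    show "k \<in> {j. j < m \<and> S j < i \<and> i \<le> j}" using assms True by auto
    fix j assume "j \<in> {j. j < m \<and> S j < i \<and> i \<le> j}"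
    then show "k \<le> j" using assms(6)[of j] by force
  qed auto
  then show ?thesis using assms True by (auto simp: rbf_def)
next
  case False
  then have k: "k = m - 1" using assms by auto
  have "\<not> (\<exists>j<m. S j < i \<and> i \<le> j)"
  proof
    assume "\<exists>j<m. S j < i \<and> i \<le> j"
    then obtain j where j: "j < m" "S j < i" "i \<le> j" by auto
    then have "\<not> j < k" using assms(6)[of j] by auto
    then have "j = m - 1" using j k by auto
    then show False using j assms by auto
  qed
  then show ?thesis using assms k by (auto simp: rbf_def)
qed

lemma rbf_cases:
  assumes "0 < i" "i < m - 1" "S (m - 1) = m - 1"
  obtains k where "rbf m S i = k" "i \<le> k" "k < m" "S k < i \<or> k = m - 1"
    "\<And>j. i \<le> j \<Longrightarrow> j < k \<Longrightarrow> i \<le> S j"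
proof -
  let ?k = "LEAST k. i \<le> k \<and> (S k < i \<or> k = m - 1)"
  let ?P = "\<lambda>k. i \<le> k \<and> (S k < i \<or> k = m - 1)"
  have Pm: "?P (m - 1)" using assms by auto
  have k: "?P ?k" using LeastI[of ?P, OF Pm] .
  have le: "?k \<le> m - 1" using Least_le[of ?P, OF Pm] .
  have least: "i \<le> S j" if "i \<le> j" "j < ?k" for j
  proof -
    have "\<not> ?P j" using not_less_Least[of j ?P] that by auto
    then show ?thesis using that by auto
  qed
  show ?thesis
    using that[of ?k] rbf_eqI[of i m ?k S] k le least assms by auto
qed

lemma order_inj_strict:
  assumes "order_inj n m d" "i < j" "j < n"
  shows "d i < d j"
proof -
  have "d i \<le> d j" "d i \<noteq> d j" using assms mono_onD[of "{..<n}" d i j]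
    by (auto simp: order_inj_def dest: inj_onD)
  then show ?thesis by simp
qed

lemma order_surj_facts:
  assumes "order_surj m p s" "1 \<le> p"
  shows "\<And>i. i < m \<Longrightarrow> s i < p" "mono_on {..<m} s" "0 < m" "s 0 = 0"
    "\<And>j. j < p \<Longrightarrow> radj m s j < m" "\<And>j. j < p \<Longrightarrow> s (radj m s j) = j"
    "\<And>i j. i < m \<Longrightarrow> i \<le> radj m s j \<longleftrightarrow> s i \<le> j" "s (m - 1) = p - 1"
proof -
  show lt: "\<And>i. i < m \<Longrightarrow> s i < p" and mono: "mono_on {..<m} s"
    using assms by (auto simp: order_surj_def)
  have hit: "\<exists>i<m. s i = j" if "j < p" for j
  proof -
    have "j \<in> s ` {..<m}" using assms(1) that by (simp add: order_surj_def)
    then show ?thesis by (metis imageE lessThan_iff)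
  qed
  obtain i where i: "i < m" "s i = 0" using hit[of 0] assms(2) by auto
  then show m: "0 < m" by simp
  show s0: "s 0 = 0" using mono_lessThan[OF mono, of 0 i] i by simp
  note r = radj_le[OF mono, unfolded s0, OF le0 m]
  show "\<And>j. j < p \<Longrightarrow> radj m s j < m" using r(1) .
  show "\<And>i j. i < m \<Longrightarrow> i \<le> radj m s j \<longleftrightarrow> s i \<le> j" using r(3) .
  show "s (radj m s j) = j" if j: "j < p" for j
  proof -
    obtain i where i: "i < m" "s i = j" using hit[OF j] by auto
    then have "i \<le> radj m s j" using r(3) by simp
    then have "s i \<le> s (radj m s j)" using mono_lessThan[OF mono] r(1) by blast
    then show ?thesis using r(2)[of j] i by simp
  qed
  obtain i where i: "i < m" "s i = p - 1" using hit[of "p - 1"] assms(2) by auto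
  have "s i \<le> s (m - 1)" using mono_lessThan[OF mono, of i "m - 1"] i by simp
  then show "s (m - 1) = p - 1" using i lt[of "m - 1"] by simp
qed

section \<open>Fsk-surjections and Fsk-injections satisfy the lax inequality, which composes\<close>

text \<open>For a shrink morphism out of \<open>L\<close> the inequality is an equality, since
  \<open>T j = s (L i)\<close> with \<open>i\<close> the last element of the fibre over
  \<open>j\<close>. Passing from \<open>L\<close> down to \<open>S\<close> only lowers the left-hand
  side.\<close>

lemma fsk_surjection_lax:
  assumes "A \<in> fsk_objects" "B \<in> fsk_objects" "fsk_surjection A B s"
  shows "lax_map A B s"
proof -
  obtain m u S n v T where AB: "A = (m, u, S)" "B = (n, v, T)" by (cases A, cases B) auto
  have o: "1 \<le> m" "u \<subseteq> {..<m}" "S \<in> Tam m" "1 \<le> n" "v \<subseteq> {..<n}" "T \<in> Tam n"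
    using assms AB by (auto simp: fsk_objects_def)
  obtain L where L: "L \<in> Tam m" "tam_le m S L" "shrink_morphism (m, u, L) (n, v, T) s"
    using assms AB by auto
  have os: "order_surj m n s" and mono: "mono_on {..<m} s" and ext: "s \<in> {..<m} \<rightarrow>\<^sub>E {..<n}"
    and bij: "bij_betw (radj m s) v u" and c: "\<And>j. j < n \<Longrightarrow> T j = s (L (radj m s j))"
    using L by (auto simp: order_surj_def)
  note sf = order_surj_facts[OF os o(4)]
  note s0 = sf(4) and sr = sf(6)
  have img: "s ` u = v"
  proof -
    have "u = radj m s ` v" using bij by (auto simp: bij_betw_def)
    then have "s ` u = (\<lambda>j. s (radj m s j)) ` v" by (auto simp: image_image)
    also have "\<dots> = v" using sr o(5) by force
    finally show ?thesis .
  qed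
  have top: "s i < s (i + 1)" if i: "i \<in> u" "i + 1 < m" for i
  proof -
    obtain j where j: "j \<in> v" "i = radj m s j" using bij i by (auto simp: bij_betw_def)
    then have "s i = j" using sr o(5) by auto
    then show ?thesis using radj_next[OF mono] j i s0 by auto
  qed
  have main: "s (S i) \<le> T j" if "i + 1 < m" "s i \<le> j" "j < s (i + 1)" for i j
  proof -
    have "j < n" using that ext by (auto simp: PiE_def Pi_def)
    have ri: "radj m s j = i" by (rule radj_eqI[OF mono]) (use that in auto)
    have Li: "L i \<le> i" "S i \<le> L i" using TamD(1)[OF L(1)] L(2) that by (auto simp: tam_le_def)
    have "s (S i) \<le> s (L i)" using mono_lessThan[OF mono, of "S i" "L i"] Li that by auto
    then show ?thesis using c[OF \<open>j < n\<close>] ri by simp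
  qed
  show ?thesis using AB ext mono s0 img top main by simp
qed

text \<open>Swell morphisms are governed by right bracketing functions, so the inequality for left
  ones is reached by contradiction: a value \<open>S j\<close> below \<open>d (T k)\<close> makes
  the right bracketing value at \<open>d (T k)\<close> stop at \<open>j\<close> or before, and
  pulling this back along \<open>d\<close> makes the one at \<open>T k\<close> stop at
  \<open>k\<close> or before.\<close>

lemma fsk_injection_lax:
  assumes "A \<in> fsk_objects" "B \<in> fsk_objects" "fsk_injection A B d"
  shows "lax_map A B d"
proof -
  obtain n v T m u S where AB: "A = (n, v, T)" "B = (m, u, S)" by (cases A, cases B) auto
  have o: "1 \<le> m" "u \<subseteq> {..<m}" "S \<in> Tam m" "1 \<le> n" "v \<subseteq> {..<n}" "T \<in> Tam n"
    using assms AB by (auto simp: fsk_objects_def)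
  obtain S' where S': "S' \<in> Tam m" "tam_le m S' S" and sw: "swell_morphism (n, v, T) (m, u, S') d"
    using assms AB by auto
  have mono: "mono_on {..<n} d" and ext: "d \<in> {..<n} \<rightarrow>\<^sub>E {..<m}" and oi: "order_inj n m d"
    and d0: "d 0 = 0" and c: "\<And>j. j < n \<Longrightarrow> rbf n T j = radj n d (rbf m S' (d j))"
    and img: "d ` v = u"
    using sw by (auto simp: order_inj_def bij_betw_def)
  have top: "d i < d (i + 1)" if "i + 1 < n" for i
    using order_inj_strict[OF oi, of i "i+1"] that by auto
  have main: "d (T k) \<le> S j" if k: "k + 1 < n" "d k \<le> j" "j < d (k + 1)" for k j
  proof (rule ccontr)
    define i where "i = T k"
    assume "\<not> d (T k) \<le> S j"
    then have lt: "S j < d i" by (simp add: i_def)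
    have jm: "j < m - 1" using that ext by (force simp: PiE_def Pi_def)
    have ik: "i \<le> k" using TamD(1)[OF o(6), of k] k by (simp add: i_def)
    have di: "d i \<le> d k" using mono_lessThan[OF mono, of i k] ik k by auto
    have "S' j \<le> S j" using S'(2) jm by (auto simp: tam_le_def)
    then have lt': "S' j < d i" using lt by simp
    have i0: "0 < i" using lt d0 by (cases i) auto
    have di0: "0 < d i" using lt by simp
    obtain q where q: "rbf m S' (d i) = q" "d i \<le> q" "q < m" "S' q < d i \<or> q = m - 1"
      "\<And>x. d i \<le> x \<Longrightarrow> x < q \<Longrightarrow> d i \<le> S' x"
      using rbf_cases[of "d i" m S'] di0 di jm k(2) TamD(3)[OF S'(1)] by auto
    \<comment> \<open>\<open>j\<close> is itself a position from \<open>d i\<close> on where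
      \<open>S'\<close> drops below \<open>d i\<close>, and no such position precedes
      \<open>q\<close>.\<close>
    have "q \<le> j" using q(5)[of j] di k(2) lt' by force
    have "radj n d j = k" by (rule radj_eqI[OF mono]) (use k in auto)
    moreover have "radj n d q \<le> radj n d j"
      using radj_le[OF mono, of q] radj_le[OF mono, of j] d0 o(4) \<open>q \<le> j\<close>
      by (metis le_trans less_le_trans less_one zero_le nat_less_le)
    ultimately have rT: "rbf n T i \<le> k" using c[of i] q(1) ik k by auto
    obtain p where p: "rbf n T i = p" "i \<le> p" "p < n" "T p < i \<or> p = n - 1"
    proof (rule rbf_cases[of i n T])
      show "0 < i" "i < n - 1" "T (n - 1) = n - 1" using i0 ik k TamD(3)[OF o(6)] by auto
    qed blast
    \<comment> \<open>Now \<open>T k = i \<le> p \<le> k\<close>, so the bracketing condition gives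
      \<open>i \<le> T p\<close>. But \<open>T p < i\<close>, because
      \<open>p \<le> k < n - 1\<close> excludes the default value.\<close>
    have "T k \<le> T p" using TamD(2)[OF o(6), of k p] p rT k i_def by auto
    then show False using p rT k i_def by auto
  qed
  show ?thesis using AB ext mono d0 img top main by simp
qed

text \<open>The two inequalities chain through \<open>g (T k)\<close>, where \<open>k\<close> is the
  right adjoint of \<open>g\<close> at \<open>j\<close>: it satisfies both
  \<open>f i \<le> k < f (i + 1)\<close> and \<open>g k \<le> j < g (k + 1)\<close>.\<close>

lemma lax_map_comp:
  assumes "A \<in> fsk_objects" "B \<in> fsk_objects" "C \<in> fsk_objects" "lax_map A B f" "lax_map B C g"
  shows "lax_map A C (compose {..<fst A} g f)"
proof -
  obtain m u S n v T p w W where ABC: "A = (m, u, S)" "B = (n, v, T)" "C = (p, w, W)"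
    by (cases A, cases B, cases C) auto
  have o: "1 \<le> m" "u \<subseteq> {..<m}" "S \<in> Tam m" "1 \<le> n" "v \<subseteq> {..<n}" "T \<in> Tam n"
    using assms ABC by (auto simp: fsk_objects_def)
  have f: "\<And>i. i < m \<Longrightarrow> f i < n" "mono_on {..<m} f" "f 0 = 0" "f ` u = v"
    "\<And>i. i \<in> u \<Longrightarrow> i + 1 < m \<Longrightarrow> f i < f (i + 1)"
    "\<And>i j. i + 1 < m \<Longrightarrow> f i \<le> j \<Longrightarrow> j < f (i + 1) \<Longrightarrow> f (S i) \<le> T j"
    using assms(4) ABC by (auto simp: PiE_def Pi_def)
  have g: "\<And>i. i < n \<Longrightarrow> g i < p" "mono_on {..<n} g" "g 0 = 0" "g ` v = w"
    "\<And>i. i \<in> v \<Longrightarrow> i + 1 < n \<Longrightarrow> g i < g (i + 1)"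
    "\<And>i j. i + 1 < n \<Longrightarrow> g i \<le> j \<Longrightarrow> j < g (i + 1) \<Longrightarrow> g (T i) \<le> W j"
    using assms(5) ABC by (auto simp: PiE_def Pi_def)
  let ?h = "compose {..<m} g f"
  have h: "\<And>i. i < m \<Longrightarrow> ?h i = g (f i)" by (auto simp: compose_def)
  have mono: "mono_on {..<m} ?h"
  proof (rule mono_onI)
    fix i j assume ij: "i \<in> {..<m}" "j \<in> {..<m}" "i \<le> j"
    then have "f i \<le> f j" "f j < n" using mono_lessThan[OF f(2)] f(1) by blast+
    then have "g (f i) \<le> g (f j)" by (rule mono_lessThan[OF g(2)])
    then show "?h i \<le> ?h j" using h ij by (metis lessThan_iff)
  qed
  have "?h ` u = (\<lambda>i. g (f i)) ` u"
  proof (rule image_cong)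
    fix i assume "i \<in> u"
    then show "?h i = g (f i)" using o(2) h by blast
  qed simp
  then have img: "?h ` u = w" using f(4) g(4) by (metis image_image)
  have top: "?h i < ?h (i + 1)" if i: "i \<in> u" "i + 1 < m" for i
  proof -
    have a: "f i \<in> v" "f i + 1 \<le> f (i + 1)" using f(4,5) i by force+
    then have b: "f i + 1 < n" using f(1)[of "i + 1"] i by auto
    have "g (f i) < g (f i + 1)" using g(5)[OF a(1) b] .
    also have "\<dots> \<le> g (f (i + 1))" using mono_lessThan[OF g(2), of "f i + 1" "f (i+1)"] a b f(1) i by auto
    finally show ?thesis using h i by auto
  qed
  have main: "?h (S i) \<le> W j" if i: "i + 1 < m" "?h i \<le> j" "j < ?h (i + 1)" for i j
  proof -
    define k where "k = radj n g j"
    note r = radj_le[OF g(2), of j, unfolded g(3) k_def[symmetric]]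
    have a: "f i \<le> k" using r(3)[of "f i"] f(1) i h o(4) by auto
    have b: "k < f (i + 1)" using r(3)[of "f (i + 1)"] f(1)[of "i + 1"] i h o(4) by auto
    have k: "k + 1 < n" using b f(1)[of "i + 1"] i by auto
    have jk: "g k \<le> j" "j < g (k + 1)" using r(2) o(4) radj_next[OF g(2), of j] g(3) k by (auto simp: k_def)
    have Tk: "T k \<le> k" using TamD(1)[OF o(6)] k by auto
    have Si: "S i \<le> i" using TamD(1)[OF o(3)] i by auto
    have "g (f (S i)) \<le> g (T k)"
      using mono_lessThan[OF g(2), of "f (S i)" "T k"] f(6)[OF i(1) a b] Tk k by auto
    also have "\<dots> \<le> W j" using g(6)[OF k jk] .
    finally show ?thesis using h Si i by auto
  qed
  have "?h \<in> {..<m} \<rightarrow>\<^sub>E {..<p}" using f(1) g(1) unfolding compose_def by (intro PiE_I) auto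
  moreover have "?h 0 = 0" using h[of 0] f(3) g(3) o(1) by simp
  ultimately show ?thesis unfolding ABC fst_conv lax_map.simps
    using mono img top main by blast
qed

section \<open>Factoring a map that satisfies the lax inequality\<close>

text \<open>\<open>R\<close> can be computed from \<open>S\<close> because the witness
  \<open>L\<close> agrees with \<open>S\<close> on the last elements of fibres, the only places that
  the right adjoint reaches. At the other elements \<open>S\<close> is raised just enough to stay
  inside the fibre.\<close>

lemma fsk_surjectionI:
  assumes A: "(m, u, S) \<in> fsk_objects" and s: "order_surj m p s" and p: "1 \<le> p"
    and u: "\<And>i. i \<in> u \<Longrightarrow> i + 1 < m \<Longrightarrow> s i < s (i + 1)"
    and R: "R = (\<lambda>j\<in>{..<p}. s (S (radj m s j)))"
  shows "(p, s ` u, R) \<in> fsk_objects" "fsk_surjection (m, u, S) (p, s ` u, R) s"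
proof -
  note f = order_surj_facts[OF s p]
  have S: "S \<in> Tam m" and um: "u \<subseteq> {..<m}" using A by (auto simp: fsk_objects_def)
  have Rj: "R j = s (S (radj m s j))" if "j < p" for j using that R by simp
  have top_iff: "radj m s (s i) = i \<longleftrightarrow> i = m - 1 \<or> s i < s (i + 1)" if "i < m" for i
  proof
    assume *: "radj m s (s i) = i"
    show "i = m - 1 \<or> s i < s (i + 1)"
    proof (cases "i = m - 1")
      case False
      then have "i + 1 < m" using that by simp
      then show ?thesis using f(7)[of "i + 1" "s i"] * by auto
    qed simp
  next
    assume "i = m - 1 \<or> s i < s (i + 1)"
    then show "radj m s (s i) = i"
      using that by (intro radj_eqI[OF f(2)]) auto
  qed
  have RTam: "R \<in> Tam p"
  proof (rule TamI)
    show "R \<in> extensional {..<p}" using R by simp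
    show "R j \<le> j" if "j < p" for j
    proof -
      have "S (radj m s j) \<le> radj m s j" using TamD(1)[OF S] f(5) that by blast
      then have "s (S (radj m s j)) \<le> s (radj m s j)" using mono_lessThan[OF f(2)] f(5) that by blast
      then show ?thesis using Rj f(6) that by simp
    qed
    show "R j \<le> R i" if "R j \<le> i" "i \<le> j" "j < p" for i j
    proof -
      have lt: "radj m s j < m" "radj m s i < m" using f(5) that by auto
      have a: "S (radj m s j) < m" using TamD(1)[OF S lt(1)] lt by simp
      then have "S (radj m s j) \<le> radj m s i" using f(7) that Rj by simp
      moreover have "radj m s i \<le> radj m s j" using f(7)[OF lt(2)] f(6) that by simp
      ultimately have "S (radj m s j) \<le> S (radj m s i)" using TamD(2)[OF S] lt by blast
      moreover have "S (radj m s i) < m" using TamD(1)[OF S lt(2)] lt by simp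
      ultimately show ?thesis using mono_lessThan[OF f(2)] Rj that by simp
    qed
    have "radj m s (p - 1) = m - 1" by (rule radj_eqI[OF f(2)]) (use f(3,8) in auto)
    then show "R (p - 1) = p - 1" using Rj[of "p - 1"] p TamD(3)[OF S] f(8) by simp
  qed (use p in auto)
  have sub: "s ` u \<subseteq> {..<p}" using um f(1) by blast
  show "(p, s ` u, R) \<in> fsk_objects" using RTam sub p by (auto simp: fsk_objects_def)
  \<comment> \<open>\<open>b i\<close> is the first element of the fibre through \<open>i\<close>;
    between \<open>b i\<close> and \<open>i\<close> the map \<open>s\<close> is constant.\<close>
  define b where "b i = (LEAST x. s x = s i)" for i
  have b: "b i \<le> i" "s (b i) = s i" for i
    unfolding b_def by (rule Least_le, rule refl) (rule LeastI[of _ i], rule refl)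
  have b_eq: "b i = b j" if "s i = s j" for i j using that by (simp add: b_def)
  have b_fib: "s i = s j" if "b j \<le> i" "i \<le> j" "j < m" for i j
    using mono_lessThan[OF f(2) that(1)] mono_lessThan[OF f(2) that(2)] that b(2)[of j] by simp
  \<comment> \<open>\<open>L\<close> is the least bracketing function above \<open>S\<close> satisfying condition (b) for shrink morphisms.\<close>
  define L where "L = (\<lambda>i\<in>{..<m}. if i = radj m s (s i) then S i else max (S i) (b i))"
  have SL: "S i \<le> L i" if "i < m" for i using that by (simp add: L_def)
  have L: "L \<in> Tam m"
  proof (rule TamI)
    show "L \<in> extensional {..<m}" by (simp add: L_def)
    show "L j \<le> j" if "j < m" for j using that TamD(1)[OF S that] b(1)[of j] by (simp add: L_def)
    show "L j \<le> L i" if ij: "L j \<le> i" "i \<le> j" "j < m" for i j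
    proof (cases "j = radj m s (s j)")
      case True
      then have "L j = S j" using ij by (simp add: L_def)
      then have "L j \<le> S i" using TamD(2)[OF S, of j i] ij by simp
      then show ?thesis using SL[of i] ij by simp
    next
      case False
      show ?thesis
      proof (cases "i = j")
        case False
        have Lj: "L j = max (S j) (b j)" using \<open>j \<noteq> radj m s (s j)\<close> ij by (simp add: L_def)
        then have "s i = s j" using b_fib[of j i] ij by simp
        moreover have "j \<le> radj m s (s j)" using f(7) ij by simp
        ultimately have "i \<noteq> radj m s (s i)" using False ij by simp
        then have Li: "L i = max (S i) (b i)" using ij by (simp add: L_def)
        have "S j \<le> S i" using TamD(2)[OF S, of j i] ij Lj by simp
        moreover have "b j = b i" by (rule b_eq[OF \<open>s i = s j\<close>, symmetric])
        ultimately show ?thesis using Lj Li by simp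
      qed simp
    qed
    have "radj m s (s (m - 1)) = m - 1" using top_iff[of "m - 1"] f(3) by simp
    then show "L (m - 1) = m - 1" using TamD(3)[OF S] f(3) by (simp add: L_def)
  qed (use f(3) in simp)
  have bij: "bij_betw (radj m s) (s ` u) u"
  proof (rule bij_betwI[where g = s])
    have top: "radj m s (s i) = i" if "i \<in> u" for i
    proof -
      have "i < m" using that um by blast
      then have "i = m - 1 \<or> s i < s (i + 1)" using u[OF that] by linarith
      then show ?thesis using top_iff[OF \<open>i < m\<close>] by blast
    qed
    then show "radj m s \<in> s ` u \<rightarrow> u" by auto
    show "s \<in> u \<rightarrow> s ` u" by auto
    show "s (radj m s x) = x" if "x \<in> s ` u" for x using that sub f(6) by auto
    show "radj m s (s y) = y" if "y \<in> u" for y using top that by simp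
  qed
  have nontop: "s (L j) = s j" if j: "j + 1 < m" "s j = s (j + 1)" for j
  proof -
    have "radj m s (s j) \<noteq> j" using top_iff[of j] j by simp
    then have Lj: "L j = max (S j) (b j)" using j by (simp add: L_def)
    then have "b j \<le> L j" "L j \<le> j" using TamD(1)[OF S, of j] b(1)[of j] j by auto
    then show ?thesis by (rule b_fib) (use j in simp)
  qed
  have "R j = s (L (radj m s j))" if "j < p" for j
    using Rj[OF that] f(5,6)[OF that] by (simp add: L_def)
  then have "shrink_morphism (m, u, L) (p, s ` u, R) s" using s bij nontop by simp
  then show "fsk_surjection (m, u, S) (p, s ` u, R) s"
    using L SL by (auto simp: tam_le_def)
qed

text \<open>The witness must restrict along \<open>d\<close> to \<open>R\<close>, as measured by
  right bracketing functions, and lie below \<open>T\<close>. The assumption \<open>RT\<close> is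
  what gives the second property.\<close>

lemma fsk_injectionI:
  assumes A: "(p, w, R) \<in> fsk_objects" and B: "(n, v, T) \<in> fsk_objects"
    and d: "order_inj p n d" "d 0 = 0" and v: "d ` w = v"
    and RT: "\<And>k j. k + 1 < p \<Longrightarrow> d k \<le> j \<Longrightarrow> j < d (k + 1) \<Longrightarrow> d (R k) \<le> T j"
  shows "fsk_injection (p, w, R) (n, v, T) d"
proof -
  have o: "1 \<le> p" "w \<subseteq> {..<p}" "R \<in> Tam p" "1 \<le> n" "T \<in> Tam n"
    using A B by (auto simp: fsk_objects_def)
  have mono: "mono_on {..<p} d" and dn: "\<And>k. k < p \<Longrightarrow> d k < n"
    using d by (auto simp: order_inj_def)
  note r = radj_le[OF mono, unfolded d(2), OF le0 less_le_trans[OF zero_less_one o(1)]]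
  have rd: "radj p d (d k) = k" if "k < p" for k
    using that order_inj_strict[OF d(1), of k "k + 1"] by (intro radj_eqI[OF mono]) auto
  have R_lt: "R k \<le> k" "R k < p" if "k < p" for k using TamD(1)[OF o(3) that] that by auto
  \<comment> \<open>In \<open>S\<close> a new leaf is attached on the right of what precedes it, as in \<open>(X \<otimes> I) \<otimes> I\<close>, so that it
    starts no right-hand factor containing an old leaf.\<close>
  define S where "S = (\<lambda>j\<in>{..<n}. if j = n - 1 then n - 1
    else if radj p d j < p - 1 then d (R (radj p d j)) else 0)"
  have S_last: "S (n - 1) = n - 1" using o(4) by (simp add: S_def)
  have rn: "radj p d (n - 1) = p - 1"
    by (rule radj_eqI[OF mono]) (use o(1) dn[of "p - 1"] in auto)
  have S: "S \<in> Tam n"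
  proof (rule TamI)
    show "S \<in> extensional {..<n}" by (simp add: S_def)
    show "S j \<le> j" if "j < n" for j
    proof -
      have "d (R (radj p d j)) \<le> j"
        using r(1,2)[of j] mono_lessThan[OF mono R_lt(1)[OF r(1)] r(1), of j] by simp
      then show ?thesis using that by (simp add: S_def)
    qed
    show "S j \<le> S i" if ij: "S j \<le> i" "i \<le> j" "j < n" for i j
    proof (cases "j \<noteq> n - 1 \<and> radj p d j < p - 1")
      case True
      then have Sj: "S j = d (R (radj p d j))" using ij by (simp add: S_def)
      then have a: "R (radj p d j) \<le> radj p d i" using r(3)[OF R_lt(2)[OF r(1)]] ij by simp
      have b: "radj p d i \<le> radj p d j" using r(2)[of i] ij r(3)[OF r(1)[of i], of j] by simp
      have c: "R (radj p d j) \<le> R (radj p d i)" using TamD(2)[OF o(3) a b r(1)] .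
      have "i \<noteq> n - 1" using ij True by linarith
      then have "S i = d (R (radj p d i))" using ij True b by (simp add: S_def)
      then show ?thesis using Sj mono_lessThan[OF mono c R_lt(2)[OF r(1)]] by simp
    next
      case False
      then show ?thesis using ij by (cases "j = n - 1") (auto simp: S_def)
    qed
  qed (use o S_last in auto)
  have ST: "S j \<le> T j" if "j < n" for j
  proof -
    consider "j = n - 1" | "j \<noteq> n - 1" "radj p d j < p - 1" | "j \<noteq> n - 1" "\<not> radj p d j < p - 1"
      by blast
    then show ?thesis
    proof cases
      case 1
      then show ?thesis using S_last TamD(3)[OF o(5)] by simp
    next
      case 2
      then have "d (R (radj p d j)) \<le> T j"
        using radj_next[OF mono, of j] d(2) by (intro RT) (auto simp: r(2))
      then show ?thesis using 2 that by (simp add: S_def)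
    qed (use that in \<open>simp add: S_def\<close>)
  qed
  \<comment> \<open>A new leaf before the last one has \<open>S j < j\<close>, so its right
    bracketing value is \<open>j\<close> itself and reaches no later old leaf.\<close>
  have b: "j \<in> d ` {..<p}" if j: "j < n" "k < p" "j < d k" "d k \<le> rbf n S j" for j k
  proof (rule ccontr)
    assume nin: "j \<notin> d ` {..<p}"
    have j0: "0 < j" using nin d(2) o(1) by (metis gr0I image_eqI lessThan_iff less_le_trans zero_less_one)
    have jn: "j < n - 1" using j dn[of k] by simp
    have "d (R (radj p d j)) \<noteq> j" using nin R_lt(2)[OF r(1)[of j]] by (metis imageI lessThan_iff)
    then have Sj: "S j \<noteq> j" using j0 nin jn R_lt[OF r(1)[of j]] j(1)
      by (auto simp: S_def split: if_splits)
    have "rbf n S j = j"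
      by (rule rbf_eqI) (use j(1) j0 jn Sj TamD(1)[OF S, of j] S_last in auto)
    then show False using j by simp
  qed
  \<comment> \<open>The first drop of \<open>S\<close> below \<open>d i\<close>, pulled back along
    \<open>d\<close>, is the first drop of \<open>R\<close> below \<open>i\<close>. The two end
    points are separate because \<open>rbf\<close> fixes them by convention.\<close>
  have c: "rbf p R i = radj p d (rbf n S (d i))" if i: "i < p" for i
  proof -
    consider "i = 0" | "i \<noteq> 0" "i = p - 1" | "0 < i" "i < p - 1" using i by linarith
    then show ?thesis
    proof cases
      case 1
      then show ?thesis using i o(1,4) d(2) rd[of 0] by (simp add: rbf_def)
    next
      case 2
      let ?q = "rbf n S (d i)"
      have "i \<le> radj p d ?q" using r(3)[OF i, of ?q] rbf_le[OF dn[OF i]] by simp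
      then have "radj p d ?q = p - 1" using r(1)[of ?q] 2 by simp
      then show ?thesis using 2 i by (simp add: rbf_def)
    next
      case 3
      have di: "0 < d i" "d i < n - 1"
        using order_inj_strict[OF d(1), of 0 i] order_inj_strict[OF d(1), of i "p - 1"] 3 d(2) dn[of "p - 1"] i
        by auto
      obtain q where q: "rbf n S (d i) = q" "d i \<le> q" "q < n" "S q < d i \<or> q = n - 1"
        "\<And>j. d i \<le> j \<Longrightarrow> j < q \<Longrightarrow> d i \<le> S j"
        by (rule rbf_cases[where S = S, OF di S_last]) blast
      have dle: "d x \<le> d y \<longleftrightarrow> x \<le> y" if "x < p" "y < p" for x y
        using that order_inj_strict[OF d(1), of y x] mono_lessThan[OF mono, of x y] by force
      have "rbf p R i = radj p d q"
      proof (rule rbf_eqI)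
        show "R (radj p d q) < i \<or> radj p d q = p - 1"
        proof (cases "q = n - 1")
          case True
          then show ?thesis using rn by simp
        next
          case False
          then have "S q < d i" using q by simp
          then show ?thesis using False q(3) R_lt[OF r(1)[of q]] dle[of i "R (radj p d q)"] i r(1)[of q]
            by (auto simp: S_def split: if_splits)
        qed
        show "i \<le> R k" if k: "i \<le> k" "k < radj p d q" for k
        proof -
          have kp: "k < p - 1" using k r(1)[of q] by simp
          have "d k < d (radj p d q)" using order_inj_strict[OF d(1)] k r(1) by blast
          then have kq: "d k < q" using r(2)[of q] by simp
          have "d i \<le> d k" using dle k kp i by simp
          then have "d i \<le> S (d k)" using q(5) kq by simp
          moreover have "k < p" "d k < n - 1" using kp kq q(3) by simp_all
          ultimately have "d i \<le> d (R k)" using rd[of k] kp by (auto simp: S_def split: if_splits)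
          then show ?thesis using dle[of i "R k"] R_lt[of k] kp i by simp
        qed
      qed (use 3 r(1,3) i q(2) TamD(3)[OF o(3)] in auto)
      then show ?thesis using q(1) by simp
    qed
  qed
  have "bij_betw d w v"
    using d(1) v o(2) by (auto simp: order_inj_def bij_betw_def intro: inj_on_subset)
  then have "swell_morphism (p, w, R) (n, v, S) d"
    using d b c by auto
  then show ?thesis using S ST by (auto simp: tam_le_def)
qed

text \<open>The image is enumerated by its sorted list. As \<open>f 0 = 0\<close> is the least
  value, the enumeration starts at 0, which an Fsk-injection requires.\<close>

lemma epi_mono_factorization:
  assumes f: "f \<in> {..<m} \<rightarrow>\<^sub>E {..<n}" "mono_on {..<m} f" "f 0 = 0" "1 \<le> m"
  obtains p s d where "1 \<le> p" "order_surj m p s" "order_inj p n d" "d 0 = 0"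
    "\<And>i. i < m \<Longrightarrow> f i = d (s i)"
proof -
  define xs where "xs = sorted_list_of_set (f ` {..<m})"
  have xs: "set xs = f ` {..<m}" "sorted_wrt (<) xs"
    by (simp_all add: xs_def strict_sorted_iff)
  define p where "p = length xs"
  have lt: "xs ! j < xs ! k" if "j < k" "k < p" for j k
    using sorted_wrt_nth_less[OF xs(2)] that by (auto simp: p_def)
  have le: "xs ! j \<le> xs ! k \<longleftrightarrow> j \<le> k" if "j < p" "k < p" for j k
    using lt[of j k] lt[of k j] that by (metis le_neq_implies_less leD less_imp_le_nat nat_le_linear)
  have ex: "\<exists>k<p. xs ! k = f i" if "i < m" for i
    using xs(1) that by (metis imageI in_set_conv_nth lessThan_iff p_def)
  define s where "s = (\<lambda>i\<in>{..<m}. SOME k. k < p \<and> xs ! k = f i)"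
  have s: "s i < p" "xs ! (s i) = f i" if "i < m" for i
    using someI_ex[OF ex[OF that]] that by (auto simp: s_def)
  define d where "d = (\<lambda>k\<in>{..<p}. xs ! k)"
  have hit: "\<exists>i<m. s i = k" if "k < p" for k
  proof -
    have "xs ! k \<in> f ` {..<m}" using that xs(1) by (metis nth_mem p_def)
    then obtain i where i: "i < m" "xs ! k = f i" by auto
    then have "s i = k" using le[of "s i" k] le[of k "s i"] s[of i] that by simp
    then show ?thesis using i by blast
  qed
  show ?thesis
  proof (rule that)
    show p: "1 \<le> p" using s(1)[of 0] f(4) by simp
    have "mono_on {..<m} s"
    proof (rule mono_onI)
      fix i j assume "i \<in> {..<m}" "j \<in> {..<m}" "i \<le> j"
      then show "s i \<le> s j"
        using mono_lessThan[OF f(2), of i j] s[of i] s[of j] le[of "s i" "s j"] by auto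
    qed
    moreover have "s ` {..<m} = {..<p}" using hit s(1) by (force simp: image_iff)
    ultimately show "order_surj m p s" using s(1) by (auto simp: order_surj_def s_def)
    have "d k < n" if k: "k < p" for k
    proof -
      obtain i where "i < m" "s i = k" using hit[OF k] by blast
      then show ?thesis using s(2)[of i] f(1) k by (auto simp: d_def)
    qed
    then have "d \<in> {..<p} \<rightarrow>\<^sub>E {..<n}" by (auto simp: d_def)
    moreover have "mono_on {..<p} d" by (rule mono_onI) (simp add: d_def le)
    moreover have "inj_on d {..<p}" by (rule inj_onI) (metis d_def le le_antisym lessThan_iff order_refl restrict_apply')
    ultimately show "order_inj p n d" by (simp add: order_inj_def)
    show "d 0 = 0" using le[of 0 "s 0"] s[of 0] p f(3,4) by (simp add: d_def)
    show "f i = d (s i)" if "i < m" for i using s[OF that] by (simp add: d_def)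
  qed
qed

proposition fsk_morphism_iff_lax_map:
  assumes A: "A \<in> fsk_objects" and B: "B \<in> fsk_objects"
  shows "fsk_morphism A B f \<longleftrightarrow> lax_map A B f"
proof
  assume "fsk_morphism A B f"
  then show "lax_map A B f"
    using fsk_surjection_lax fsk_injection_lax lax_map_comp A B
    unfolding fsk_morphism_def by blast
next
  assume f: "lax_map A B f"
  obtain m u S n v T where AB: "A = (m, u, S)" "B = (n, v, T)" by (cases A, cases B) auto
  have o: "1 \<le> m" "u \<subseteq> {..<m}" "S \<in> Tam m" using A AB by (auto simp: fsk_objects_def)
  have fe: "f \<in> {..<m} \<rightarrow>\<^sub>E {..<n}" "mono_on {..<m} f" "f 0 = 0" "f ` u = v"
    "\<And>i. i \<in> u \<Longrightarrow> i + 1 < m \<Longrightarrow> f i < f (i + 1)"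
    "\<And>i j. i + 1 < m \<Longrightarrow> f i \<le> j \<Longrightarrow> j < f (i + 1) \<Longrightarrow> f (S i) \<le> T j"
    using f AB by auto
  obtain p s d where p: "1 \<le> p" and s: "order_surj m p s" and d: "order_inj p n d" "d 0 = 0"
    and ds: "\<And>i. i < m \<Longrightarrow> f i = d (s i)"
    using epi_mono_factorization[OF fe(1-3) o(1)] by blast
  note sf = order_surj_facts[OF s p]
  define R where "R = (\<lambda>j\<in>{..<p}. s (S (radj m s j)))"
  have su: "s i < s (i + 1)" if i: "i \<in> u" "i + 1 < m" for i
  proof -
    have "d (s i) \<noteq> d (s (i + 1))" using fe(5)[OF i] ds i by simp
    then have "s i \<noteq> s (i + 1)" by auto
    then show ?thesis using mono_lessThan[OF sf(2), of i "i + 1"] i by simp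
  qed
  have Am: "(m, u, S) \<in> fsk_objects" "(n, v, T) \<in> fsk_objects" using A B AB by auto
  note P = fsk_surjectionI[OF Am(1) s p su R_def]
  have "d ` s ` u = f ` u" using ds o(2) unfolding image_image by (intro image_cong) auto
  then have dv: "d ` s ` u = v" using fe(4) by simp
  have "fsk_injection (p, s ` u, R) (n, v, T) d"
  proof (rule fsk_injectionI[OF P(1) Am(2) d dv])
    fix k j assume k: "k + 1 < p" "d k \<le> j" "j < d (k + 1)"
    \<comment> \<open>The last element of the fibre over \<open>k\<close>: its successor lies over
      something larger, so \<open>f i \<le> j < f (i + 1)\<close> and the inequality for
      \<open>f\<close> applies.\<close>
    define i where "i = radj m s k"
    have i: "i < m" "s i = k" using sf(5,6)[of k] k by (auto simp: i_def)
    have "i \<noteq> m - 1" using sf(8) i k by auto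
    then have i1: "i + 1 < m" using i by simp
    have "\<not> s (i + 1) \<le> k" using sf(7)[OF i1, of k] by (simp add: i_def)
    then have "k + 1 \<le> s (i + 1)" by simp
    then have "d (k + 1) \<le> d (s (i + 1))"
      using d(1) sf(1)[OF i1] mono_lessThan[of p d] by (auto simp: order_inj_def)
    then have "f (S i) \<le> T j" using fe(6)[OF i1, of j] ds[OF i1] ds[OF i(1)] i k by simp
    moreover have "S i < m" using TamD(1)[OF o(3) i(1)] i by simp
    ultimately show "d (R k) \<le> T j" using ds k by (simp add: R_def i_def)
  qed
  moreover have "f = compose {..<fst A} d s"
    using ds fe(1) AB by (auto simp: compose_def fun_eq_iff PiE_def extensional_def)
  ultimately show "fsk_morphism A B f"
    using P AB unfolding fsk_morphism_def by blast
qed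

section \<open>Comb-shaped tensors in a skew monoidal category\<close>

context category
begin

text \<open>The axioms speak of hom-sets; versions with \<open>Arr\<close>, \<open>Dom\<close> and
  \<open>Cod\<close> have premises that the simplifier can discharge. The resulting normal form
  brackets composites to the right and fuses tensors of arrows.\<close>

lemma comp_arr [simp]:
  assumes "f \<in> Arr C" "g \<in> Arr C" "Dom C g = Cod C f"
  shows "g \<cdot> f \<in> Arr C" "Dom C (g \<cdot> f) = Dom C f" "Cod C (g \<cdot> f) = Cod C g"
  using comp_hom[of f "Dom C f" "Cod C f" g "Cod C g"] assms by (auto simp: Hom_def)

lemma id_arr [simp]:
  assumes "x \<in> Obj C"
  shows "Id C x \<in> Arr C" "Dom C (Id C x) = x" "Cod C (Id C x) = x"
  using id_hom[OF assms] by (auto simp: Hom_def)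

lemma comp_id_arr [simp]: "f \<in> Arr C \<Longrightarrow> Dom C f = x \<Longrightarrow> f \<cdot> Id C x = f"
  using comp_id[of f x "Cod C f"] by (auto simp: Hom_def)

lemma id_comp_arr [simp]: "f \<in> Arr C \<Longrightarrow> Cod C f = x \<Longrightarrow> Id C x \<cdot> f = f"
  using id_comp[of f "Dom C f" x] by (auto simp: Hom_def)

lemma comp_assoc_arr [simp]:
  assumes "f \<in> Arr C" "g \<in> Arr C" "h \<in> Arr C" "Dom C g = Cod C f" "Dom C h = Cod C g"
  shows "(h \<cdot> g) \<cdot> f = h \<cdot> (g \<cdot> f)"
  using comp_assoc[of f "Dom C f" "Cod C f" g "Cod C g" h "Cod C h"] assms by (auto simp: Hom_def)

lemma obj_arr [simp]: "f \<in> Arr C \<Longrightarrow> Dom C f \<in> Obj C" "f \<in> Arr C \<Longrightarrow> Cod C f \<in> Obj C"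
  by (simp_all add: dom_obj cod_obj)

end

context skew_monoidal_category
begin

lemma unit_obj' [simp]: "Unit C \<in> Obj C" by (rule unit_obj)

lemma tensor_obj' [simp]: "x \<in> Obj C \<Longrightarrow> y \<in> Obj C \<Longrightarrow> x \<otimes> y \<in> Obj C" by (rule tensor_obj)

lemma tensor_arr [simp]:
  assumes "f \<in> Arr C" "g \<in> Arr C"
  shows "f \<boxtimes> g \<in> Arr C" "Dom C (f \<boxtimes> g) = Dom C f \<otimes> Dom C g" "Cod C (f \<boxtimes> g) = Cod C f \<otimes> Cod C g"
  using tensor_hom[of f "Dom C f" "Cod C f" g "Dom C g" "Cod C g"] assms by (auto simp: Hom_def)

lemma tensor_id' [simp]: "x \<in> Obj C \<Longrightarrow> y \<in> Obj C \<Longrightarrow> Id C x \<boxtimes> Id C y = Id C (x \<otimes> y)"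
  by (rule tensor_id)

lemma tensor_comp_arr [simp]:
  assumes "f \<in> Arr C" "f' \<in> Arr C" "g \<in> Arr C" "g' \<in> Arr C" "Dom C f' = Cod C f" "Dom C g' = Cod C g"
  shows "(f' \<boxtimes> g') \<cdot> (f \<boxtimes> g) = (f' \<cdot> f) \<boxtimes> (g' \<cdot> g)"
  using tensor_comp[of f "Dom C f" "Cod C f" f' "Cod C f'" g "Dom C g" "Cod C g" g' "Cod C g'"] assms
  by (auto simp: Hom_def)

text \<open>With composites bracketed to the right, two tensors to be fused usually stand in front
  of a further factor \<open>h\<close>; this variant fuses them in place.\<close>

lemma tensor_comp_arr2 [simp]:
  assumes "f \<in> Arr C" "f' \<in> Arr C" "g \<in> Arr C" "g' \<in> Arr C" "Dom C f' = Cod C f" "Dom C g' = Cod C g"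
    "h \<in> Arr C" "Cod C h = Dom C f \<otimes> Dom C g"
  shows "(f' \<boxtimes> g') \<cdot> ((f \<boxtimes> g) \<cdot> h) = ((f' \<cdot> f) \<boxtimes> (g' \<cdot> g)) \<cdot> h"
  using assms by (simp flip: comp_assoc_arr)

lemma assoc_arr [simp]:
  assumes "x \<in> Obj C" "y \<in> Obj C" "z \<in> Obj C"
  shows "Assoc C x y z \<in> Arr C" "Dom C (Assoc C x y z) = x \<otimes> y \<otimes> z"
    "Cod C (Assoc C x y z) = x \<otimes> (y \<otimes> z)"
  using assoc_hom[OF assms] by (auto simp: Hom_def)

lemma lunit_arr [simp]:
  assumes "x \<in> Obj C"
  shows "Lunit C x \<in> Arr C" "Dom C (Lunit C x) = Unit C \<otimes> x" "Cod C (Lunit C x) = x"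
  using lunit_hom[OF assms] by (auto simp: Hom_def)

lemma runit_arr [simp]:
  assumes "x \<in> Obj C"
  shows "Runit C x \<in> Arr C" "Dom C (Runit C x) = x" "Cod C (Runit C x) = x \<otimes> Unit C"
  using runit_hom[OF assms] by (auto simp: Hom_def)

lemma assoc_nat:
  assumes "f \<in> Arr C" "g \<in> Arr C" "h \<in> Arr C"
  shows "Assoc C (Cod C f) (Cod C g) (Cod C h) \<cdot> ((f \<boxtimes> g) \<boxtimes> h)
    = (f \<boxtimes> (g \<boxtimes> h)) \<cdot> Assoc C (Dom C f) (Dom C g) (Dom C h)"
  using assms by (intro assoc_natural) (auto simp: Hom_def)

lemma lunit_nat:
  assumes "f \<in> Arr C"
  shows "Lunit C (Cod C f) \<cdot> (Id C (Unit C) \<boxtimes> f) = f \<cdot> Lunit C (Dom C f)"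
  using assms by (intro lunit_natural) (auto simp: Hom_def)

lemma runit_nat:
  assumes "f \<in> Arr C"
  shows "Runit C (Cod C f) \<cdot> f = (f \<boxtimes> Id C (Unit C)) \<cdot> Runit C (Dom C f)"
  using assms by (intro runit_natural) (auto simp: Hom_def)

end

text \<open>Contexts are lists of right-hand factors with the outermost factor first.\<close>

primrec comb_ob :: "('o, 'a, 'z) skew_monoidal_scheme \<Rightarrow> 'o \<Rightarrow> 'o list \<Rightarrow> 'o" where
  "comb_ob C x [] = x"
| "comb_ob C x (y # D) = Tensor C (comb_ob C x D) y"

primrec whisker :: "('o, 'a, 'z) skew_monoidal_scheme \<Rightarrow> 'a \<Rightarrow> 'o list \<Rightarrow> 'a" where
  "whisker C f [] = f"
| "whisker C f (y # D) = Tensor_Arr C (whisker C f D) (Id C y)"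

text \<open>
  \<open>split_arr C x D\<close> goes from \<open>x \<otimes> D\<^sub>n \<otimes> \<dots> \<otimes> D\<^sub>1\<close> to \<open>x \<otimes> (I \<otimes> D\<^sub>n \<otimes> \<dots> \<otimes> D\<^sub>1)\<close>: a unit is created
  next to \<open>x\<close>, and everything behind it is reassociated.
\<close>

primrec split_arr :: "('o, 'a, 'z) skew_monoidal_scheme \<Rightarrow> 'o \<Rightarrow> 'o list \<Rightarrow> 'a" where
  "split_arr C x [] = Runit C x"
| "split_arr C x (y # D) =
     Comp C (Assoc C x (comb_ob C (Unit C) D) y) (Tensor_Arr C (split_arr C x D) (Id C y))"

lemma comb_ob_append: "comb_ob C x (E @ D) = comb_ob C (comb_ob C x D) E"
  by (induction E) auto

lemma whisker_append: "whisker C f (E @ D) = whisker C (whisker C f D) E"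
  by (induction E) auto

context skew_monoidal_category
begin

lemma comb_ob_obj [simp]: "x \<in> Obj C \<Longrightarrow> set D \<subseteq> Obj C \<Longrightarrow> comb_ob C x D \<in> Obj C"
  by (induction D) auto

lemma whisker_arr [simp]:
  assumes "f \<in> Arr C" "set D \<subseteq> Obj C"
  shows "whisker C f D \<in> Arr C" "Dom C (whisker C f D) = comb_ob C (Dom C f) D"
    "Cod C (whisker C f D) = comb_ob C (Cod C f) D"
  using assms by (induction D) auto

lemma split_arr_arr [simp]:
  assumes "x \<in> Obj C" "set D \<subseteq> Obj C"
  shows "split_arr C x D \<in> Arr C" "Dom C (split_arr C x D) = comb_ob C x D"
    "Cod C (split_arr C x D) = x \<otimes> comb_ob C (Unit C) D"
  using assms by (induction D) auto

text \<open>Naturality of \<rho> starts the induction and naturality of \<alpha> adds one factor.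
  The use is to move an arrow on the head across the splitting.\<close>

lemma split_arr_nat:
  assumes "f \<in> Arr C" "set D \<subseteq> Obj C"
  shows "split_arr C (Cod C f) D \<cdot> whisker C f D
    = (f \<boxtimes> Id C (comb_ob C (Unit C) D)) \<cdot> split_arr C (Dom C f) D"
  using assms(2)
proof (induction D)
  case Nil
  then show ?case using runit_nat assms by simp
next
  case (Cons y D)
  let ?i = "comb_ob C (Unit C) D"
  have [simp]: "y \<in> Obj C" "set D \<subseteq> Obj C" "f \<in> Arr C" using Cons assms by auto
  have "split_arr C (Cod C f) (y # D) \<cdot> whisker C f (y # D)
    = Assoc C (Cod C f) ?i y \<cdot> ((split_arr C (Cod C f) D \<cdot> whisker C f D) \<boxtimes> Id C y)"
    by simp
  also have "\<dots> = Assoc C (Cod C f) ?i y \<cdot> (((f \<boxtimes> Id C ?i) \<boxtimes> Id C y) \<cdot> (split_arr C (Dom C f) D \<boxtimes> Id C y))"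
    using Cons by simp
  also have "\<dots> = (Assoc C (Cod C f) ?i y \<cdot> ((f \<boxtimes> Id C ?i) \<boxtimes> Id C y)) \<cdot> (split_arr C (Dom C f) D \<boxtimes> Id C y)"
    by (rule comp_assoc_arr[symmetric]) simp_all
  also have "\<dots> = (f \<boxtimes> Id C (?i \<otimes> y)) \<cdot> split_arr C (Dom C f) (y # D)"
    using assoc_nat[of f "Id C ?i" "Id C y"] by simp
  finally show ?case by simp
qed

text \<open>\<lambda> cancels the planted unit: \<open>lunit_runit\<close> is the base case and
  \<open>lunit_assoc\<close> carries the induction. This reduces a cut of \<lambda> against the
  tensor rule.\<close>

lemma lunit_split_arr:
  assumes "set D \<subseteq> Obj C"
  shows "Lunit C (comb_ob C (Unit C) D) \<cdot> split_arr C (Unit C) D = Id C (comb_ob C (Unit C) D)"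
  using assms
proof (induction D)
  case Nil
  then show ?case using lunit_runit by simp
next
  case (Cons y D)
  let ?i = "comb_ob C (Unit C) D"
  have [simp]: "y \<in> Obj C" "set D \<subseteq> Obj C" using Cons by auto
  have "Lunit C (?i \<otimes> y) \<cdot> (Assoc C (Unit C) ?i y \<cdot> (split_arr C (Unit C) D \<boxtimes> Id C y))
    = (Lunit C (?i \<otimes> y) \<cdot> Assoc C (Unit C) ?i y) \<cdot> (split_arr C (Unit C) D \<boxtimes> Id C y)"
    by (rule comp_assoc_arr[symmetric]) simp_all
  also have "\<dots> = Id C (?i \<otimes> y)" using lunit_assoc[of ?i y] Cons by simp
  finally show ?case by simp
qed

text \<open>Induction on the outer context \<open>D\<close>, with \<open>assoc_runit\<close> at the
  base and the pentagon moving one more factor across. This is the equation that lets two nested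
  tensor rules be rebracketed.\<close>

lemma split_arr_split_arr:
  assumes "x \<in> Obj C" "set D \<subseteq> Obj C" "set E \<subseteq> Obj C"
  shows "Assoc C x (comb_ob C (Unit C) E) (comb_ob C (Unit C) D) \<cdot>
      ((split_arr C x E \<boxtimes> Id C (comb_ob C (Unit C) D)) \<cdot> split_arr C (comb_ob C x E) D)
    = (Id C x \<boxtimes> split_arr C (comb_ob C (Unit C) E) D) \<cdot> split_arr C x (D @ E)"
  using assms(2)
proof (induction D)
  case Nil
  let ?e = "comb_ob C (Unit C) E"
  have [simp]: "x \<in> Obj C" "set E \<subseteq> Obj C" using assms by auto
  have "Assoc C x ?e (Unit C) \<cdot> ((split_arr C x E \<boxtimes> Id C (Unit C)) \<cdot> Runit C (comb_ob C x E))
    = Assoc C x ?e (Unit C) \<cdot> (Runit C (x \<otimes> ?e) \<cdot> split_arr C x E)"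
    using runit_nat[of "split_arr C x E"] by simp
  also have "\<dots> = (Id C x \<boxtimes> Runit C ?e) \<cdot> split_arr C x E"
    using assoc_runit[of x ?e] by (simp flip: comp_assoc_arr)
  finally show ?case by simp
next
  case (Cons y D)
  let ?e = "comb_ob C (Unit C) E" and ?d = "comb_ob C (Unit C) D" and ?xe = "comb_ob C x E"
  let ?s = "split_arr C x E" and ?t = "split_arr C ?xe D" and ?u = "split_arr C ?e D" and ?v = "split_arr C x (D @ E)"
  have [simp]: "x \<in> Obj C" "set E \<subseteq> Obj C" "y \<in> Obj C" "set D \<subseteq> Obj C" using assms Cons by auto
  have de [simp]: "comb_ob C (Unit C) (D @ E) = comb_ob C ?e D" "comb_ob C x (D @ E) = comb_ob C ?xe D"
    by (simp_all add: comb_ob_append)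
  have "Assoc C x ?e (?d \<otimes> y) \<cdot> ((?s \<boxtimes> Id C (?d \<otimes> y)) \<cdot> (Assoc C ?xe ?d y \<cdot> (?t \<boxtimes> Id C y)))
    = Assoc C x ?e (?d \<otimes> y) \<cdot> (((?s \<boxtimes> Id C (?d \<otimes> y)) \<cdot> Assoc C ?xe ?d y) \<cdot> (?t \<boxtimes> Id C y))"
    by simp
  also have "\<dots> = Assoc C x ?e (?d \<otimes> y) \<cdot> ((Assoc C (x \<otimes> ?e) ?d y \<cdot> ((?s \<boxtimes> Id C ?d) \<boxtimes> Id C y)) \<cdot> (?t \<boxtimes> Id C y))"
    using assoc_nat[of ?s "Id C ?d" "Id C y"] by simp
  also have "\<dots> = (Assoc C x ?e (?d \<otimes> y) \<cdot> Assoc C (x \<otimes> ?e) ?d y) \<cdot> (((?s \<boxtimes> Id C ?d) \<cdot> ?t) \<boxtimes> Id C y)"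
    by simp
  also have "\<dots> = ((Id C x \<boxtimes> Assoc C ?e ?d y) \<cdot> Assoc C x (?e \<otimes> ?d) y \<cdot> (Assoc C x ?e ?d \<boxtimes> Id C y))
      \<cdot> (((?s \<boxtimes> Id C ?d) \<cdot> ?t) \<boxtimes> Id C y)"
    by (subst pentagon) simp_all
  also have "\<dots> = (Id C x \<boxtimes> Assoc C ?e ?d y) \<cdot> (Assoc C x (?e \<otimes> ?d) y \<cdot>
      ((Assoc C x ?e ?d \<cdot> ((?s \<boxtimes> Id C ?d) \<cdot> ?t)) \<boxtimes> Id C y))"
    by simp
  also have "\<dots> = (Id C x \<boxtimes> Assoc C ?e ?d y) \<cdot> (Assoc C x (?e \<otimes> ?d) y \<cdot>
      (((Id C x \<boxtimes> ?u) \<boxtimes> Id C y) \<cdot> (?v \<boxtimes> Id C y)))"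
    using Cons by simp
  also have "\<dots> = (Id C x \<boxtimes> Assoc C ?e ?d y) \<cdot> ((Assoc C x (?e \<otimes> ?d) y \<cdot>
      ((Id C x \<boxtimes> ?u) \<boxtimes> Id C y)) \<cdot> (?v \<boxtimes> Id C y))"
    by simp
  also have "\<dots> = (Id C x \<boxtimes> Assoc C ?e ?d y) \<cdot> (((Id C x \<boxtimes> (?u \<boxtimes> Id C y)) \<cdot> Assoc C x (comb_ob C ?e D) y)
      \<cdot> (?v \<boxtimes> Id C y))"
    using assoc_nat[of "Id C x" ?u "Id C y"] by simp
  also have "\<dots> = (Id C x \<boxtimes> split_arr C ?e (y # D)) \<cdot> split_arr C x ((y # D) @ E)"
    by simp
  finally show ?case by simp
qed

end

section \<open>Normal forms of arrows between trees\<close>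

datatype tree = Gen | One | Ten tree tree

primrec comb :: "tree \<Rightarrow> tree list \<Rightarrow> tree" where
  "comb t [] = t"
| "comb t (y # D) = Ten (comb t D) y"

lemma comb_append: "comb t (E @ D) = comb (comb t D) E"
  by (induction E) auto

primrec interp :: "('o, 'a, 'z) skew_monoidal_scheme \<Rightarrow> 'o \<Rightarrow> tree \<Rightarrow> 'o" where
  "interp C c Gen = c"
| "interp C c One = Unit C"
| "interp C c (Ten s t) = Tensor C (interp C c s) (interp C c t)"

abbreviation interps :: "('o, 'a, 'z) skew_monoidal_scheme \<Rightarrow> 'o \<Rightarrow> tree list \<Rightarrow> 'o list" where
  "interps C c \<equiv> map (interp C c)"

lemma interp_comb [simp]: "interp C c (comb t D) = comb_ob C (interp C c t) (interps C c D)"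
  by (induction D) auto

text \<open>
  The rule \<open>nf_ten\<close> is the right rule for the tensor in the sequent calculus of skew monoidal
  categories, and \<open>nf_lunit\<close> its shift of a formula into the stoup: a tree is a left comb over its
  first leaf, and the remaining right-hand factors are the context.
\<close>

inductive nf :: "('o, 'a, 'z) skew_monoidal_scheme \<Rightarrow> 'o \<Rightarrow> tree \<Rightarrow> tree \<Rightarrow> 'a \<Rightarrow> bool"
  for C c where
  nf_gen: "nf C c Gen Gen (Id C c)"
| nf_unit: "nf C c One One (Id C (Unit C))"
| nf_lunit: "nf C c (comb t D) w f \<Longrightarrow>
    nf C c (comb (Ten One t) D) w (Comp C f (whisker C (Lunit C (interp C c t)) (interps C c D)))"
| nf_ten: "nf C c s t f \<Longrightarrow> nf C c (comb One D) w g \<Longrightarrow>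
    nf C c (comb s D) (Ten t w) (Comp C (Tensor_Arr C f g) (split_arr C (interp C c s) (interps C c D)))"

locale pointed_skew_monoidal_category = skew_monoidal_category C
  for C :: "('o, 'a, 'z) skew_monoidal_scheme" (structure) +
  fixes c :: 'o
  assumes point_obj [simp]: "c \<in> Obj C"
begin

abbreviation "I \<equiv> interp C c"
abbreviation "Is \<equiv> interps C c"

lemma interp_obj [simp]: "I t \<in> Obj C" by (induction t) auto
lemma interps_obj [simp]: "set (Is D) \<subseteq> Obj C" "I ` A \<subseteq> Obj C" by auto

lemma nf_arr: "nf C c s t f \<Longrightarrow> f \<in> Arr C \<and> Dom C f = I s \<and> Cod C f = I t"
  by (induction rule: nf.induct) auto

lemmas nf_arrD [simp] = nf_arr[THEN conjunct1] nf_arr[THEN conjunct2, THEN conjunct1]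
  nf_arr[THEN conjunct2, THEN conjunct2]

text \<open>In the tensor case the source is split behind \<open>s\<close>; the right premise is
  then the left unit arrow at \<open>t\<close>, and \<open>runit_assoc_lunit\<close> says that the
  composite is the identity.\<close>

lemma nf_id: "nf C c t t (Id C (I t))"
proof (induction t)
  case (Ten s t)
  have "nf C c (comb (Ten One t) []) t (Id C (I t) \<cdot> whisker C (Lunit C (I t)) (Is []))"
    by (rule nf_lunit) (use Ten in simp)
  then have "nf C c (comb One [t]) t (Lunit C (I t))" by simp
  from nf_ten[OF Ten(1) this]
  have "nf C c (Ten s t) (Ten s t) ((Id C (I s) \<boxtimes> Lunit C (I t)) \<cdot> split_arr C (I s) [I t])"
    by simp
  then show ?case using runit_assoc_lunit[of "I s" "I t"] by simp
qed (use nf_gen nf_unit in auto)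

text \<open>
  Naturality of \<open>split_arr\<close> moves an application of \<open>nf_lunit\<close> in the left premise of \<open>nf_ten\<close> below
  that rule.
\<close>

lemma ten_whisker_lunit:
  assumes "f \<in> Arr C" "g \<in> Arr C" "Dom C f = I (comb t D)" "Dom C g = I (comb One E)"
  shows "((f \<cdot> whisker C (Lunit C (I t)) (Is D)) \<boxtimes> g) \<cdot> split_arr C (I (comb (Ten One t) D)) (Is E)
    = ((f \<boxtimes> g) \<cdot> split_arr C (I (comb t D)) (Is E)) \<cdot> whisker C (Lunit C (I t)) (Is (E @ D))"
proof -
  let ?l = "whisker C (Lunit C (I t)) (Is D)"
  have "((f \<boxtimes> g) \<cdot> split_arr C (I (comb t D)) (Is E)) \<cdot> whisker C (Lunit C (I t)) (Is (E @ D))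
    = (f \<boxtimes> g) \<cdot> (split_arr C (I (comb t D)) (Is E) \<cdot> whisker C ?l (Is E))"
    using assms by (simp add: whisker_append)
  also have "\<dots> = (f \<boxtimes> g) \<cdot> ((?l \<boxtimes> Id C (comb_ob C (Unit C) (Is E))) \<cdot> split_arr C (I (comb (Ten One t) D)) (Is E))"
    using split_arr_nat[of ?l "Is E"] by simp
  also have "\<dots> = ((f \<cdot> ?l) \<boxtimes> g) \<cdot> split_arr C (I (comb (Ten One t) D)) (Is E)"
    using assms by simp
  finally show ?thesis by simp
qed

text \<open>The arrow \<open>h\<close> is carried along so that one permutation step serves the cuts
  of both \<lambda> and \<alpha> against the tensor rule.\<close>

lemma nf_lunit_below:
  assumes "nf C c (comb (comb t D) E) w (h \<cdot> ((f \<boxtimes> g) \<cdot> split_arr C (I (comb t D)) (Is E)))"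
    and "f \<in> Arr C" "g \<in> Arr C" "Dom C f = I (comb t D)" "Dom C g = I (comb One E)"
    and "h \<in> Arr C" "Dom C h = Cod C f \<otimes> Cod C g"
  shows "nf C c (comb (comb (Ten One t) D) E) w
    (h \<cdot> (((f \<cdot> whisker C (Lunit C (I t)) (Is D)) \<boxtimes> g) \<cdot> split_arr C (I (comb (Ten One t) D)) (Is E)))"
proof -
  have "nf C c (comb t (E @ D)) w (h \<cdot> ((f \<boxtimes> g) \<cdot> split_arr C (I (comb t D)) (Is E)))"
    using assms(1) by (simp add: comb_append)
  from nf_lunit[OF this] show ?thesis
    unfolding ten_whisker_lunit[OF assms(2-5)] using assms
    by (simp add: comb_append comb_ob_append)
qed

section \<open>Cut elimination\<close>

text \<open>A derivation into the unit consists of the unit axiom followed by left unit rules. At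
  the axiom the planted unit cancels and \<open>g\<close> remains; a left unit rule is moved below
  the tensor rule.\<close>

lemma nf_lunit_ten:
  assumes "nf C c s One f" "nf C c (comb One E) w g"
  shows "nf C c (comb s E) w (Lunit C (I w) \<cdot> ((f \<boxtimes> g) \<cdot> split_arr C (I s) (Is E)))"
  using assms
proof (induction s One f rule: nf.induct)
  case nf_unit
  have "Lunit C (I w) \<cdot> ((Id C (Unit C) \<boxtimes> g) \<cdot> split_arr C (Unit C) (Is E))
    = (Lunit C (I w) \<cdot> (Id C (Unit C) \<boxtimes> g)) \<cdot> split_arr C (Unit C) (Is E)"
    using nf_unit by (intro comp_assoc_arr[symmetric]) simp_all
  also have "\<dots> = g \<cdot> (Lunit C (comb_ob C (Unit C) (Is E)) \<cdot> split_arr C (Unit C) (Is E))"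
    using nf_unit lunit_nat[of g] by simp
  also have "\<dots> = g" using lunit_split_arr[of "Is E"] nf_unit by simp
  finally show ?case using nf_unit by simp
next
  case (nf_lunit t D f)
  show ?case
    by (rule nf_lunit_below[OF nf_lunit(2)[OF nf_lunit(3)]]) (use nf_lunit in simp_all)
qed

text \<open>Admissibility of cut, phrased as a closure property of the arrow \<open>h\<close>.
  Quantifying over all derivations into \<open>t\<close> makes closure under composition immediate,
  so derivations have to be inspected only for the structure maps and the tensor. A stable arrow is
  a normal form because identities are.\<close>

definition stable :: "tree \<Rightarrow> tree \<Rightarrow> 'a \<Rightarrow> bool" where
  "stable t w h \<longleftrightarrow> h \<in> Arr C \<and> Dom C h = I t \<and> Cod C h = I w \<and>
     (\<forall>s f. nf C c s t f \<longrightarrow> nf C c s w (h \<cdot> f))"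

lemma stableI:
  assumes "h \<in> Arr C" "Dom C h = I t" "Cod C h = I w" "\<And>s f. nf C c s t f \<Longrightarrow> nf C c s w (h \<cdot> f)"
  shows "stable t w h"
  using assms by (simp add: stable_def)

lemma stable_arr [simp]:
  assumes "stable t w h"
  shows "h \<in> Arr C" "Dom C h = I t" "Cod C h = I w"
  using assms by (auto simp: stable_def)

lemma stableD: "stable t w h \<Longrightarrow> nf C c s t f \<Longrightarrow> nf C c s w (h \<cdot> f)"
  unfolding stable_def by blast

lemma stable_nf: "stable t w h \<Longrightarrow> nf C c t w h"
  using stableD[OF _ nf_id, of t w h] by simp

lemma stable_id: "stable t t (Id C (I t))"
  by (rule stableI) simp_all

lemma stable_comp:
  assumes "stable t w h" "stable w v k"
  shows "stable t v (k \<cdot> h)"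
proof (rule stableI)
  fix s f assume f: "nf C c s t f"
  from stableD[OF assms(2) stableD[OF assms(1) f]]
  show "nf C c s v ((k \<cdot> h) \<cdot> f)" using assms f by simp
qed (use assms in simp_all)

text \<open>The left unit rule acts on the source, hence commutes with composition by
  \<open>h\<close> at the target. Only derivations ending with the tensor rule remain.\<close>

lemma stable_tenI:
  assumes h: "h \<in> Arr C" "Dom C h = I t \<otimes> I w" "Cod C h = I v"
    and ten: "\<And>s D f g. nf C c s t f \<Longrightarrow> nf C c (comb One D) w g \<Longrightarrow>
      nf C c (comb s D) v (h \<cdot> ((f \<boxtimes> g) \<cdot> split_arr C (I s) (Is D)))"
  shows "stable (Ten t w) v h"
proof (rule stableI)
  fix s f assume "nf C c s (Ten t w) f"
  then show "nf C c s v (h \<cdot> f)"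
  proof (induction s "Ten t w" f rule: nf.induct)
    case (nf_lunit u D f)
    have "nf C c (comb (Ten One u) D) v ((h \<cdot> f) \<cdot> whisker C (Lunit C (I u)) (Is D))"
      by (rule nf.nf_lunit[OF nf_lunit(2)])
    then show ?case using nf_lunit h by simp
  qed (rule ten)
qed (use h in simp_all)

lemma stable_lunit: "stable (Ten One t) t (Lunit C (I t))"
  by (rule stable_tenI) (simp_all add: nf_lunit_ten)

text \<open>By naturality of \<rho>, composing with it is an instance of the tensor rule with empty
  context.\<close>

lemma stable_runit: "stable t (Ten t One) (Runit C (I t))"
proof (rule stableI)
  fix s f assume f: "nf C c s t f"
  have "nf C c (comb One []) One (Id C (Unit C))" using nf_unit by simp
  from nf_ten[OF f this] have "nf C c s (Ten t One) ((f \<boxtimes> Id C (Unit C)) \<cdot> Runit C (I s))" by simp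
  then show "nf C c s (Ten t One) (Runit C (I t) \<cdot> f)" using runit_nat[of f] f by simp
qed simp_all

lemma nf_assoc_ten:
  assumes "nf C c s (Ten t w) e" "nf C c (comb One D) v g"
  shows "nf C c (comb s D) (Ten t (Ten w v))
    (Assoc C (I t) (I w) (I v) \<cdot> ((e \<boxtimes> g) \<cdot> split_arr C (I s) (Is D)))"
  using assms
proof (induction s "Ten t w" e rule: nf.induct)
  case (nf_lunit u E f)
  show ?case
    by (rule nf_lunit_below[OF nf_lunit(2)[OF nf_lunit(3)]]) (use nf_lunit in simp_all)
next
  case (nf_ten s f E q)
  let ?d = "I (comb One D)" and ?e = "I (comb One E)"
  \<comment> \<open>Rebracketing: \<open>q\<close> and \<open>g\<close> are combined before
    \<open>f\<close>. Since the source of \<open>q\<close> already has a unit as head, the contexts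
    merge to \<open>D @ E\<close> behind that one unit.\<close>
  have "nf C c (comb One (D @ E)) (Ten w v) ((q \<boxtimes> g) \<cdot> split_arr C (I (comb One E)) (Is D))"
    using nf.nf_ten[OF nf_ten(3) nf_ten(5)] by (simp add: comb_append)
  from nf.nf_ten[OF nf_ten(1) this]
  have "nf C c (comb s (D @ E)) (Ten t (Ten w v))
    ((f \<boxtimes> ((q \<boxtimes> g) \<cdot> split_arr C ?e (Is D))) \<cdot> split_arr C (I s) (Is (D @ E)))" .
  moreover have "(f \<boxtimes> ((q \<boxtimes> g) \<cdot> split_arr C ?e (Is D))) \<cdot> split_arr C (I s) (Is (D @ E))
    = (f \<boxtimes> (q \<boxtimes> g)) \<cdot> ((Id C (I s) \<boxtimes> split_arr C ?e (Is D)) \<cdot> split_arr C (I s) (Is (D @ E)))"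
    using nf_ten by (simp add: comb_ob_append)
  moreover have "\<dots> = (f \<boxtimes> (q \<boxtimes> g)) \<cdot> (Assoc C (I s) ?e ?d \<cdot>
      ((split_arr C (I s) (Is E) \<boxtimes> Id C ?d) \<cdot> split_arr C (I (comb s E)) (Is D)))"
    using split_arr_split_arr[of "I s" "Is D" "Is E"] by simp
  moreover have "\<dots> = ((f \<boxtimes> (q \<boxtimes> g)) \<cdot> Assoc C (I s) ?e ?d) \<cdot>
      ((split_arr C (I s) (Is E) \<boxtimes> Id C ?d) \<cdot> split_arr C (I (comb s E)) (Is D))"
    using nf_ten by (intro comp_assoc_arr[symmetric]) simp_all
  moreover have "\<dots> = (Assoc C (I t) (I w) (I v) \<cdot> ((f \<boxtimes> q) \<boxtimes> g)) \<cdot>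
      ((split_arr C (I s) (Is E) \<boxtimes> Id C ?d) \<cdot> split_arr C (I (comb s E)) (Is D))"
    using assoc_nat[of f q g] nf_ten by simp
  moreover have "\<dots> = Assoc C (I t) (I w) (I v) \<cdot> ((((f \<boxtimes> q) \<cdot> split_arr C (I s) (Is E)) \<boxtimes> g) \<cdot>
      split_arr C (I (comb s E)) (Is D))"
    using nf_ten by simp
  ultimately show ?case by (simp add: comb_append)
qed

lemma stable_assoc: "stable (Ten (Ten s t) w) (Ten s (Ten t w)) (Assoc C (I s) (I t) (I w))"
  by (rule stable_tenI) (simp_all add: nf_assoc_ten)

lemma stable_ten:
  assumes "stable s s' h" "stable t t' k"
  shows "stable (Ten s t) (Ten s' t') (h \<boxtimes> k)"
proof (rule stable_tenI)
  fix a D f g assume fg: "nf C c a s f" "nf C c (comb One D) t g"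
  have "nf C c (comb a D) (Ten s' t') (((h \<cdot> f) \<boxtimes> (k \<cdot> g)) \<cdot> split_arr C (I a) (Is D))"
    by (intro nf_ten stableD[OF assms(1)] stableD[OF assms(2)] fg)
  then show "nf C c (comb a D) (Ten s' t') ((h \<boxtimes> k) \<cdot> ((f \<boxtimes> g) \<cdot> split_arr C (I a) (Is D)))"
    using assms fg by simp
qed (use assms in simp_all)

lemma stable_whisker: "stable s t f \<Longrightarrow> stable (comb s D) (comb t D) (whisker C f (Is D))"
  by (induction D) (auto intro: stable_ten stable_id)

lemma stable_split_arr: "stable (comb s D) (Ten s (comb One D)) (split_arr C (I s) (Is D))"
proof (induction D)
  case (Cons y D)
  show ?case
    using stable_comp[OF stable_ten[OF Cons stable_id[of y]] stable_assoc[of s "comb One D" y]] by simp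
qed (simp add: stable_runit)

text \<open>Every rule builds its arrow from identities, \<alpha>, \<lambda> and \<rho> by
  composition and tensor, all of which respect stability.\<close>

lemma nf_stable: "nf C c s t f \<Longrightarrow> stable s t f"
proof (induction rule: nf.induct)
  case nf_gen
  show ?case using stable_id[of Gen] by simp
next
  case nf_unit
  show ?case using stable_id[of One] by simp
qed (auto intro!: stable_comp stable_whisker stable_lunit stable_ten stable_split_arr)

lemma nf_iff_stable: "nf C c s t f \<longleftrightarrow> stable s t f"
  using nf_stable stable_nf by blast

lemma nf_comp: "nf C c s t f \<Longrightarrow> nf C c t w g \<Longrightarrow> nf C c s w (g \<cdot> f)"
  using nf_stable stableD by blast

lemma nf_tensor: "nf C c s t f \<Longrightarrow> nf C c s' t' g \<Longrightarrow> nf C c (Ten s s') (Ten t t') (f \<boxtimes> g)"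
  unfolding nf_iff_stable by (rule stable_ten)

lemmas nf_assoc_arr = stable_nf[OF stable_assoc]
  and nf_lunit_arr = stable_nf[OF stable_lunit]
  and nf_runit_arr = stable_nf[OF stable_runit]

end

section \<open>The skew monoidal category Fsk\<close>

lemma tam_star_eq:
  "i < m - Suc 0 \<Longrightarrow> tam_star m S n T i = S i"
  "0 < m \<Longrightarrow> tam_star m S n T (m - Suc 0) = 0"
  "0 < m \<Longrightarrow> i < n \<Longrightarrow> tam_star m S n T (m + i) = m + T i"
  by (auto simp: tam_star_def)

lemma nat_split3:
  fixes i m n :: nat
  assumes "i < m + n"
  obtains "i < m - 1" | "i = m - 1" "0 < m" | k where "i = m + k" "k < n"
proof -
  consider "i < m - 1" | "i = m - 1" "0 < m" | "m \<le> i" by linarith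
  then show ?thesis
    using that(3)[of "i - m"] that(1,2) assms by cases auto
qed

lemma tam_star_Tam:
  assumes "1 \<le> m" "1 \<le> n" "S \<in> Tam m" "T \<in> Tam n"
  shows "tam_star m S n T \<in> Tam (m + n)"
proof (rule TamI)
  let ?W = "tam_star m S n T"
  show "?W \<in> extensional {..<m + n}" by (simp add: tam_star_def)
  show le: "?W j \<le> j" if "j < m + n" for j
    using that TamD(1)[OF assms(3), of j] TamD(1)[OF assms(4), of "j - m"] assms(1)
    by (cases j m n rule: nat_split3) (auto simp: tam_star_eq)
  show "?W j \<le> ?W i" if ij: "?W j \<le> i" "i \<le> j" "j < m + n" for i j
    using ij(3)
  proof (cases j m n rule: nat_split3)
    case 1
    then show ?thesis using ij TamD(2)[OF assms(3), of j i] by (simp add: tam_star_eq)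
  next
    case (3 k)
    then have "m \<le> i" using ij assms(1) tam_star_eq(3)[of m k n S T] by simp
    then obtain l where l: "i = m + l" by (rule le_Suc_ex[THEN exE])
    then have "l \<le> k" using ij 3 by simp
    note l = l this
    then show ?thesis using 3 ij assms(1) TamD(2)[OF assms(4), of k l] by (simp add: tam_star_eq)
  qed (use tam_star_eq(2)[of m S n T] in simp)
  have "m + n - 1 = m + (n - 1)" using assms(2) by simp
  then show "?W (m + n - 1) = m + n - 1"
    using tam_star_eq(3)[of m "n - 1" n S T] TamD(3)[OF assms(4)] assms by simp
qed (use assms in simp)

lemma fsk_tensor_obj: "A \<in> fsk_objects \<Longrightarrow> B \<in> fsk_objects \<Longrightarrow> fsk_tensor A B \<in> fsk_objects"
  using tam_star_Tam by (cases A, cases B) (force simp: fsk_objects_def)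

lemma fsk_point_obj: "u \<subseteq> {..<1} \<Longrightarrow> (1, u, \<lambda>i\<in>{..<1}. 0) \<in> fsk_objects"
  by (auto simp: fsk_objects_def Tam_def)

lemma fsk_unit_obj: "fsk_unit \<in> fsk_objects"
  and fsk_generator_obj: "fsk_generator \<in> fsk_objects"
  using fsk_point_obj[of "{}"] fsk_point_obj[of "{..<1}"] by (simp_all add: fsk_unit_def fsk_generator_def)

lemma fst_fsk_tensor [simp]: "fst (fsk_tensor A B) = fst A + fst B"
  by (cases A, cases B) simp

lemma fst_fsk_unit [simp]: "fst fsk_unit = 1"
  by (simp add: fsk_unit_def)

lemma fsk_obj_pos: "A \<in> fsk_objects \<Longrightarrow> 0 < fst A"
  by (auto simp: fsk_objects_def)

lemma lax_map_fun:
  assumes "lax_map A B f"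
  shows "f \<in> {..<fst A} \<rightarrow>\<^sub>E {..<fst B}" "f 0 = 0" "i < fst A \<Longrightarrow> f i < fst B"
  using assms by (cases A, cases B, auto)+

lemma ordinal_sum_eq:
  "i < m \<Longrightarrow> ordinal_sum m m' f n g i = f i"
  "k < n \<Longrightarrow> ordinal_sum m m' f n g (m + k) = m' + g k"
  by (auto simp: ordinal_sum_def)

lemma nat_split2:
  fixes i m n :: nat
  assumes "i < m + n"
  obtains "i < m" | k where "i = m + k" "k < n"
  using that(1) that(2)[of "i - m"] assms by (cases "i < m") auto

text \<open>The inequality follows the cases of \<open>tam_star\<close>: inside a factor it is that
  of \<open>f\<close> or of \<open>g\<close>, and at the last leaf \<open>m - 1\<close> of the left
  factor the bracketing value is 0, which the map fixes.\<close>

lemma lax_map_tensor: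
  assumes A: "A \<in> fsk_objects" "B \<in> fsk_objects" "A' \<in> fsk_objects" "B' \<in> fsk_objects"
    and fg: "lax_map A A' f" "lax_map B B' g"
  shows "lax_map (fsk_tensor A B) (fsk_tensor A' B') (ordinal_sum (fst A) (fst A') f (fst B) g)"
proof -
  obtain m u S n v T m' u' S' n' v' T'
    where AB: "A = (m, u, S)" "B = (n, v, T)" "A' = (m', u', S')" "B' = (n', v', T')"
    by (cases A, cases B, cases A', cases B') auto
  have o: "1 \<le> m" "u \<subseteq> {..<m}" "S \<in> Tam m" "1 \<le> n" "v \<subseteq> {..<n}" "T \<in> Tam n" "1 \<le> m'" "1 \<le> n'"
    using A AB by (auto simp: fsk_objects_def)
  have f: "\<And>i. i < m \<Longrightarrow> f i < m'" "mono_on {..<m} f" "f 0 = 0" "f ` u = u'"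
    "\<And>i. i \<in> u \<Longrightarrow> i + 1 < m \<Longrightarrow> f i < f (i + 1)"
    "\<And>i j. i + 1 < m \<Longrightarrow> f i \<le> j \<Longrightarrow> j < f (i + 1) \<Longrightarrow> f (S i) \<le> S' j"
    using fg(1) AB by (auto simp: PiE_def Pi_def)
  have g: "\<And>i. i < n \<Longrightarrow> g i < n'" "mono_on {..<n} g" "g 0 = 0" "g ` v = v'"
    "\<And>i. i \<in> v \<Longrightarrow> i + 1 < n \<Longrightarrow> g i < g (i + 1)"
    "\<And>i j. i + 1 < n \<Longrightarrow> g i \<le> j \<Longrightarrow> j < g (i + 1) \<Longrightarrow> g (T i) \<le> T' j"
    using fg(2) AB by (auto simp: PiE_def Pi_def)
  let ?h = "ordinal_sum m m' f n g"
  note os = ordinal_sum_eq(1)[of _ m m' f n g] ordinal_sum_eq(2)[of _ n m m' f g]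
  have hm: "?h m = m'" using os(2)[of 0] o(4) g(3) by simp
  have ext: "?h \<in> {..<m + n} \<rightarrow>\<^sub>E {..<m' + n'}"
  proof (rule PiE_I)
    fix i assume "i \<in> {..<m + n}"
    then have "i < m + n" by simp
    then show "?h i \<in> {..<m' + n'}"
      by (cases i m n rule: nat_split2) (use f(1)[of i] g(1) in \<open>auto simp: os intro: trans_less_add1\<close>)
  qed (simp add: ordinal_sum_def)
  have mono: "mono_on {..<m + n} ?h"
  proof (rule mono_onI)
    fix i j assume ij: "i \<in> {..<m + n}" "j \<in> {..<m + n}" "i \<le> j"
    have "j < m + n" using ij by simp
    then show "?h i \<le> ?h j"
    proof (cases j m n rule: nat_split2)
      case 1
      then show ?thesis using ij mono_lessThan[OF f(2), of i j] by (simp add: os)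
    next
      case (2 k)
      have "i < m + n" using ij by simp
      then show ?thesis
      proof (cases i m n rule: nat_split2)
        case 1
        then show ?thesis using f(1)[of i] 2 by (simp add: os)
      next
        case (2 l)
        then show ?thesis using ij mono_lessThan[OF g(2), of l k] \<open>j = m + k\<close> \<open>k < n\<close> by (simp add: os)
      qed
    qed
  qed
  have "?h ` u = f ` u" using o(2) by (intro image_cong) (auto simp: os)
  moreover have "?h ` (\<lambda>j. m + j) ` v = (\<lambda>j. m' + j) ` g ` v"
    unfolding image_image using o(5) by (intro image_cong) (auto simp: os)
  ultimately have img: "?h ` (u \<union> (\<lambda>j. m + j) ` v) = u' \<union> (\<lambda>j. m' + j) ` v'"
    using f(4) g(4) by (simp add: image_Un)
  have top: "?h i < ?h (i + 1)" if i: "i \<in> u \<union> (\<lambda>j. m + j) ` v" "i + 1 < m + n" for i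
  proof (cases "i \<in> u")
    case True
    then have im: "i < m" using o(2) by auto
    show ?thesis
    proof (cases "i + 1 < m")
      case True
      then show ?thesis using f(5) \<open>i \<in> u\<close> by (simp add: os del: One_nat_def add_Suc_right)
    next
      case False
      then have "i + 1 = m" using im by simp
      then show ?thesis using hm f(1)[OF im] im by (simp add: os)
    qed
  next
    case False
    then obtain k where k: "i = m + k" "k \<in> v" using i by auto
    then have "k + 1 < n" using i by simp
    then show ?thesis using g(5)[of k] os(2)[of k] os(2)[of "k + 1"] k by simp
  qed
  have main: "?h (tam_star m S n T i) \<le> tam_star m' S' n' T' j"
    if i: "i + 1 < m + n" "?h i \<le> j" "j < ?h (i + 1)" for i j
  proof -
    have "i < m + n" using i by simp
    then show ?thesis
    proof (cases i m n rule: nat_split3)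
      case 1
      then have im: "i < m" "i + 1 < m" by auto
      then have j: "f i \<le> j" "j < f (i + 1)" using i os(1)[of i] os(1)[of "i + 1"] by simp_all
      \<comment> \<open>Thus \<open>j\<close> avoids the leaf \<open>m' - 1\<close>, where
        \<open>tam_star\<close> replaces the value of \<open>S'\<close> by 0.\<close>
      then have "j < m' - 1" using f(1)[OF im(2)] by simp
      then show ?thesis using f(6)[OF im(2) j] TamD(1)[OF o(3), of i] 1 im by (simp add: tam_star_eq os)
    next
      case 2
      then show ?thesis using o(1) f(3) os(1)[of 0] tam_star_eq(2)[of m S n T] by simp
    next
      case (3 k)
      have k1: "k + 1 < n" using i 3 by simp
      have a: "m' + g k \<le> j" "j < m' + g (k + 1)" using i(2,3) os(2)[of k] os(2)[of "k + 1"] k1 3 by simp_all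
      then have "m' \<le> j" by simp
      then obtain l where l: "j = m' + l" by (rule le_Suc_ex[THEN exE])
      then have "g k \<le> l" "l < g (k + 1)" using a by simp_all
      note l = l this
      have "l < n'" using l g(1)[OF k1] by simp
      then show ?thesis using g(6)[OF k1 l(2,3)] TamD(1)[OF o(6), of k] 3 l(1) o(1,7) by (simp add: tam_star_eq os)
    qed
  qed
  have "?h 0 = 0" using os(1)[of 0] o(1) f(3) by simp
  then show ?thesis unfolding AB fst_conv fsk_tensor.simps lax_map.simps
    by (intro conjI ext mono img ballI allI impI top main) simp_all
qed

section \<open>The structure maps of Fsk\<close>

text \<open>For an inclusion of an initial segment the condition
  \<open>f i \<le> j < f (i + 1)\<close> means \<open>j = i\<close>, so comparing values pointwise
  suffices. It serves identities, \<alpha> and \<rho>.\<close>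

lemma lax_map_id:
  assumes "m \<le> n" "1 \<le> m" "u \<subseteq> {..<m}" "\<And>i. i + 1 < m \<Longrightarrow> S i \<le> T i" "S \<in> Tam m"
  shows "lax_map (m, u, S) (n, u, T) (\<lambda>i\<in>{..<m}. i)"
proof -
  have "(\<lambda>i\<in>{..<m}. i) ` u = (\<lambda>i. i) ` u" using assms(3) by (intro image_cong) auto
  moreover have "S i < m" if "i + 1 < m" for i using TamD(1)[OF assms(5), of i] that by simp
  ultimately show ?thesis using assms
    by (auto simp: mono_on_def dest!: le_less_Suc_eq[THEN iffD1, rotated])
qed

lemma lax_map_Id: "A \<in> fsk_objects \<Longrightarrow> lax_map A A (\<lambda>i\<in>{..<fst A}. i)"
  by (cases A) (auto intro!: lax_map_id simp: fsk_objects_def simp del: lax_map.simps)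

lemma lax_map_assoc:
  assumes "A \<in> fsk_objects" "B \<in> fsk_objects" "C \<in> fsk_objects"
  shows "lax_map (fsk_tensor (fsk_tensor A B) C) (fsk_tensor A (fsk_tensor B C))
    (\<lambda>i\<in>{..<fst A + fst B + fst C}. i)"
proof -
  obtain m u S n v T p w W where ABC: "A = (m, u, S)" "B = (n, v, T)" "C = (p, w, W)"
    by (cases A, cases B, cases C) auto
  have o: "1 \<le> m" "1 \<le> n" "1 \<le> p" "u \<subseteq> {..<m}" "v \<subseteq> {..<n}" "w \<subseteq> {..<p}"
    using assms ABC by (auto simp: fsk_objects_def)
  let ?u = "u \<union> (\<lambda>j. m + j) ` v \<union> (\<lambda>j. m + n + j) ` w"
  have eq: "u \<union> (\<lambda>j. m + j) ` (v \<union> (\<lambda>j. n + j) ` w) = ?u"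
    by (simp add: image_Un image_image Un_assoc add.assoc)
  have "fsk_tensor (fsk_tensor A B) C \<in> fsk_objects" using assms by (intro fsk_tensor_obj)
  then have T: "tam_star (m + n) (tam_star m S n T) p W \<in> Tam (m + n + p)" "?u \<subseteq> {..<m + n + p}"
    by (simp_all add: ABC fsk_objects_def)
  \<comment> \<open>The two sides differ only at \<open>i = m + n - 1\<close>, where the value rises
    from 0 to \<open>m\<close>: the end of the left factor \<open>A \<otimes> B\<close> becomes the
    end of \<open>B\<close> inside \<open>B \<otimes> C\<close>.\<close>
  have eq2: "tam_star (m + n) (tam_star m S n T) p W i \<le> tam_star m S (n + p) (tam_star n T p W) i"
    if "i < m + n + p" for i
  proof -
    consider "i + 1 < m" | "i + 1 = m" | "m \<le> i" "i + 1 < m + n" | "i + 1 = m + n" | "m + n \<le> i"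
      by linarith
    then show ?thesis using that o(1-3) by cases (auto simp: tam_star_def)
  qed
  have "lax_map (m + n + p, ?u, tam_star (m + n) (tam_star m S n T) p W)
    (m + (n + p), ?u, tam_star m S (n + p) (tam_star n T p W)) (\<lambda>i\<in>{..<m + n + p}. i)"
    by (rule lax_map_id) (use o T eq2 in auto)
  then show ?thesis unfolding ABC fsk_tensor.simps fst_conv eq .
qed

lemma lax_map_lunit:
  assumes "A \<in> fsk_objects"
  shows "lax_map (fsk_tensor fsk_unit A) A (\<lambda>i\<in>{..<fst A + 1}. i - 1)"
proof -
  obtain m u S where A: "A = (m, u, S)" by (cases A) auto
  have o: "1 \<le> m" "u \<subseteq> {..<m}" "S \<in> Tam m" using assms A by (auto simp: fsk_objects_def)
  let ?f = "\<lambda>i\<in>{..<m + 1}. i - 1"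
  have "?f ` (\<lambda>j. 1 + j) ` u = (\<lambda>i. i) ` u"
    unfolding image_image using o(2) by (intro image_cong) auto
  then have img: "?f ` ({} \<union> (\<lambda>j. 1 + j) ` u) = u" by simp
  have main: "?f (tam_star 1 (\<lambda>i\<in>{..<1}. 0) m S i) \<le> S j" if i: "i + 1 < 1 + m" "?f i \<le> j" "j < ?f (i + 1)" for i j
  proof -
    \<comment> \<open>The assumptions say \<open>i - 1 \<le> j < i\<close>; here
      \<open>i = 0\<close> is impossible because leaves 0 and 1 have the same image.\<close>
    have "i = j + 1" using i by auto
    then show ?thesis using i TamD(1)[OF o(3), of j] by (simp add: tam_star_def)
  qed
  have "?f \<in> {..<1 + m} \<rightarrow>\<^sub>E {..<m}" using o(1) by auto
  moreover have "mono_on {..<1 + m} ?f" by (auto intro!: mono_onI)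
  moreover have "?f 0 = 0" by simp
  moreover have "\<forall>i\<in>{} \<union> (\<lambda>j. 1 + j) ` u. i + 1 < 1 + m \<longrightarrow> ?f i < ?f (i + 1)" by auto
  ultimately show ?thesis unfolding A fsk_unit_def fsk_tensor.simps fst_conv lax_map.simps
    using img main by blast
qed

lemma lax_map_runit:
  assumes "A \<in> fsk_objects"
  shows "lax_map A (fsk_tensor A fsk_unit) (\<lambda>i\<in>{..<fst A}. i)"
proof -
  obtain m u S where A: "A = (m, u, S)" by (cases A) auto
  have o: "1 \<le> m" "u \<subseteq> {..<m}" "S \<in> Tam m" using assms A by (auto simp: fsk_objects_def)
  have "lax_map (m, u, S) (m + 1, u, tam_star m S 1 (\<lambda>i\<in>{..<1}. 0)) (\<lambda>i\<in>{..<m}. i)"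
    by (rule lax_map_id) (use o in \<open>auto simp: tam_star_def\<close>)
  then show ?thesis by (simp add: A fsk_unit_def del: lax_map.simps)
qed


lemma Fsk_simps [simp]:
  "Obj Fsk = fsk_objects"
  "Dom Fsk (A, f, B) = A" "Cod Fsk (A, f, B) = B"
  "Id Fsk A = (A, \<lambda>i\<in>{..<fst A}. i, A)"
  "Comp Fsk (B', g, D) (A, f, B) = (A, compose {..<fst A} g f, D)"
  "Tensor Fsk = fsk_tensor" "Unit Fsk = fsk_unit"
  "Tensor_Arr Fsk (A, f, A') (B, g, B') =
    (fsk_tensor A B, ordinal_sum (fst A) (fst A') f (fst B) g, fsk_tensor A' B')"
  "Assoc Fsk A B D = (fsk_tensor (fsk_tensor A B) D, \<lambda>i\<in>{..<fst A + fst B + fst D}. i,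
    fsk_tensor A (fsk_tensor B D))"
  "Lunit Fsk A = (fsk_tensor fsk_unit A, \<lambda>i\<in>{..<fst A + 1}. i - 1, A)"
  "Runit Fsk A = (A, \<lambda>i\<in>{..<fst A}. i, fsk_tensor A fsk_unit)"
  by (simp_all add: Fsk_def)

text \<open>From here on arrows of Fsk enter only through the intrinsic condition, and
  factorizations do not return.\<close>

lemma Arr_Fsk [simp]:
  "(A, f, B) \<in> Arr Fsk \<longleftrightarrow> A \<in> fsk_objects \<and> B \<in> fsk_objects \<and> lax_map A B f"
  by (auto simp: Fsk_def fsk_morphism_iff_lax_map)

lemma Hom_Fsk:
  "x \<in> Hom Fsk A B \<longleftrightarrow> (\<exists>f. x = (A, f, B) \<and> A \<in> fsk_objects \<and> B \<in> fsk_objects \<and> lax_map A B f)"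
  by (cases x) (auto simp: Hom_def)

lemma Hom_FskE:
  assumes "x \<in> Hom Fsk A B"
  obtains f where "x = (A, f, B)" "A \<in> fsk_objects" "B \<in> fsk_objects" "lax_map A B f"
    "f \<in> {..<fst A} \<rightarrow>\<^sub>E {..<fst B}" "f 0 = 0" "\<And>i. i < fst A \<Longrightarrow> f i < fst B"
  using assms lax_map_fun by (auto simp: Hom_Fsk)

lemma ordinal_sum_id: "ordinal_sum m m (\<lambda>i\<in>{..<m}. i) n (\<lambda>i\<in>{..<n}. i) = (\<lambda>i\<in>{..<m + n}. i)"
  by (auto simp: ordinal_sum_def fun_eq_iff)

lemma ordinal_sum_compose:
  assumes "\<And>i. i < m \<Longrightarrow> f i < m'" "\<And>i. i < n \<Longrightarrow> g i < n'"
  shows "ordinal_sum m m'' (compose {..<m} f' f) n (compose {..<n} g' g) =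
    compose {..<m + n} (ordinal_sum m' m'' f' n' g') (ordinal_sum m m' f n g)"
proof
  fix i
  show "ordinal_sum m m'' (compose {..<m} f' f) n (compose {..<n} g' g) i =
    compose {..<m + n} (ordinal_sum m' m'' f' n' g') (ordinal_sum m m' f n g) i"
  proof (cases "i < m + n")
    case True
    then show ?thesis
      by (cases i m n rule: nat_split2) (use assms in \<open>auto simp: compose_def ordinal_sum_def intro: trans_less_add1\<close>)
  qed (simp add: compose_def ordinal_sum_def)
qed

lemma ordinal_sum_assoc:
  "ordinal_sum (m + n) (m' + n') (ordinal_sum m m' f n g) p h =
    ordinal_sum m m' f (n + p) (ordinal_sum n n' g p h)"
  by (auto simp: ordinal_sum_def fun_eq_iff)

lemma compose_id_right: "f \<in> extensional A \<Longrightarrow> compose A f (\<lambda>i\<in>A. i) = f"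
  by (auto simp: compose_def fun_eq_iff extensional_def)

lemma compose_id_left:
  "f \<in> extensional A \<Longrightarrow> (\<And>i. i \<in> A \<Longrightarrow> f i \<in> B) \<Longrightarrow> compose A (\<lambda>i\<in>B. i) f = f"
  by (auto simp: compose_def fun_eq_iff extensional_def)

lemma ordinal_sum_less:
  assumes "\<And>i. i < m \<Longrightarrow> f i < m'" "\<And>i. i < n \<Longrightarrow> g i < n'" "i < m + n"
  shows "ordinal_sum m m' f n g i < m' + n'"
  using assms(3) by (cases i m n rule: nat_split2) (use assms(1,2) in \<open>auto simp: ordinal_sum_def intro: trans_less_add1\<close>)

lemma ordinal_sum_extensional: "ordinal_sum m m' f n g \<in> extensional {..<m + n}"
  by (simp add: ordinal_sum_def)

proposition Fsk_skew_monoidal: "skew_monoidal_category Fsk"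
proof
  show "f \<in> Arr Fsk \<Longrightarrow> Dom Fsk f \<in> Obj Fsk" for f by (cases f) simp
  show "f \<in> Arr Fsk \<Longrightarrow> Cod Fsk f \<in> Obj Fsk" for f by (cases f) simp
  show "A \<in> Obj Fsk \<Longrightarrow> Id Fsk A \<in> Hom Fsk A A" for A by (simp add: Hom_Fsk lax_map_Id)
  show "x \<in> Hom Fsk A B \<Longrightarrow> y \<in> Hom Fsk B D \<Longrightarrow> y \<cdot>\<^bsub>Fsk\<^esub> x \<in> Hom Fsk A D" for x y A B D
    by (auto simp: Hom_Fsk intro: lax_map_comp)
  show "x \<in> Hom Fsk A B \<Longrightarrow> x \<cdot>\<^bsub>Fsk\<^esub> Id Fsk A = x" for x A B
    by (auto elim!: Hom_FskE simp: compose_id_right PiE_def)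
  show "x \<in> Hom Fsk A B \<Longrightarrow> Id Fsk B \<cdot>\<^bsub>Fsk\<^esub> x = x" for x A B
    by (elim Hom_FskE, simp, intro compose_id_left) (auto simp: PiE_def)
  show "x \<in> Hom Fsk A B \<Longrightarrow> y \<in> Hom Fsk B D \<Longrightarrow> z \<in> Hom Fsk D E \<Longrightarrow>
    (z \<cdot>\<^bsub>Fsk\<^esub> y) \<cdot>\<^bsub>Fsk\<^esub> x = z \<cdot>\<^bsub>Fsk\<^esub> (y \<cdot>\<^bsub>Fsk\<^esub> x)" for x y z A B D E
    by (elim Hom_FskE) (auto simp: compose_def fun_eq_iff)
  show "A \<in> Obj Fsk \<Longrightarrow> B \<in> Obj Fsk \<Longrightarrow> A \<otimes>\<^bsub>Fsk\<^esub> B \<in> Obj Fsk" for A B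
    by (simp add: fsk_tensor_obj)
  show "x \<in> Hom Fsk A A' \<Longrightarrow> y \<in> Hom Fsk B B' \<Longrightarrow>
    x \<boxtimes>\<^bsub>Fsk\<^esub> y \<in> Hom Fsk (A \<otimes>\<^bsub>Fsk\<^esub> B) (A' \<otimes>\<^bsub>Fsk\<^esub> B')" for x y A A' B B'
    by (auto simp: Hom_Fsk fsk_tensor_obj intro: lax_map_tensor)
  show "A \<in> Obj Fsk \<Longrightarrow> B \<in> Obj Fsk \<Longrightarrow> Id Fsk A \<boxtimes>\<^bsub>Fsk\<^esub> Id Fsk B = Id Fsk (A \<otimes>\<^bsub>Fsk\<^esub> B)" for A B
    by (simp add: ordinal_sum_id)
  show "x \<in> Hom Fsk A A' \<Longrightarrow> x' \<in> Hom Fsk A' A'' \<Longrightarrow> y \<in> Hom Fsk B B' \<Longrightarrow> y' \<in> Hom Fsk B' B'' \<Longrightarrow>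
    (x' \<cdot>\<^bsub>Fsk\<^esub> x) \<boxtimes>\<^bsub>Fsk\<^esub> (y' \<cdot>\<^bsub>Fsk\<^esub> y) = (x' \<boxtimes>\<^bsub>Fsk\<^esub> y') \<cdot>\<^bsub>Fsk\<^esub> (x \<boxtimes>\<^bsub>Fsk\<^esub> y)" for x x' y y' A A' A'' B B' B''
    by (elim Hom_FskE) (simp add: ordinal_sum_compose)
  show "Unit Fsk \<in> Obj Fsk" by (simp add: fsk_unit_obj)
  show "A \<in> Obj Fsk \<Longrightarrow> B \<in> Obj Fsk \<Longrightarrow> D \<in> Obj Fsk \<Longrightarrow>
    Assoc Fsk A B D \<in> Hom Fsk ((A \<otimes>\<^bsub>Fsk\<^esub> B) \<otimes>\<^bsub>Fsk\<^esub> D) (A \<otimes>\<^bsub>Fsk\<^esub> (B \<otimes>\<^bsub>Fsk\<^esub> D))" for A B D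
    by (simp add: Hom_Fsk fsk_tensor_obj lax_map_assoc)
  show "A \<in> Obj Fsk \<Longrightarrow> Lunit Fsk A \<in> Hom Fsk (Unit Fsk \<otimes>\<^bsub>Fsk\<^esub> A) A" for A
    using lax_map_lunit[of A] by (simp add: Hom_Fsk fsk_tensor_obj fsk_unit_obj)
  show "A \<in> Obj Fsk \<Longrightarrow> Runit Fsk A \<in> Hom Fsk A (A \<otimes>\<^bsub>Fsk\<^esub> Unit Fsk)" for A
    by (simp add: Hom_Fsk fsk_tensor_obj fsk_unit_obj lax_map_runit)
  show "x \<in> Hom Fsk A A' \<Longrightarrow> y \<in> Hom Fsk B B' \<Longrightarrow> z \<in> Hom Fsk D D' \<Longrightarrow>
    Assoc Fsk A' B' D' \<cdot>\<^bsub>Fsk\<^esub> (x \<boxtimes>\<^bsub>Fsk\<^esub> y \<boxtimes>\<^bsub>Fsk\<^esub> z) =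
    (x \<boxtimes>\<^bsub>Fsk\<^esub> (y \<boxtimes>\<^bsub>Fsk\<^esub> z)) \<cdot>\<^bsub>Fsk\<^esub> Assoc Fsk A B D" for x y z A A' B B' D D'
    by (elim Hom_FskE)
      (simp add: compose_id_right ordinal_sum_extensional flip: ordinal_sum_assoc add.assoc,
        intro compose_id_left ordinal_sum_extensional, auto intro!: ordinal_sum_less)
  show "x \<in> Hom Fsk A A' \<Longrightarrow>
    Lunit Fsk A' \<cdot>\<^bsub>Fsk\<^esub> (Id Fsk (Unit Fsk) \<boxtimes>\<^bsub>Fsk\<^esub> x) = x \<cdot>\<^bsub>Fsk\<^esub> Lunit Fsk A" for x A A'
    by (elim Hom_FskE) (auto simp: compose_def ordinal_sum_def fun_eq_iff)
  show "x \<in> Hom Fsk A A' \<Longrightarrow>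
    Runit Fsk A' \<cdot>\<^bsub>Fsk\<^esub> x = (x \<boxtimes>\<^bsub>Fsk\<^esub> Id Fsk (Unit Fsk)) \<cdot>\<^bsub>Fsk\<^esub> Runit Fsk A" for x A A'
    by (elim Hom_FskE) (auto simp: compose_def ordinal_sum_def fun_eq_iff)
  show "A \<in> Obj Fsk \<Longrightarrow> B \<in> Obj Fsk \<Longrightarrow> D \<in> Obj Fsk \<Longrightarrow> E \<in> Obj Fsk \<Longrightarrow>
    (Id Fsk A \<boxtimes>\<^bsub>Fsk\<^esub> Assoc Fsk B D E) \<cdot>\<^bsub>Fsk\<^esub> Assoc Fsk A (B \<otimes>\<^bsub>Fsk\<^esub> D) E \<cdot>\<^bsub>Fsk\<^esub> (Assoc Fsk A B D \<boxtimes>\<^bsub>Fsk\<^esub> Id Fsk E) =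
    Assoc Fsk A B (D \<otimes>\<^bsub>Fsk\<^esub> E) \<cdot>\<^bsub>Fsk\<^esub> Assoc Fsk (A \<otimes>\<^bsub>Fsk\<^esub> B) D E" for A B D E
    by (simp add: ordinal_sum_id compose_id_right flip: add.assoc)
  show "A \<in> Obj Fsk \<Longrightarrow> B \<in> Obj Fsk \<Longrightarrow>
    Lunit Fsk (A \<otimes>\<^bsub>Fsk\<^esub> B) \<cdot>\<^bsub>Fsk\<^esub> Assoc Fsk (Unit Fsk) A B = Lunit Fsk A \<boxtimes>\<^bsub>Fsk\<^esub> Id Fsk B" for A B
    using fsk_obj_pos[of A] by (auto simp: compose_def ordinal_sum_def fun_eq_iff)
  show "A \<in> Obj Fsk \<Longrightarrow> B \<in> Obj Fsk \<Longrightarrow>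
    (Id Fsk A \<boxtimes>\<^bsub>Fsk\<^esub> Lunit Fsk B) \<cdot>\<^bsub>Fsk\<^esub> Assoc Fsk A (Unit Fsk) B \<cdot>\<^bsub>Fsk\<^esub> (Runit Fsk A \<boxtimes>\<^bsub>Fsk\<^esub> Id Fsk B) =
    Id Fsk (A \<otimes>\<^bsub>Fsk\<^esub> B)" for A B
    by (auto simp: compose_def ordinal_sum_def fun_eq_iff)
  show "A \<in> Obj Fsk \<Longrightarrow> B \<in> Obj Fsk \<Longrightarrow>
    Assoc Fsk A B (Unit Fsk) \<cdot>\<^bsub>Fsk\<^esub> Runit Fsk (A \<otimes>\<^bsub>Fsk\<^esub> B) = Id Fsk A \<boxtimes>\<^bsub>Fsk\<^esub> Runit Fsk B" for A B
    by (auto simp: compose_def ordinal_sum_def fun_eq_iff)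
  show "Lunit Fsk (Unit Fsk) \<cdot>\<^bsub>Fsk\<^esub> Runit Fsk (Unit Fsk) = Id Fsk (Unit Fsk)"
    by (auto simp: compose_def fun_eq_iff)
qed

section \<open>Binary trees and bracketing functions\<close>

primrec leaves :: "tree \<Rightarrow> nat" where
  "leaves Gen = 1"
| "leaves One = 1"
| "leaves (Ten s t) = leaves s + leaves t"

primrec marks :: "tree \<Rightarrow> nat set" where
  "marks Gen = {..<1}"
| "marks One = {}"
| "marks (Ten s t) = marks s \<union> (\<lambda>j. leaves s + j) ` marks t"

primrec lbf :: "tree \<Rightarrow> nat \<Rightarrow> nat" where
  "lbf Gen = (\<lambda>i\<in>{..<1}. 0)"
| "lbf One = (\<lambda>i\<in>{..<1}. 0)"
| "lbf (Ten s t) = tam_star (leaves s) (lbf s) (leaves t) (lbf t)"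

abbreviation fsk_of :: "tree \<Rightarrow> fsk_obj" where
  "fsk_of t \<equiv> (leaves t, marks t, lbf t)"

lemma interp_Fsk [simp]: "interp Fsk fsk_generator t = fsk_of t"
  by (induction t) (auto simp: fsk_generator_def fsk_unit_def fun_eq_iff restrict_def)

lemma fsk_of_obj: "fsk_of t \<in> fsk_objects"
proof -
  have "interp Fsk fsk_generator t \<in> fsk_objects"
    by (induction t) (simp_all add: fsk_tensor_obj fsk_unit_obj fsk_generator_obj del: interp_Fsk)
  then show ?thesis by simp
qed

lemma leaves_pos [simp]: "0 < leaves t"
  by (induction t) auto

lemma marks_less: "i \<in> marks t \<Longrightarrow> i < leaves t"
  using fsk_of_obj[of t] by (auto simp: fsk_objects_def)

lemma lbf_Tam: "lbf t \<in> Tam (leaves t)"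
  using fsk_of_obj[of t] by (simp add: fsk_objects_def)

lemma lbf_le: "i < leaves t \<Longrightarrow> lbf t i \<le> i"
  by (rule TamD(1)[OF lbf_Tam])

text \<open>The left factor of a tensor ends at the last zero of the bracketing function: position
  \<open>m' - 1\<close> has value 0 in one tensor, but belongs to the right factor of the other,
  where values are at least \<open>m\<close>.\<close>

lemma fsk_tensor_split_le:
  assumes "1 \<le> m" "m < m'" "m + n = m' + n'"
  shows "tam_star m S n T \<noteq> tam_star m' S' n' T'"
proof
  assume "tam_star m S n T = tam_star m' S' n' T'"
  moreover have "tam_star m' S' n' T' (m' - 1) = 0" using assms by (simp add: tam_star_eq)
  moreover have "tam_star m S n T (m' - 1) \<ge> m"
    using assms by (auto simp: tam_star_def)
  ultimately show False using assms by simp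
qed

lemma fsk_tensor_inject:
  assumes "A \<in> fsk_objects" "B \<in> fsk_objects" "A' \<in> fsk_objects" "B' \<in> fsk_objects"
    and eq: "fsk_tensor A B = fsk_tensor A' B'"
  shows "A = A' \<and> B = B'"
proof -
  obtain m u S n v T m' u' S' n' v' T'
    where AB: "A = (m, u, S)" "B = (n, v, T)" "A' = (m', u', S')" "B' = (n', v', T')"
    by (cases A, cases B, cases A', cases B') auto
  have o: "1 \<le> m" "u \<subseteq> {..<m}" "S \<in> Tam m" "1 \<le> n" "v \<subseteq> {..<n}" "T \<in> Tam n"
    "1 \<le> m'" "u' \<subseteq> {..<m'}" "S' \<in> Tam m'" "1 \<le> n'" "v' \<subseteq> {..<n'}" "T' \<in> Tam n'"
    using assms AB by (auto simp: fsk_objects_def)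
  have e: "m + n = m' + n'" "u \<union> (\<lambda>j. m + j) ` v = u' \<union> (\<lambda>j. m' + j) ` v'"
    and st: "tam_star m S n T = tam_star m' S' n' T'" using eq AB by auto
  have m: "m = m'"
    using fsk_tensor_split_le[of m m' n n' S T S' T'] fsk_tensor_split_le[of m' m n' n S' T' S T] e st o
    by (metis nat_neq_iff)
  then have n: "n = n'" using e by simp
  have "S i = S' i" for i
  proof -
    consider "i < m - Suc 0" | "i = m - 1" | "\<not> i < m" by linarith
    then show ?thesis
    proof cases
      case 1
      then show ?thesis using tam_star_eq(1)[of i m S n T] tam_star_eq(1)[of i m S' n' T'] st m by simp
    next
      case 2
      then show ?thesis using TamD(3)[OF o(3)] TamD(3)[OF o(9)] m by simp
    next
      case 3
      then show ?thesis using TamD(4)[OF o(3)] TamD(4)[OF o(9)] m by (simp add: extensional_def)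
    qed
  qed
  moreover have "T i = T' i" for i
  proof (cases "i < n")
    case True
    then show ?thesis
      using tam_star_eq(3)[of m i n S T] tam_star_eq(3)[of m i n' S' T'] st m n o(1) by simp
  next
    case False
    then show ?thesis using TamD(4)[OF o(6)] TamD(4)[OF o(12)] n by (simp add: extensional_def)
  qed
  moreover have "u = (u \<union> (\<lambda>j. m + j) ` v) \<inter> {..<m}" using o(2) by auto
  then have "u = u'" unfolding e(2) using o(8) m by auto
  moreover have "v = {j. m + j \<in> u \<union> (\<lambda>j. m + j) ` v}" using o(2) by auto
  then have "v = v'" unfolding e(2) using o(8) m by auto
  ultimately show ?thesis using AB m n by auto
qed

lemma fsk_of_inject: "fsk_of s = fsk_of t \<Longrightarrow> s = t"
proof (induction s arbitrary: t)
  case Gen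
  show ?case
  proof (cases t)
    case (Ten a b)
    then show ?thesis using Gen leaves_pos[of a] leaves_pos[of b] by simp
  qed (use Gen in auto)
next
  case One
  show ?case
  proof (cases t)
    case (Ten a b)
    then show ?thesis using One leaves_pos[of a] leaves_pos[of b] by simp
  qed (use One in auto)
next
  case (Ten a b)
  show ?case
  proof (cases t)
    case (Ten a' b')
    have "fsk_tensor (fsk_of a) (fsk_of b) = fsk_tensor (fsk_of a') (fsk_of b')"
      using Ten.prems Ten by simp
    then have "fsk_of a = fsk_of a' \<and> fsk_of b = fsk_of b'"
      by (intro fsk_tensor_inject fsk_of_obj)
    then show ?thesis using Ten.IH Ten by blast
  qed (use Ten.prems leaves_pos[of a] leaves_pos[of b] in simp_all)
qed

lemma fsk_of_surj: "A \<in> fsk_objects \<Longrightarrow> \<exists>t. fsk_of t = A"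
proof (induction "fst A" arbitrary: A rule: less_induct)
  case less
  obtain m u S where A: "A = (m, u, S)" by (cases A) auto
  have o: "1 \<le> m" "u \<subseteq> {..<m}" "S \<in> Tam m" using less.prems A by (auto simp: fsk_objects_def)
  show ?case
  proof (cases "m = 1")
    case True
    have "S i = (\<lambda>i\<in>{..<1}. 0) i" for i
      using TamD(1)[OF o(3), of i] TamD(4)[OF o(3)] True by (auto simp: extensional_def)
    then have S: "S = (\<lambda>i\<in>{..<1}. 0)" by (rule ext)
    have "u = {} \<or> u = {..<1}" using o(2) True by auto
    then show ?thesis
    proof
      assume "u = {}"
      then have "fsk_of One = A" using A S True by simp
      then show ?thesis by blast
    next
      assume "u = {..<1}"
      then have "fsk_of Gen = A" using A S True by simp
      then show ?thesis by blast
    qed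
  next
    case False
    then have m: "0 < m - 1" using o(1) by simp
    let ?Z = "{i. i < m - 1 \<and> S i = 0}"
    \<comment> \<open>In a tensor the left factor ends at the last zero, so the last zero is where
      the object must be cut. The final leaf is excluded because its value is conventional.\<close>
    define k where "k = Max ?Z"
    have S0: "S 0 = 0" using TamD(1)[OF o(3), of 0] m by simp
    have "0 \<in> ?Z" using S0 m by simp
    then have "?Z \<noteq> {}" by blast
    then have "k \<in> ?Z" unfolding k_def by (intro Max_in) simp_all
    then have k: "k < m - 1" "S k = 0" by auto
    have kmax: "i \<le> k" if "i < m - 1" "S i = 0" for i
      unfolding k_def using that by (intro Max_ge) auto
    define p where "p = k + 1"
    have p: "1 \<le> p" "p < m" using k by (auto simp: p_def)
    \<comment> \<open>A value \<open>S j \<le> k\<close> with \<open>j\<close> behind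
      \<open>k\<close> would satisfy \<open>S j \<le> S k = 0\<close>, giving a zero beyond the last
      one.\<close>
    have Sp: "p \<le> S j" if "p \<le> j" "j < m" for j
    proof (rule ccontr)
      assume "\<not> p \<le> S j"
      then have "S j \<le> k" by (simp add: p_def)
      then have "S j = 0" using TamD(2)[OF o(3), of j k] that k by (simp add: p_def)
      moreover have "j \<noteq> m - 1" using \<open>S j = 0\<close> TamD(3)[OF o(3)] m by auto
      ultimately have "j \<le> k" using kmax[of j] that by simp
      then show False using that by (simp add: p_def)
    qed
    \<comment> \<open>The left factor regains its conventional last value \<open>k\<close>, which
      the tensor overwrites by 0.\<close>
    define S1 where "S1 = (\<lambda>i\<in>{..<p}. if i = k then k else S i)"
    define S2 where "S2 = (\<lambda>i\<in>{..<m - p}. S (p + i) - p)"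
    have S1: "S1 \<in> Tam p"
    proof (rule TamI)
      show "S1 j \<le> j" if "j < p" for j using TamD(1)[OF o(3), of j] that p by (simp add: S1_def)
      show "S1 j \<le> S1 i" if ij: "S1 j \<le> i" "i \<le> j" "j < p" for i j
      proof (cases "j = k")
        case True
        then show ?thesis using ij by (simp add: S1_def)
      next
        case False
        then have "i \<noteq> k" using ij by (simp add: p_def)
        then show ?thesis using False ij TamD(2)[OF o(3), of j i] p by (simp add: S1_def)
      qed
    qed (use p in \<open>simp_all add: S1_def p_def\<close>)
    have S2: "S2 \<in> Tam (m - p)"
    proof (rule TamI)
      show "S2 j \<le> j" if "j < m - p" for j
      proof -
        have "p + j < m" using that by simp
        then show ?thesis using TamD(1)[OF o(3), of "p + j"] that by (simp add: S2_def)
      qed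
      show "S2 j \<le> S2 i" if ij: "S2 j \<le> i" "i \<le> j" "j < m - p" for i j
      proof -
        have "S (p + j) \<le> p + i" using ij by (simp add: S2_def)
        then show ?thesis using ij TamD(2)[OF o(3), of "p + j" "p + i"] by (simp add: S2_def diff_le_mono)
      qed
      show "S2 (m - p - 1) = m - p - 1"
      proof -
        have "m - p - 1 < m - p" "p + (m - p - 1) = m - 1" using p by simp_all
        then show ?thesis using TamD(3)[OF o(3)] by (simp add: S2_def)
      qed
    qed (use p in \<open>simp_all add: S2_def\<close>)
    let ?B = "(p, u \<inter> {..<p}, S1)" and ?D = "(m - p, {i. p + i \<in> u}, S2)"
    have BD: "?B \<in> fsk_objects" "?D \<in> fsk_objects" using S1 S2 p o(2) by (auto simp: fsk_objects_def)
    obtain s where s: "fsk_of s = ?B" using less.hyps[OF _ BD(1)] p A by auto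
    obtain t where t: "fsk_of t = ?D" using less.hyps[OF _ BD(2)] p A by auto
    have "u \<inter> {..<p} \<union> (\<lambda>j. p + j) ` {i. p + i \<in> u} = u"
      by (auto simp: image_iff) (metis le_add_diff_inverse not_less)
    moreover have "tam_star p S1 (m - p) S2 i = S i" for i
    proof -
      consider "i < p - Suc 0" | "i = p - Suc 0" | j where "i = p + j" "j < m - p" | "\<not> i < m"
        using p(1) by (metis One_nat_def add_diff_inverse_nat diff_less_mono less_Suc_eq
            Suc_pred less_le_trans not_less zero_less_one)
      then show ?thesis
      proof cases
        case 1
        then show ?thesis by (simp add: tam_star_eq) (simp add: S1_def p_def)
      next
        case 2
        then show ?thesis using p k tam_star_eq(2)[of p S1 "m - p" S2] by (simp add: p_def)
      next
        case 3
        then show ?thesis using p Sp[of i] by (simp add: tam_star_eq) (simp add: S2_def)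
      next
        case 4
        then show ?thesis using p TamD(4)[OF o(3)] by (simp add: tam_star_def extensional_def)
      qed
    qed
    ultimately have "fsk_of (Ten s t) = A" using s t A p by auto
    then show ?thesis by blast
  qed
qed

definition tree_of :: "fsk_obj \<Rightarrow> tree" where
  "tree_of A = (THE t. fsk_of t = A)"

lemma tree_of_fsk_of [simp]: "tree_of (fsk_of t) = t"
  unfolding tree_of_def by (rule the_equality) (rule refl, erule fsk_of_inject)

section \<open>Comb decompositions, seen through leaves, marks and bracketing values\<close>

lemma leaves_comb: "leaves (comb a D) = leaves a + sum_list (map leaves D)"
  by (induction D) auto

lemma comb_leaves_inject:
  assumes "comb a D = comb a' D'" "leaves a = leaves a'"
  shows "a = a' \<and> D = D'"
  using assms
proof (induction D arbitrary: D')
  case Nil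
  then show ?case
  proof (cases D')
    case (Cons y E)
    then show ?thesis using Nil leaves_comb[of a' D'] leaves_pos[of y] by simp
  qed simp
next
  case (Cons y D)
  then show ?case
  proof (cases D')
    case Nil
    then show ?thesis using Cons leaves_comb[of a "y # D"] leaves_pos[of y] by simp
  qed auto
qed

text \<open>The subtrees along the left spine form a chain, so of two heads of the same tree one
  contains the other.\<close>

lemma comb_eq_comb:
  assumes "comb a D = comb b E"
  shows "(\<exists>F. a = comb b F \<and> E = D @ F) \<or> (\<exists>F. b = comb a F \<and> D = E @ F)"
  using assms
proof (induction D arbitrary: E)
  case (Cons y D)
  then show ?case by (cases E) auto
qed auto

lemma comb_Ten_One: "comb One (E @ [t]) = comb (Ten One t) E"
  by (simp add: comb_append)

lemma comb_eq_comb_Ten_One: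
  assumes "comb a D = comb (Ten One t) E"
  shows "(\<exists>F. a = comb (Ten One t) F \<and> E = D @ F) \<or> (a = One \<and> D = E @ [t])"
proof -
  have "a = One \<and> F = [t]" if F: "Ten One t = comb a F" "F \<noteq> []" for F
  proof -
    obtain y F' where "F = y # F'" using F by (cases F) auto
    then show ?thesis using F by (cases F') auto
  qed
  then show ?thesis using comb_eq_comb[OF assms] by (metis append_Nil2 comb.simps(1))
qed

lemma tree_head_cases:
  obtains D where "t = comb Gen D" | "t = One" | s D where "t = comb (Ten One s) D"
proof -
  have "\<exists>D. t = comb Gen D \<or> t = comb One D"
  proof (induction t)
    case (Ten s t)
    then show ?case by (metis comb.simps(2))
  qed (metis comb.simps(1))+
  then obtain D where "t = comb Gen D \<or> t = comb One D" by blast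
  then show ?thesis
  proof
    assume t: "t = comb One D"
    show ?thesis
      using t that(2,3) by (cases D rule: rev_cases) (auto simp: comb_Ten_One)
  qed (use that in blast)
qed

lemma lbf_Ten:
  "i + 1 < leaves s \<Longrightarrow> lbf (Ten s t) i = lbf s i"
  "i + 1 = leaves s \<Longrightarrow> lbf (Ten s t) i = 0"
  "k < leaves t \<Longrightarrow> lbf (Ten s t) (leaves s + k) = leaves s + lbf t k"
proof -
  show "i + 1 < leaves s \<Longrightarrow> lbf (Ten s t) i = lbf s i" by (simp add: tam_star_eq)
  show "i + 1 = leaves s \<Longrightarrow> lbf (Ten s t) i = 0" by (auto simp: tam_star_def)
  show "k < leaves t \<Longrightarrow> lbf (Ten s t) (leaves s + k) = leaves s + lbf t k"
    by (simp add: tam_star_eq)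
qed

text \<open>In a tensor a zero lies inside the left factor or at its end, since the values in the
  right factor are at least the size of the left one. Descending the left spine finds the head that
  ends there. This converts bracketing information into a way of cutting the source.\<close>

lemma lbf_zero_split:
  assumes "lbf s p = 0" "p + 1 < leaves s"
  shows "\<exists>a D. s = comb a D \<and> leaves a = p + 1 \<and> D \<noteq> []"
  using assms
proof (induction s)
  case (Ten x y)
  have "p < leaves x + leaves y" using Ten.prems by simp
  then show ?case
  proof (cases p "leaves x" "leaves y" rule: nat_split3)
    case 1
    then have "\<exists>a D. x = comb a D \<and> leaves a = p + 1 \<and> D \<noteq> []"
      using Ten by (simp add: tam_star_eq)
    then show ?thesis by (metis comb.simps(2) list.distinct(1))
  next
    case 2
    then have "Ten x y = comb x [y] \<and> leaves x = p + 1" by simp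
    then show ?thesis by blast
  next
    case (3 k)
    then show ?thesis using Ten.prems(1) lbf_Ten(3)[of k y x] leaves_pos[of x] by auto
  qed
qed auto

lemma marks_comb_head: "i < leaves a \<Longrightarrow> i \<in> marks (comb a D) \<longleftrightarrow> i \<in> marks a"
  by (induction D) (auto simp: leaves_comb)

lemma marks_comb_tail: "leaves a + k \<in> marks (comb a D) \<longleftrightarrow> Suc k \<in> marks (comb One D)"
proof (induction D)
  case Nil
  then show ?case using marks_less[of "leaves a + k" a] by auto
next
  case (Cons y D)
  then show ?case by (auto simp: leaves_comb image_iff)
qed

lemma marks_comb_lunit: "Suc i \<in> marks (comb (Ten One t) D) \<longleftrightarrow> i \<in> marks (comb t D)"
  by (induction D) (auto simp: leaves_comb image_iff)

lemma marks_comb_One: "0 \<notin> marks (comb One D)"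
  using marks_comb_head[of 0 One D] by simp

lemma marks_comb_Ten_One: "0 \<notin> marks (comb (Ten One t) D)"
  using marks_comb_head[of 0 "Ten One t" D] by auto

lemma lbf_comb_head: "i + 1 < leaves a \<Longrightarrow> lbf (comb a D) i = lbf a i"
  by (induction D) (auto simp: leaves_comb tam_star_eq)

text \<open>Replacing the head by a single leaf lowers the nonzero values on the tail by
  \<open>leaves a - 1\<close>. Truncated subtraction makes the formula uniform: a zero refers to the
  start of the whole comb and stays zero.\<close>

lemma lbf_comb_tail:
  "k < sum_list (map leaves D) \<Longrightarrow>
    lbf (comb One D) (Suc k) = lbf (comb a D) (leaves a + k) + 1 - leaves a"
proof (induction D)
  case (Cons y D)
  let ?c = "sum_list (map leaves D)"
  consider "k + 1 < ?c" | "k + 1 = ?c" | "?c \<le> k" by linarith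
  then show ?case
  proof cases
    case 1
    then show ?thesis using Cons by (simp add: leaves_comb tam_star_eq)
  next
    case 2
    then have "Suc k + 1 = leaves (comb One D)" "leaves a + k + 1 = leaves (comb a D)"
      by (simp_all add: leaves_comb)
    note this[THEN lbf_Ten(2), of y]
    then show ?thesis by (simp add: Suc_leI del: lbf.simps)
  next
    case 3
    define j where "j = k - ?c"
    have j: "j < leaves y" using 3 Cons.prems by (simp add: j_def)
    have "Suc k = leaves (comb One D) + j" "leaves a + k = leaves (comb a D) + j"
      using 3 by (simp_all add: leaves_comb j_def)
    then have "lbf (comb One (y # D)) (Suc k) = leaves (comb One D) + lbf y j"
      "lbf (comb a (y # D)) (leaves a + k) = leaves (comb a D) + lbf y j"
      using lbf_Ten(3)[OF j] by simp_all
    then show ?thesis by (simp add: leaves_comb del: lbf.simps)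
  qed
qed simp

text \<open>Deleting the unit leaf 0 lowers positive values by one; the truncated subtraction keeps
  zeros at zero.\<close>

lemma lbf_comb_lunit:
  "i < leaves (comb t D) \<Longrightarrow> lbf (comb t D) i = lbf (comb (Ten One t) D) (Suc i) - 1"
proof (induction D)
  case Nil
  then show ?case using tam_star_eq(3)[of 1 i "leaves t" "lbf One" "lbf t"] by simp
next
  case (Cons y D)
  have "i < leaves (comb t D) + leaves y" using Cons.prems by simp
  then show ?case
  proof (cases i "leaves (comb t D)" "leaves y" rule: nat_split3)
    case 1
    then show ?thesis using Cons.IH by (simp add: leaves_comb tam_star_eq)
  next
    case 2
    then have "i + 1 = leaves (comb t D)" "Suc i + 1 = leaves (comb (Ten One t) D)"
      by (simp_all add: leaves_comb)
    note this[THEN lbf_Ten(2), of y]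
    then show ?thesis by (simp del: lbf.simps)
  next
    case (3 k)
    then have "Suc i = leaves (comb (Ten One t) D) + k" by (simp add: leaves_comb)
    then have e: "Suc (leaves (comb t D) + k) = leaves (comb (Ten One t) D) + k" using 3(1) by simp
    have "lbf (comb t (y # D)) i = leaves (comb t D) + lbf y k"
      "lbf (comb (Ten One t) (y # D)) (Suc i) = leaves (comb (Ten One t) D) + lbf y k"
      unfolding comb.simps 3(1) e using lbf_Ten(3)[OF 3(2)] by (simp_all only:)
    then show ?thesis by (simp add: leaves_comb del: lbf.simps)
  qed
qed

section \<open>Products\<close>

text \<open>The second factor will be Fsk, so that the cut elimination above applies at once to an
  arrow and its underlying function.\<close>

definition prod_skew ::
  "('o, 'a, 'z) skew_monoidal_scheme \<Rightarrow> ('p, 'b, 'y) skew_monoidal_scheme \<Rightarrow> ('o \<times> 'p, 'a \<times> 'b) skew_monoidal" where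
  "prod_skew C D = \<lparr>
     Obj = Obj C \<times> Obj D,
     Arr = Arr C \<times> Arr D,
     Dom = map_prod (Dom C) (Dom D),
     Cod = map_prod (Cod C) (Cod D),
     Id = map_prod (Id C) (Id D),
     Comp = (\<lambda>g f. (Comp C (fst g) (fst f), Comp D (snd g) (snd f))),
     Tensor = (\<lambda>x y. (Tensor C (fst x) (fst y), Tensor D (snd x) (snd y))),
     Tensor_Arr = (\<lambda>f g. (Tensor_Arr C (fst f) (fst g), Tensor_Arr D (snd f) (snd g))),
     Unit = (Unit C, Unit D),
     Assoc = (\<lambda>x y z. (Assoc C (fst x) (fst y) (fst z), Assoc D (snd x) (snd y) (snd z))),
     Lunit = map_prod (Lunit C) (Lunit D),
     Runit = map_prod (Runit C) (Runit D) \<rparr>"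

lemma prod_skew_simps [simp]:
  "Obj (prod_skew C D) = Obj C \<times> Obj D"
  "Arr (prod_skew C D) = Arr C \<times> Arr D"
  "Dom (prod_skew C D) x = (Dom C (fst x), Dom D (snd x))"
  "Cod (prod_skew C D) x = (Cod C (fst x), Cod D (snd x))"
  "Id (prod_skew C D) a = (Id C (fst a), Id D (snd a))"
  "Comp (prod_skew C D) g f = (Comp C (fst g) (fst f), Comp D (snd g) (snd f))"
  "Tensor (prod_skew C D) a b = (Tensor C (fst a) (fst b), Tensor D (snd a) (snd b))"
  "Tensor_Arr (prod_skew C D) f g = (Tensor_Arr C (fst f) (fst g), Tensor_Arr D (snd f) (snd g))"
  "Unit (prod_skew C D) = (Unit C, Unit D)"
  "Assoc (prod_skew C D) a b e = (Assoc C (fst a) (fst b) (fst e), Assoc D (snd a) (snd b) (snd e))"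
  "Lunit (prod_skew C D) a = (Lunit C (fst a), Lunit D (snd a))"
  "Runit (prod_skew C D) a = (Runit C (fst a), Runit D (snd a))"
  by (simp_all add: prod_skew_def map_prod_def split: prod.splits)

lemma Hom_prod_skew:
  "x \<in> Hom (prod_skew C D) a b \<longleftrightarrow> fst x \<in> Hom C (fst a) (fst b) \<and> snd x \<in> Hom D (snd a) (snd b)"
  by (cases x, cases a, cases b) (auto simp: Hom_def)

lemma prod_skew_skew_monoidal:
  assumes C: "skew_monoidal_category C" and D: "skew_monoidal_category D"
  shows "skew_monoidal_category (prod_skew C D)"
proof -
  note cat = skew_monoidal_category.axioms(1)
  note catC = cat[OF C] and catD = cat[OF D]
  show ?thesis
    apply unfold_locales
    apply (simp_all only: Hom_prod_skew prod_skew_simps mem_Times_iff fst_conv snd_conv prod_eq_iff)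
    subgoal by (blast intro: category.dom_obj[OF catC] category.dom_obj[OF catD])
    subgoal by (blast intro: category.cod_obj[OF catC] category.cod_obj[OF catD])
    subgoal by (blast intro: category.id_hom[OF catC] category.id_hom[OF catD])
    subgoal by (blast intro: category.comp_hom[OF catC] category.comp_hom[OF catD])
    subgoal by (blast intro: category.comp_id[OF catC] category.comp_id[OF catD])
    subgoal by (blast intro: category.id_comp[OF catC] category.id_comp[OF catD])
    subgoal by (blast intro: category.comp_assoc[OF catC] category.comp_assoc[OF catD])
    subgoal by (blast intro: skew_monoidal_category.tensor_obj[OF C] skew_monoidal_category.tensor_obj[OF D])
    subgoal by (blast intro: skew_monoidal_category.tensor_hom[OF C] skew_monoidal_category.tensor_hom[OF D])
    subgoal by (blast intro: skew_monoidal_category.tensor_id[OF C] skew_monoidal_category.tensor_id[OF D])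
    subgoal by (blast intro: skew_monoidal_category.tensor_comp[OF C] skew_monoidal_category.tensor_comp[OF D])
    subgoal by (blast intro: skew_monoidal_category.unit_obj[OF C] skew_monoidal_category.unit_obj[OF D])
    subgoal by (blast intro: skew_monoidal_category.assoc_hom[OF C] skew_monoidal_category.assoc_hom[OF D])
    subgoal by (blast intro: skew_monoidal_category.lunit_hom[OF C] skew_monoidal_category.lunit_hom[OF D])
    subgoal by (blast intro: skew_monoidal_category.runit_hom[OF C] skew_monoidal_category.runit_hom[OF D])
    subgoal by (blast intro: skew_monoidal_category.assoc_natural[OF C] skew_monoidal_category.assoc_natural[OF D])
    subgoal by (blast intro: skew_monoidal_category.lunit_natural[OF C] skew_monoidal_category.lunit_natural[OF D])
    subgoal by (blast intro: skew_monoidal_category.runit_natural[OF C] skew_monoidal_category.runit_natural[OF D])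
    subgoal by (blast intro: skew_monoidal_category.pentagon[OF C] skew_monoidal_category.pentagon[OF D])
    subgoal by (blast intro: skew_monoidal_category.lunit_assoc[OF C] skew_monoidal_category.lunit_assoc[OF D])
    subgoal by (blast intro: skew_monoidal_category.runit_assoc_lunit[OF C] skew_monoidal_category.runit_assoc_lunit[OF D])
    subgoal by (blast intro: skew_monoidal_category.assoc_runit[OF C] skew_monoidal_category.assoc_runit[OF D])
    subgoal by (blast intro: skew_monoidal_category.lunit_runit[OF C] skew_monoidal_category.lunit_runit[OF D])
    done
qed

lemma interp_prod_skew: "interp (prod_skew C D) (c, d) t = (interp C c t, interp D d t)"
  by (induction t) simp_all

lemma comb_ob_prod_skew:
  "comb_ob (prod_skew C D) x E = (comb_ob C (fst x) (map fst E), comb_ob D (snd x) (map snd E))"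
  by (induction E) (simp_all add: prod_eq_iff)

lemma whisker_prod_skew:
  "whisker (prod_skew C D) f E = (whisker C (fst f) (map fst E), whisker D (snd f) (map snd E))"
  by (induction E) simp_all

lemma split_arr_prod_skew:
  "split_arr (prod_skew C D) x E = (split_arr C (fst x) (map fst E), split_arr D (snd x) (map snd E))"
  by (induction E) (simp_all add: comb_ob_prod_skew)

section \<open>The arrows of the calculus, computed in Fsk\<close>

lemma comb_ob_Fsk: "comb_ob Fsk (fsk_of a) (map fsk_of D) = fsk_of (comb a D)"
  by (induction D) simp_all

lemma fsk_unit_eq: "fsk_unit = fsk_of One"
  using interp_Fsk[of One] by simp

lemma comb_ob_Fsk_unit: "comb_ob Fsk fsk_unit (map fsk_of D) = fsk_of (comb One D)"
  using comb_ob_Fsk[of One D] by (simp only: fsk_unit_eq)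

lemma whisker_lunit_Fsk:
  "whisker Fsk (Lunit Fsk (fsk_of t)) (map fsk_of D) =
    (fsk_of (comb (Ten One t) D), \<lambda>i\<in>{..<leaves (comb (Ten One t) D)}. i - 1, fsk_of (comb t D))"
proof (induction D)
  case Nil
  show ?case by (auto simp: fsk_unit_eq fun_eq_iff simp del: lbf.simps(1,2))
next
  case (Cons y D)
  then show ?case
    by (auto simp: ordinal_sum_def leaves_comb fun_eq_iff)
qed

text \<open>The planted unit is leaf \<open>leaves a\<close> of the target, and the function skips
  it.\<close>

lemma split_arr_Fsk:
  "split_arr Fsk (fsk_of a) (map fsk_of D) =
    (fsk_of (comb a D), \<lambda>i\<in>{..<leaves (comb a D)}. if i < leaves a then i else Suc i,
     fsk_tensor (fsk_of a) (fsk_of (comb One D)))"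
proof (induction D)
  case Nil
  show ?case by (auto simp: fsk_unit_eq fun_eq_iff simp del: lbf.simps(1,2))
next
  case (Cons y D)
  then show ?case
    by (auto simp: comb_ob_Fsk_unit ordinal_sum_def compose_def leaves_comb fun_eq_iff)
qed

lemma comp_whisker_lunit_Fsk:
  "Comp Fsk (fsk_of (comb t D), \<phi>, B) (whisker Fsk (Lunit Fsk (fsk_of t)) (map fsk_of D)) =
    (fsk_of (comb (Ten One t) D), \<lambda>i\<in>{..<leaves (comb (Ten One t) D)}. \<phi> (i - 1), B)"
proof -
  have "compose {..<leaves (comb (Ten One t) D)} \<phi> (\<lambda>i\<in>{..<leaves (comb (Ten One t) D)}. i - 1) =
    (\<lambda>i\<in>{..<leaves (comb (Ten One t) D)}. \<phi> (i - 1))"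
    by (auto simp: compose_def fun_eq_iff)
  then show ?thesis
    by (simp only: whisker_lunit_Fsk Fsk_simps(5) fst_conv)
qed

lemma fsk_of_Ten: "fsk_tensor (fsk_of s) (fsk_of t) = fsk_of (Ten s t)"
  by simp

text \<open>A context leaf \<open>i\<close> comes \<open>i - leaves s\<close> places behind the
  head; it is leaf \<open>Suc (i - leaves s)\<close> of the right premise, whose leaf 0 is the
  planted unit.\<close>

lemma comp_split_arr_Fsk:
  "Comp Fsk (Tensor_Arr Fsk (fsk_of s, \<phi>, fsk_of t) (fsk_of (comb One D), \<psi>, fsk_of w))
      (split_arr Fsk (fsk_of s) (map fsk_of D)) =
    (fsk_of (comb s D), \<lambda>i\<in>{..<leaves (comb s D)}.
      if i < leaves s then \<phi> i else leaves t + \<psi> (Suc (i - leaves s)), fsk_of (Ten t w))"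
proof -
  have "compose {..<leaves (comb s D)}
      (ordinal_sum (leaves s) (leaves t) \<phi> (leaves (comb One D)) \<psi>)
      (\<lambda>i\<in>{..<leaves (comb s D)}. if i < leaves s then i else Suc i) =
    (\<lambda>i\<in>{..<leaves (comb s D)}. if i < leaves s then \<phi> i else leaves t + \<psi> (Suc (i - leaves s)))"
    by (auto simp: compose_def ordinal_sum_def leaves_comb fun_eq_iff Suc_diff_le)
  then show ?thesis
    by (simp only: split_arr_Fsk Fsk_simps(5,8) fst_conv fsk_of_Ten)
qed

section \<open>Normal forms and their underlying functions\<close>

context pointed_skew_monoidal_category
begin

lemma leaves_neq_0 [simp]: "leaves t \<noteq> 0"
  using leaves_pos[of t] by (metis less_irrefl)

lemma fsk_generator_eq: "fsk_generator = fsk_of Gen"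
  using interp_Fsk[of Gen] by simp

text \<open>This is \<open>nf\<close> over the product with Fsk, with the Fsk component unpacked so
  that inversion sees the function itself.\<close>

inductive NF :: "tree \<Rightarrow> tree \<Rightarrow> 'a \<Rightarrow> (nat \<Rightarrow> nat) \<Rightarrow> bool" where
  NF_gen: "NF Gen Gen (Id C c) (\<lambda>i\<in>{..<1}. i)"
| NF_unit: "NF One One (Id C (Unit C)) (\<lambda>i\<in>{..<1}. i)"
| NF_lunit: "NF (comb t D) w f \<phi> \<Longrightarrow>
    NF (comb (Ten One t) D) w (f \<cdot> whisker C (Lunit C (I t)) (Is D))
      (\<lambda>i\<in>{..<leaves (comb (Ten One t) D)}. \<phi> (i - 1))"
| NF_ten: "NF s t f \<phi> \<Longrightarrow> NF (comb One D) w g \<psi> \<Longrightarrow>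
    NF (comb s D) (Ten t w) ((f \<boxtimes> g) \<cdot> split_arr C (I s) (Is D))
      (\<lambda>i\<in>{..<leaves (comb s D)}.
        if i < leaves s then \<phi> i else leaves t + \<psi> (Suc (i - leaves s)))"

abbreviation "P \<equiv> prod_skew C Fsk"
abbreviation "pt \<equiv> (c, fsk_generator)"

interpretation P: pointed_skew_monoidal_category P pt
  by (intro pointed_skew_monoidal_category.intro prod_skew_skew_monoidal Fsk_skew_monoidal
      skew_monoidal_category_axioms pointed_skew_monoidal_category_axioms.intro)
    (simp add: fsk_generator_obj)

lemma interp_P: "interp P pt t = (I t, fsk_of t)"
  by (simp add: interp_prod_skew)

lemma interps_P: "map fst (interps P pt D) = Is D" "map snd (interps P pt D) = map fsk_of D"
  by (simp_all only: map_map comp_def interp_P fst_conv snd_conv)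

lemma lunit_whisker_P:
  assumes "snd x = (fsk_of (comb t D), \<phi>, fsk_of w)"
  shows "Comp P x (whisker P (Lunit P (interp P pt t)) (interps P pt D)) =
    (fst x \<cdot> whisker C (Lunit C (I t)) (Is D), fsk_of (comb (Ten One t) D),
      (\<lambda>i\<in>{..<leaves (comb (Ten One t) D)}. \<phi> (i - 1)), fsk_of w)"
  by (simp only: prod_skew_simps whisker_prod_skew interp_P interps_P fst_conv snd_conv
      comp_whisker_lunit_Fsk assms)

lemma ten_split_P:
  assumes "snd x = (fsk_of s, \<phi>, fsk_of t)" "snd y = (fsk_of (comb One D), \<psi>, fsk_of w)"
  shows "Comp P (Tensor_Arr P x y) (split_arr P (interp P pt s) (interps P pt D)) =
    ((fst x \<boxtimes> fst y) \<cdot> split_arr C (I s) (Is D), fsk_of (comb s D),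
      (\<lambda>i\<in>{..<leaves (comb s D)}.
        if i < leaves s then \<phi> i else leaves t + \<psi> (Suc (i - leaves s))), fsk_of (Ten t w))"
  by (simp only: prod_skew_simps split_arr_prod_skew interp_P interps_P fst_conv snd_conv
      comp_split_arr_Fsk assms)

text \<open>Through this equivalence \<open>NF\<close> inherits identities, composition, tensor and
  the structure maps from the results on \<open>nf\<close> in the product category.\<close>

lemma NF_iff_nf: "NF s t f \<phi> \<longleftrightarrow> nf P pt s t (f, fsk_of s, \<phi>, fsk_of t)"
proof
  have id_gen: "Id P pt = (Id C c, fsk_of Gen, (\<lambda>i\<in>{..<1}. i), fsk_of Gen)"
    by (simp only: prod_skew_simps Fsk_simps fst_conv snd_conv fsk_generator_eq leaves.simps)
  have id_unit: "Id P (Unit P) = (Id C (Unit C), fsk_of One, (\<lambda>i\<in>{..<1}. i), fsk_of One)"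
    by (simp only: prod_skew_simps Fsk_simps fst_conv snd_conv fsk_unit_eq leaves.simps)
  show "NF s t f \<phi> \<Longrightarrow> nf P pt s t (f, fsk_of s, \<phi>, fsk_of t)"
  proof (induction rule: NF.induct)
    case NF_gen
    show ?case using nf_gen[of P pt] unfolding id_gen .
  next
    case NF_unit
    show ?case using nf_unit[of P pt] unfolding id_unit .
  next
    case (NF_lunit t D w f \<phi>)
    show ?case using nf_lunit[OF NF_lunit.IH]
      unfolding lunit_whisker_P[OF snd_conv] fst_conv .
  next
    case (NF_ten s t f \<phi> D w g \<psi>)
    show ?case using nf_ten[OF NF_ten.IH]
      unfolding ten_split_P[OF snd_conv snd_conv] fst_conv .
  qed
  have "NF s t (fst x) (fst (snd (snd x))) \<and> snd x = (fsk_of s, fst (snd (snd x)), fsk_of t)"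
    if "nf P pt s t x" for x
    using that
  proof (induction rule: nf.induct)
    case nf_gen
    show ?case using NF_gen by (simp only: id_gen fst_conv snd_conv simp_thms)
  next
    case nf_unit
    show ?case using NF_unit by (simp only: id_unit fst_conv snd_conv simp_thms)
  next
    case (nf_lunit t D w x)
    then obtain \<phi> where x: "snd x = (fsk_of (comb t D), \<phi>, fsk_of w)" "NF (comb t D) w (fst x) \<phi>"
      by blast
    show ?case unfolding lunit_whisker_P[OF x(1)] using NF_lunit[OF x(2)] by (simp only: fst_conv snd_conv simp_thms)
  next
    case (nf_ten s t x D w y)
    then obtain \<phi> where x: "snd x = (fsk_of s, \<phi>, fsk_of t)" "NF s t (fst x) \<phi>"
      by blast
    from nf_ten obtain \<psi> where y: "snd y = (fsk_of (comb One D), \<psi>, fsk_of w)" "NF (comb One D) w (fst y) \<psi>"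
      by blast
    show ?case unfolding ten_split_P[OF x(1) y(1)] using NF_ten[OF x(2) y(2)] by (simp only: fst_conv snd_conv simp_thms)
  qed
  from this[of "(f, fsk_of s, \<phi>, fsk_of t)"]
  show "nf P pt s t (f, fsk_of s, \<phi>, fsk_of t) \<Longrightarrow> NF s t f \<phi>"
    unfolding fst_conv snd_conv by blast
qed

lemma NF_arr:
  assumes "NF s t f \<phi>"
  shows "f \<in> Arr C" "Dom C f = I s" "Cod C f = I t" "lax_map (fsk_of s) (fsk_of t) \<phi>"
  using P.nf_arr[OF assms[unfolded NF_iff_nf]]
  by (simp_all add: interp_P del: lax_map.simps)

lemma NF_fun:
  assumes "NF s t f \<phi>"
  shows "\<phi> \<in> extensional {..<leaves s}" "\<phi> 0 = 0" "i < leaves s \<Longrightarrow> \<phi> i < leaves t"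
  using lax_map_fun[OF NF_arr(4)[OF assms]] by (auto simp: PiE_def)

lemma NF_id: "NF t t (Id C (I t)) (\<lambda>i\<in>{..<leaves t}. i)"
  using P.nf_id[of t] by (simp only: NF_iff_nf interp_P prod_skew_simps Fsk_simps fst_conv snd_conv)

lemma NF_comp: "NF s t f \<phi> \<Longrightarrow> NF t w g \<psi> \<Longrightarrow> NF s w (g \<cdot> f) (compose {..<leaves s} \<psi> \<phi>)"
  unfolding NF_iff_nf by (drule (1) P.nf_comp) (simp only: prod_skew_simps Fsk_simps fst_conv snd_conv)

lemma NF_tensor:
  "NF s t f \<phi> \<Longrightarrow> NF s' t' g \<psi> \<Longrightarrow>
    NF (Ten s s') (Ten t t') (f \<boxtimes> g) (ordinal_sum (leaves s) (leaves t) \<phi> (leaves s') \<psi>)"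
  unfolding NF_iff_nf by (drule (1) P.nf_tensor)
    (simp only: prod_skew_simps Fsk_simps fst_conv snd_conv fsk_of_Ten)

lemma NF_assoc:
  "NF (Ten (Ten s t) w) (Ten s (Ten t w)) (Assoc C (I s) (I t) (I w))
    (\<lambda>i\<in>{..<leaves s + leaves t + leaves w}. i)"
  using P.nf_assoc_arr[of s t w] by (simp only: NF_iff_nf interp_P prod_skew_simps Fsk_simps fst_conv snd_conv fsk_of_Ten)

lemma NF_lunit_arr: "NF (Ten One t) t (Lunit C (I t)) (\<lambda>i\<in>{..<leaves t + 1}. i - 1)"
  using P.nf_lunit_arr[of t] by (simp only: NF_iff_nf interp_P prod_skew_simps Fsk_simps fst_conv snd_conv fsk_of_Ten fsk_unit_eq)

lemma NF_runit_arr: "NF t (Ten t One) (Runit C (I t)) (\<lambda>i\<in>{..<leaves t}. i)"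
  using P.nf_runit_arr[of t] by (simp only: NF_iff_nf interp_P prod_skew_simps Fsk_simps fst_conv snd_conv fsk_of_Ten fsk_unit_eq)

section \<open>Uniqueness of the arrow over a function\<close>

text \<open>Under a final tensor rule, head and context land in different factors, so identified
  leaves 0 and 1 both lie in the head. The head then starts with the same unit, and the left unit
  rule obtained for the left premise is pulled out by naturality of
  \<open>split_arr\<close>.\<close>

lemma NF_lunit_inversion:
  assumes "NF s w f \<phi>" "s = comb (Ten One t) D" "\<phi> 0 = \<phi> 1"
  shows "\<exists>g \<psi>. NF (comb t D) w g \<psi> \<and> f = g \<cdot> whisker C (Lunit C (I t)) (Is D) \<and>
    \<phi> = (\<lambda>i\<in>{..<leaves s}. \<psi> (i - 1))"
  using assms
proof (induction arbitrary: t D rule: NF.induct)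
  case NF_gen
  then have "leaves (comb (Ten One t) D) = 1" by (simp flip: NF_gen.prems(1))
  then show ?case by (simp add: leaves_comb)
next
  case NF_unit
  then have "leaves (comb (Ten One t) D) = 1" by (simp flip: NF_unit.prems(1))
  then show ?case by (simp add: leaves_comb)
next
  case (NF_lunit t' D' w f \<phi>)
  have "comb One (D' @ [t']) = comb One (D @ [t])" using NF_lunit.prems(1) by (simp add: comb_Ten_One)
  then have "D' = D \<and> t' = t" using comb_leaves_inject[of One "D' @ [t']" One "D @ [t]"] by simp
  then show ?case using NF_lunit by blast
next
  case (NF_ten s t' f \<phi> E w g \<psi>)
  let ?\<chi> = "\<lambda>i\<in>{..<leaves (comb s E)}. if i < leaves s then \<phi> i else leaves t' + \<psi> (Suc (i - leaves s))"
  from comb_eq_comb_Ten_One[OF NF_ten.prems(1)] show ?case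
  proof (elim disjE exE conjE)
    assume s: "s = One" "E = D @ [t]"
    \<comment> \<open>Here the head is leaf 0 alone: it lands in \<open>t'\<close> and leaf 1 in
      \<open>w\<close>, so the two cannot be identified.\<close>
    have "?\<chi> 0 < leaves t'" using NF_fun(3)[OF NF_ten.hyps(1), of 0] by (simp add: leaves_comb)
    moreover have "?\<chi> 1 \<ge> leaves t'" using s by (simp add: leaves_comb)
    ultimately show ?thesis using NF_ten.prems(2) by simp
  next
    fix F assume s: "s = comb (Ten One t) F" "D = E @ F"
    have s2: "1 < leaves s" using s by (simp add: leaves_comb)
    then have "\<phi> 0 = \<phi> 1" using NF_ten.prems(2) by (simp add: leaves_comb)
    then obtain h \<chi> where h: "NF (comb t F) t' h \<chi>" "f = h \<cdot> whisker C (Lunit C (I t)) (Is F)"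
      "\<phi> = (\<lambda>i\<in>{..<leaves s}. \<chi> (i - 1))"
      using NF_ten.IH(1)[OF s(1)] by blast
    have ls: "leaves s = Suc (leaves (comb t F))" using s by (simp add: leaves_comb)
    have e3: "comb (comb t F) E = comb t D" using s by (simp add: comb_append)
    have e1: "(f \<boxtimes> g) \<cdot> split_arr C (I s) (Is E) =
      ((h \<boxtimes> g) \<cdot> split_arr C (I (comb t F)) (Is E)) \<cdot> whisker C (Lunit C (I t)) (Is D)"
      unfolding h(2) s using NF_arr[OF h(1)] NF_arr[OF NF_ten.hyps(2)]
      by (intro ten_whisker_lunit) simp_all
    have e2: "?\<chi> = (\<lambda>i\<in>{..<leaves (comb s E)}. (\<lambda>i\<in>{..<leaves (comb (comb t F) E)}.
        if i < leaves (comb t F) then \<chi> i else leaves t' + \<psi> (Suc (i - leaves (comb t F)))) (i - 1))"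
    proof
      fix i
      show "?\<chi> i = (\<lambda>i\<in>{..<leaves (comb s E)}. (\<lambda>i\<in>{..<leaves (comb (comb t F) E)}.
        if i < leaves (comb t F) then \<chi> i else leaves t' + \<psi> (Suc (i - leaves (comb t F)))) (i - 1)) i"
        using ls leaves_pos[of "comb t F"] by (cases i) (auto simp: leaves_comb[of _ E] h(3) simp del: leaves_pos)
    qed
    show ?thesis
      by (intro exI conjI) (rule NF.NF_ten[OF h(1) NF_ten.hyps(2), unfolded e3], rule e1, rule e2[unfolded e3])
  qed
qed

end

lemma extensional_eqI:
  assumes "f \<in> extensional A" "g \<in> extensional A" "\<And>x. x \<in> A \<Longrightarrow> f x = g x"
  shows "f = g"
  by (rule extensionalityI[OF assms])

context pointed_skew_monoidal_category
begin

lemma NF_not_lunit_cases: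
  assumes "NF s t f \<phi>" "\<nexists>u D. s = comb (Ten One u) D \<and> \<phi> 0 = \<phi> 1"
  obtains "s = Gen" "t = Gen" "f = Id C c"
  | "s = One" "t = One" "f = Id C (Unit C)"
  | a D v w g \<psi> h \<chi> where "s = comb a D" "t = Ten v w" "NF a v g \<psi>" "NF (comb One D) w h \<chi>"
    "f = (g \<boxtimes> h) \<cdot> split_arr C (I a) (Is D)"
    "\<phi> = (\<lambda>i\<in>{..<leaves s}. if i < leaves a then \<psi> i else leaves v + \<chi> (Suc (i - leaves a)))"
  using assms(1)
proof cases
  case (NF_lunit u D g \<psi>)
  have "1 < leaves s" using NF_lunit(1) by (simp add: leaves_comb)
  then have "\<phi> 0 = \<phi> 1" using NF_lunit(1,3) by simp
  then show ?thesis using assms(2) NF_lunit(1) by blast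
qed (use that in blast)+

text \<open>Induction on the leaves of both trees together. The left unit rule shortens the source.
  Both premises of the tensor rule have a proper part of the target, and their sources do not grow:
  the planted unit replaces a head with at least one leaf.\<close>

lemma NF_unique: "NF s t f \<phi> \<Longrightarrow> NF s t g \<phi> \<Longrightarrow> f = g"
proof (induction "leaves s + leaves t" arbitrary: s t f g \<phi> rule: less_induct)
  case less
  show ?case
  proof (cases "\<exists>u D. s = comb (Ten One u) D \<and> \<phi> 0 = \<phi> 1")
    case True
    then obtain u D where s: "s = comb (Ten One u) D" and eq: "\<phi> 0 = \<phi> 1" by blast
    obtain f' \<psi> where f: "NF (comb u D) t f' \<psi>" "f = f' \<cdot> whisker C (Lunit C (I u)) (Is D)"
      "\<phi> = (\<lambda>i\<in>{..<leaves s}. \<psi> (i - 1))"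
      using NF_lunit_inversion[OF less.prems(1) s eq] by blast
    obtain g' \<chi> where g: "NF (comb u D) t g' \<chi>" "g = g' \<cdot> whisker C (Lunit C (I u)) (Is D)"
      "\<phi> = (\<lambda>i\<in>{..<leaves s}. \<chi> (i - 1))"
      using NF_lunit_inversion[OF less.prems(2) s eq] by blast
    have ls: "leaves s = Suc (leaves (comb u D))" by (simp add: s leaves_comb)
    have "\<psi> = \<chi>"
    proof (rule extensional_eqI[OF NF_fun(1)[OF f(1)] NF_fun(1)[OF g(1)]])
      fix i assume i: "i \<in> {..<leaves (comb u D)}"
      have "\<psi> i = \<phi> (Suc i)" using i by (simp add: f(3) ls)
      also have "\<dots> = \<chi> i" using i by (simp add: g(3) ls)
      finally show "\<psi> i = \<chi> i" .
    qed
    then show ?thesis using less.hyps[OF _ f(1)] f(2) g(1,2) ls by simp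
  next
    case False
    show ?thesis
    proof (cases rule: NF_not_lunit_cases[OF less.prems(1) False])
      case 1
      show ?thesis by (cases rule: NF_not_lunit_cases[OF less.prems(2) False]) (use 1 in simp_all)
    next
      case 2
      show ?thesis by (cases rule: NF_not_lunit_cases[OF less.prems(2) False]) (use 2 in simp_all)
    next
      case f: (3 a D v w f1 \<phi>1 f2 \<phi>2)
      show ?thesis
      proof (cases rule: NF_not_lunit_cases[OF less.prems(2) False])
        case g: (3 a' D' v' w' g1 \<psi>1 g2 \<psi>2)
        have v: "v' = v" "w' = w" using f g by simp_all
        note f4 = NF_fun(3)[OF f(3)] and g4 = NF_fun(3)[OF g(3)]
        have "leaves a \<le> leaves s" "leaves a' \<le> leaves s"
          using leaves_comb[of a D] leaves_comb[of a' D'] f(1) g(1) by (metis le_add1)+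
        \<comment> \<open>The function determines the size of the head: its leaves are those sent
          into the left factor of the target.\<close>
        have lo: "\<phi> i < leaves v \<longleftrightarrow> i < leaves a" if "i < leaves s" for i
          using that f4[of i] by (simp add: f(6))
        have lo': "\<phi> i < leaves v \<longleftrightarrow> i < leaves a'" if "i < leaves s" for i
          using that g4[of i] by (simp add: g(6) v)
        have "leaves a = leaves a'"
          using lo[of "leaves a"] lo'[of "leaves a"] lo[of "leaves a'"] lo'[of "leaves a'"]
            \<open>leaves a \<le> leaves s\<close> \<open>leaves a' \<le> leaves s\<close> by linarith
        then have a: "a' = a" "D' = D" using comb_leaves_inject[of a D a' D'] f(1) g(1) by simp_all
        have ls: "leaves s = leaves a + sum_list (map leaves D)" by (simp add: f(1) leaves_comb)
        have "\<phi>1 = \<psi>1"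
        proof (rule extensional_eqI[OF NF_fun(1)[OF f(3)]])
          show "\<psi>1 \<in> extensional {..<leaves a}" using NF_fun(1)[OF g(3)] a by simp
          fix i assume i: "i \<in> {..<leaves a}"
          have "\<phi>1 i = \<phi> i" using i by (simp add: f(6) ls)
          also have "\<dots> = \<psi>1 i" using i by (simp add: g(6) ls a)
          finally show "\<phi>1 i = \<psi>1 i" .
        qed
        moreover have "\<phi>2 = \<psi>2"
        proof (rule extensional_eqI[OF NF_fun(1)[OF f(4)]])
          show "\<psi>2 \<in> extensional {..<leaves (comb One D)}" using NF_fun(1)[OF g(4)] a by simp
          fix i assume i: "i \<in> {..<leaves (comb One D)}"
          show "\<phi>2 i = \<psi>2 i"
          proof (cases i)
            case 0
            then show ?thesis using NF_fun(2)[OF f(4)] NF_fun(2)[OF g(4)] by simp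
          next
            case (Suc k)
            then have k: "leaves a + k < leaves s" using i by (simp add: ls leaves_comb)
            have "leaves v + \<phi>2 i = \<phi> (leaves a + k)" using k Suc by (simp add: f(6))
            also have "\<dots> = leaves v + \<psi>2 i" using k Suc by (simp add: g(6) a v)
            finally show ?thesis by simp
          qed
        qed
        moreover have "f1 = g1"
        proof -
          have "leaves a + leaves v < leaves s + leaves t"
            using \<open>leaves a \<le> leaves s\<close> by (simp add: f(2) add_le_less_mono)
          then show ?thesis using less.hyps[OF _ f(3)] g(3) \<open>\<phi>1 = \<psi>1\<close> a v by simp
        qed
        moreover have "f2 = g2"
        proof -
          have "leaves (comb One D) + leaves w < leaves s + leaves t"
            using leaves_pos[of a] leaves_pos[of v] by (simp add: ls f(2) leaves_comb del: leaves_pos leaves_neq_0)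
          then show ?thesis using less.hyps[OF _ f(4)] g(4) \<open>\<phi>2 = \<psi>2\<close> a v by simp
        qed
        ultimately show ?thesis using f(5) g(5) a by simp
      qed (use f in simp_all)
    qed
  qed
qed

section \<open>Existence of an arrow over every lax map\<close>

lemma lax_map_lunit_factor:
  assumes \<phi>: "lax_map (fsk_of (comb (Ten One t) D)) (fsk_of w) \<phi>" and eq: "\<phi> 0 = \<phi> 1"
  defines "\<psi> \<equiv> \<lambda>i\<in>{..<leaves (comb t D)}. \<phi> (Suc i)"
  shows "lax_map (fsk_of (comb t D)) (fsk_of w) \<psi>"
    "\<phi> = (\<lambda>i\<in>{..<leaves (comb (Ten One t) D)}. \<psi> (i - 1))"
proof -
  let ?s = "comb (Ten One t) D" and ?r = "comb t D"
  have ls: "leaves ?s = Suc (leaves ?r)" by (simp add: leaves_comb)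
  have f: "\<phi> \<in> extensional {..<leaves ?s}" "\<And>i. i < leaves ?s \<Longrightarrow> \<phi> i < leaves w"
    "mono_on {..<leaves ?s} \<phi>" "\<phi> 0 = 0" "\<phi> ` marks ?s = marks w"
    "\<And>i. i \<in> marks ?s \<Longrightarrow> i + 1 < leaves ?s \<Longrightarrow> \<phi> i < \<phi> (i + 1)"
    "\<And>i j. i + 1 < leaves ?s \<Longrightarrow> \<phi> i \<le> j \<Longrightarrow> j < \<phi> (i + 1) \<Longrightarrow> \<phi> (lbf ?s i) \<le> lbf w j"
    using \<phi> by (auto simp: PiE_def Pi_def)
  show "\<phi> = (\<lambda>i\<in>{..<leaves ?s}. \<psi> (i - 1))"
  proof (rule extensional_eqI[OF f(1)])
    fix i assume i: "i \<in> {..<leaves ?s}"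
    then show "\<phi> i = (\<lambda>i\<in>{..<leaves ?s}. \<psi> (i - 1)) i"
      using eq by (cases i) (simp_all add: \<psi>_def ls)
  qed simp
  have ms: "marks ?s = Suc ` marks ?r"
  proof (rule set_eqI)
    fix i show "i \<in> marks ?s \<longleftrightarrow> i \<in> Suc ` marks ?r"
      by (cases i) (auto simp: marks_comb_lunit marks_comb_Ten_One)
  qed
  have "\<psi> \<in> {..<leaves ?r} \<rightarrow>\<^sub>E {..<leaves w}" using f(2) ls by (auto simp: \<psi>_def)
  moreover have "mono_on {..<leaves ?r} \<psi>"
    by (rule mono_onI) (use mono_lessThan[OF f(3)] ls in \<open>auto simp: \<psi>_def\<close>)
  moreover have "\<psi> 0 = 0" using eq f(4) by (simp add: \<psi>_def)
  moreover have "\<psi> ` marks ?r = marks w"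
  proof -
    have "\<psi> ` marks ?r = (\<lambda>i. \<phi> (Suc i)) ` marks ?r"
      by (intro image_cong) (auto simp: \<psi>_def dest: marks_less)
    then show ?thesis using f(5) by (simp add: ms image_image)
  qed
  moreover have "\<psi> i < \<psi> (i + 1)" if "i \<in> marks ?r" "i + 1 < leaves ?r" for i
    using f(6)[of "Suc i"] that ls by (simp add: \<psi>_def ms)
  moreover have "\<psi> (lbf ?r i) \<le> lbf w j"
    if i: "i + 1 < leaves ?r" "\<psi> i \<le> j" "j < \<psi> (i + 1)" for i j
  proof -
    have l: "lbf ?r i = lbf ?s (Suc i) - 1" using lbf_comb_lunit[of i t D] i by simp
    have "\<phi> (lbf ?s (Suc i)) \<le> lbf w j"
      using f(7)[of "Suc i" j] i ls by (simp add: \<psi>_def)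
    moreover have "lbf ?r i < leaves ?r" using lbf_le[of i ?r] i by simp
    \<comment> \<open>If the value at \<open>Suc i\<close> is 0, truncated subtraction also gives 0,
      and the two sides agree because \<open>\<psi> 0 = \<phi> 1 = \<phi> 0\<close>.\<close>
    ultimately show ?thesis using l eq by (cases "lbf ?s (Suc i)") (simp_all add: \<psi>_def)
  qed
  ultimately show "lax_map (fsk_of ?r) (fsk_of w) \<psi>" by simp
qed

lemma lax_map_ten_factor:
  assumes \<phi>: "lax_map (fsk_of s) (fsk_of (Ten v w)) \<phi>"
    and nl: "\<nexists>u D. s = comb (Ten One u) D \<and> \<phi> 0 = \<phi> 1"
  obtains a D \<psi> \<chi> where "s = comb a D" "lax_map (fsk_of a) (fsk_of v) \<psi>"
    "lax_map (fsk_of (comb One D)) (fsk_of w) \<chi>"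
    "\<phi> = (\<lambda>i\<in>{..<leaves s}. if i < leaves a then \<psi> i else leaves v + \<chi> (Suc (i - leaves a)))"
proof -
  let ?m = "leaves s" and ?k = "leaves v" and ?t = "Ten v w"
  have f: "\<phi> \<in> extensional {..<?m}" "\<And>i. i < ?m \<Longrightarrow> \<phi> i < ?k + leaves w"
    "mono_on {..<?m} \<phi>" "\<phi> 0 = 0" "\<phi> ` marks s = marks ?t"
    "\<And>i. i \<in> marks s \<Longrightarrow> i + 1 < ?m \<Longrightarrow> \<phi> i < \<phi> (i + 1)"
    "\<And>i j. i + 1 < ?m \<Longrightarrow> \<phi> i \<le> j \<Longrightarrow> j < \<phi> (i + 1) \<Longrightarrow> \<phi> (lbf s i) \<le> lbf ?t j"
    using \<phi> by (auto simp: PiE_def Pi_def simp del: lbf.simps marks.simps)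
  \<comment> \<open>Leaf 0 is either marked, hence last in its fibre, or the unit of some
    \<open>Ten One u\<close>, where the assumption forbids identifying it with leaf 1.\<close>
  have first: "0 < \<phi> 1" if m1: "1 < ?m"
  proof (cases s rule: tree_head_cases)
    case (1 D)
    then have "0 \<in> marks s" using marks_comb_head[of 0 Gen D] by simp
    then show ?thesis using f(6)[of 0] m1 f(4) by simp
  next
    case (3 u D)
    then have "\<phi> 0 \<noteq> \<phi> 1" using nl by blast
    then show ?thesis using f(4) by simp
  qed (use m1 in simp)
  \<comment> \<open>\<open>p\<close> is the number of leaves sent into \<open>v\<close>; the
    \<open>+ 1\<close> turns the last such index into a count.\<close>
  define p where "p = radj ?m \<phi> (?k - 1) + 1"
  note r = radj_le[OF f(3), of "?k - 1", unfolded f(4), OF le0 leaves_pos]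
  have pm: "p \<le> ?m" using r(1) by (simp add: p_def)
  have lt: "\<phi> i < ?k \<longleftrightarrow> i < p" if "i < ?m" for i
    using r(3)[OF that] leaves_pos[of v] by (auto simp: p_def simp del: leaves_pos leaves_neq_0)
  have "\<exists>a D. s = comb a D \<and> leaves a = p"
  proof (cases "p < ?m")
    case True
    define q where "q = p - 1"
    have q: "p = q + 1" "q + 1 < ?m" using True by (auto simp: q_def p_def)
    have "\<phi> q \<le> ?k - 1" "?k - 1 < \<phi> (q + 1)" using lt[of q] lt[of "q + 1"] q by auto
    \<comment> \<open>The lax inequality is used at the boundary: the last leaf of \<open>v\<close>
      has bracketing value 0 in \<open>Ten v w\<close>, so \<open>lbf s q\<close> is sent to 0 and,
      by \<open>first\<close>, is 0. Hence the source can be cut behind \<open>q\<close>.\<close>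
    then have "\<phi> (lbf s q) \<le> lbf ?t (?k - 1)" using f(7)[OF q(2)] by blast
    also have "\<dots> = 0" using lbf_Ten(2)[of "?k - 1" v w] by simp
    finally have z: "\<phi> (lbf s q) = 0" by simp
    have "lbf s q = 0"
    proof (rule ccontr)
      assume "lbf s q \<noteq> 0"
      then have "1 \<le> lbf s q" "lbf s q < ?m" using lbf_le[of q s] q by auto
      then have "\<phi> 1 \<le> \<phi> (lbf s q)" by (rule mono_lessThan[OF f(3)])
      then show False using z first q by simp
    qed
    then show ?thesis using lbf_zero_split[of s q] q by blast
  next
    case False
    then have "s = comb s [] \<and> leaves s = p" using pm by simp
    then show ?thesis by blast
  qed
  then obtain a D where s: "s = comb a D" and a: "leaves a = p" by blast
  let ?b = "comb One D"
  have lb: "?m + 1 = p + leaves ?b" by (simp add: s leaves_comb a)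
  have p0: "0 < p" by (simp add: p_def)
  define \<psi> where "\<psi> = (\<lambda>i\<in>{..<p}. \<phi> i)"
  \<comment> \<open>Leaf 0 is the planted unit and goes to leaf 0 of \<open>w\<close>; the others
    are the context leaves, shifted by one.\<close>
  define \<chi> where "\<chi> = (\<lambda>i\<in>{..<leaves ?b}. case i of 0 \<Rightarrow> 0 | Suc l \<Rightarrow> \<phi> (p + l) - ?k)"
  have \<chi>Suc: "\<phi> (p + l) = ?k + \<chi> (Suc l)" "p + l < ?m" if "Suc l < leaves ?b" for l
    using that lb lt[of "p + l"] by (auto simp: \<chi>_def)
  have \<chi>0: "\<chi> 0 = 0" by (simp add: \<chi>_def)
  have mt: "j \<in> marks ?t \<longleftrightarrow> j \<in> marks v" if "j < ?k" for j using that by auto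
  have mt': "?k + j \<in> marks ?t \<longleftrightarrow> j \<in> marks w" for j using marks_less[of "?k + j" v] by auto
  have ma: "i \<in> marks s \<longleftrightarrow> i \<in> marks a" if "i < p" for i
    using marks_comb_head[of i a D] that a s by simp
  have mb: "p + l \<in> marks s \<longleftrightarrow> Suc l \<in> marks ?b" for l
    using marks_comb_tail[of a l D] a s by simp
  have "lax_map (fsk_of a) (fsk_of v) \<psi>"
  proof -
    have "\<psi> \<in> {..<p} \<rightarrow>\<^sub>E {..<?k}" using lt pm by (auto simp: \<psi>_def)
    moreover have "mono_on {..<p} \<psi>"
      by (rule mono_onI) (use mono_lessThan[OF f(3)] pm in \<open>auto simp: \<psi>_def\<close>)
    moreover have "\<psi> 0 = 0" using f(4) p0 by (simp add: \<psi>_def)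
    moreover have "\<psi> ` marks a = marks v"
    proof (rule set_eqI)
      fix j
      show "j \<in> \<psi> ` marks a \<longleftrightarrow> j \<in> marks v"
      proof
        assume "j \<in> \<psi> ` marks a"
        then obtain i where i: "i \<in> marks a" "j = \<psi> i" by blast
        have ip: "i < p" using marks_less[OF i(1)] a by simp
        then have "j = \<phi> i" "j < ?k" using i lt[of i] pm by (auto simp: \<psi>_def)
        moreover have "\<phi> i \<in> marks ?t" using f(5) ma[OF ip] i by blast
        ultimately show "j \<in> marks v" using mt[of j] by simp
      next
        assume j: "j \<in> marks v"
        then have "j < ?k" by (rule marks_less)
        then have "j \<in> \<phi> ` marks s" using j mt f(5) by blast
        then obtain i where i: "i \<in> marks s" "j = \<phi> i" by blast
        then have "i < p" using lt[OF marks_less[OF i(1)]] \<open>j < ?k\<close> by simp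
        then show "j \<in> \<psi> ` marks a" using i ma[of i] by (auto simp: \<psi>_def)
      qed
    qed
    moreover have "\<psi> i < \<psi> (i + 1)" if "i \<in> marks a" "i + 1 < p" for i
      using f(6)[of i] that ma[of i] pm by (simp add: \<psi>_def)
    moreover have "\<psi> (lbf a i) \<le> lbf v j" if i: "i + 1 < p" "\<psi> i \<le> j" "j < \<psi> (i + 1)" for i j
    proof -
      have ij: "\<phi> i \<le> j" "j < \<phi> (i + 1)" using i by (simp_all add: \<psi>_def)
      have "\<phi> (i + 1) < ?k" using lt[of "i + 1"] i pm by simp
      then have "lbf ?t j = lbf v j" using lbf_Ten(1)[of j v w] ij by simp
      moreover have "lbf s i = lbf a i" using lbf_comb_head[of i a D] i a s by simp
      moreover have "lbf a i < p" using lbf_le[of i a] i a by simp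
      ultimately show ?thesis using f(7)[of i j] ij i pm by (simp add: \<psi>_def)
    qed
    ultimately show ?thesis by (simp add: a)
  qed
  moreover have "lax_map (fsk_of ?b) (fsk_of w) \<chi>"
  proof -
    have lt\<chi>: "\<chi> i < leaves w" if "i < leaves ?b" for i
    proof (cases i)
      case (Suc l)
      then show ?thesis using \<chi>Suc[of l] f(2)[of "p + l"] that by simp
    qed (simp add: \<chi>0)
    then have "\<chi> \<in> {..<leaves ?b} \<rightarrow>\<^sub>E {..<leaves w}" by (auto simp: \<chi>_def)
    moreover have "mono_on {..<leaves ?b} \<chi>"
    proof (rule mono_onI)
      fix i j assume ij: "i \<in> {..<leaves ?b}" "j \<in> {..<leaves ?b}" "i \<le> j"
      show "\<chi> i \<le> \<chi> j"
      proof (cases i)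
        case (Suc l)
        then obtain l' where l': "j = Suc l'" "l \<le> l'" using ij by (cases j) auto
        have "\<phi> (p + l) \<le> \<phi> (p + l')" using mono_lessThan[OF f(3), of "p + l" "p + l'"] \<chi>Suc(2)[of l'] l' ij by simp
        then show ?thesis using \<chi>Suc(1)[of l] \<chi>Suc(1)[of l'] ij Suc l' by simp
      qed (simp add: \<chi>0)
    qed
    moreover have "\<chi> ` marks ?b = marks w"
    proof (rule set_eqI)
      fix j
      show "j \<in> \<chi> ` marks ?b \<longleftrightarrow> j \<in> marks w"
      proof
        assume "j \<in> \<chi> ` marks ?b"
        then obtain i where i: "i \<in> marks ?b" "j = \<chi> i" by blast
        then obtain l where l: "i = Suc l" using marks_comb_One[of D] by (cases i) auto
        have "\<phi> (p + l) = ?k + j" using \<chi>Suc(1)[of l] i l marks_less[of i ?b] by simp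
        moreover have "\<phi> (p + l) \<in> marks ?t" using f(5) mb[of l] i l by blast
        ultimately show "j \<in> marks w" using mt' by simp
      next
        assume "j \<in> marks w"
        then have "?k + j \<in> \<phi> ` marks s" using mt' f(5) by blast
        then obtain i where i: "i \<in> marks s" "?k + j = \<phi> i" by blast
        have "\<not> i < p" using lt[OF marks_less[OF i(1)]] i by simp
        then obtain l where l: "i = p + l" by (metis le_Suc_ex not_less)
        have "Suc l \<in> marks ?b" using mb[of l] i l by simp
        moreover have "j = \<chi> (Suc l)"
          using \<chi>Suc(1)[of l] marks_less[OF \<open>Suc l \<in> marks ?b\<close>] i l by simp
        ultimately show "j \<in> \<chi> ` marks ?b" by blast
      qed
    qed
    moreover have "\<chi> i < \<chi> (i + 1)" if i: "i \<in> marks ?b" "i + 1 < leaves ?b" for i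
    proof -
      obtain l where l: "i = Suc l" using marks_comb_One[of D] i by (cases i) auto
      have "p + l \<in> marks s" using mb[of l] i l by simp
      then show ?thesis
        using f(6)[of "p + l"] \<chi>Suc[of l] \<chi>Suc[of "Suc l"] i l by simp
    qed
    moreover have "\<chi> (lbf ?b i) \<le> lbf w j" if i: "i + 1 < leaves ?b" "\<chi> i \<le> j" "j < \<chi> (i + 1)" for i j
    proof (cases i)
      case 0
      then show ?thesis using lbf_le[of 0 ?b] \<chi>0 by simp
    next
      case (Suc l)
      have "l < sum_list (map leaves D)" using i Suc by (simp add: leaves_comb)
      then have l: "lbf ?b i = lbf s (p + l) + 1 - p" using lbf_comb_tail[of l D a] a s Suc by simp
      have "\<phi> (p + l) \<le> ?k + j" "?k + j < \<phi> (p + l + 1)" "p + l + 1 < ?m"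
        using \<chi>Suc[of l] \<chi>Suc[of "Suc l"] i Suc by simp_all
      then have "\<phi> (lbf s (p + l)) \<le> lbf ?t (?k + j)" using f(7) by blast
      moreover have "j < leaves w" using i lt\<chi>[of "i + 1"] by simp
      ultimately have le: "\<phi> (lbf s (p + l)) \<le> ?k + lbf w j" using lbf_Ten(3)[of j w v] by simp
      \<comment> \<open>A bracketing value inside the head becomes 0 in the right premise; one in
        the context is shifted like the context itself.\<close>
      show ?thesis
      proof (cases "lbf s (p + l) < p")
        case True
        then show ?thesis using l \<chi>0 by simp
      next
        case False
        then obtain l' where l': "lbf s (p + l) = p + l'" by (metis le_Suc_ex not_less)
        then have "lbf ?b i = Suc l'" using l by simp
        moreover have "Suc l' < leaves ?b" using lbf_le[of i ?b] i calculation by simp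
        ultimately show ?thesis using \<chi>Suc(1)[of l'] le l' by simp
      qed
    qed
    ultimately show ?thesis using \<chi>0 by simp
  qed
  moreover have "\<phi> = (\<lambda>i\<in>{..<leaves s}. if i < leaves a then \<psi> i else leaves v + \<chi> (Suc (i - leaves a)))"
  proof (rule extensional_eqI[OF f(1)])
    fix i assume i: "i \<in> {..<?m}"
    show "\<phi> i = (\<lambda>i\<in>{..<leaves s}. if i < leaves a then \<psi> i else leaves v + \<chi> (Suc (i - leaves a))) i"
    proof (cases "i < p")
      case True
      then show ?thesis using i by (simp add: a \<psi>_def)
    next
      case False
      then show ?thesis using i \<chi>Suc(1)[of "i - p"] lb by (simp add: a)
    qed
  qed simp
  ultimately show ?thesis using that s by blast
qed

lemma NF_total:
  assumes "lax_map (fsk_of s) (fsk_of t) \<phi>"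
  shows "\<exists>f. NF s t f \<phi>"
  using assms
proof (induction "leaves s + leaves t" arbitrary: s t \<phi> rule: less_induct)
  case less
  show ?case
  proof (cases "\<exists>u D. s = comb (Ten One u) D \<and> \<phi> 0 = \<phi> 1")
    case True
    then obtain u D where s: "s = comb (Ten One u) D" and eq: "\<phi> 0 = \<phi> 1" by blast
    note fac = lax_map_lunit_factor[OF less.prems[unfolded s] eq]
    have "leaves (comb u D) < leaves s" by (simp add: s leaves_comb)
    then obtain f where f: "NF (comb u D) t f (\<lambda>i\<in>{..<leaves (comb u D)}. \<phi> (Suc i))"
      using less.hyps[OF _ fac(1)] by auto
    have "NF (comb (Ten One u) D) t (f \<cdot> whisker C (Lunit C (I u)) (Is D)) \<phi>"
      by (subst fac(2)) (rule NF_lunit[OF f])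
    then show ?thesis unfolding s by blast
  next
    case nl: False
    show ?thesis
    proof (cases "\<exists>v w. t = Ten v w")
      case True
      then obtain v w where t: "t = Ten v w" by blast
      obtain a D \<psi> \<chi> where fac: "s = comb a D" "lax_map (fsk_of a) (fsk_of v) \<psi>"
        "lax_map (fsk_of (comb One D)) (fsk_of w) \<chi>"
        "\<phi> = (\<lambda>i\<in>{..<leaves s}. if i < leaves a then \<psi> i else leaves v + \<chi> (Suc (i - leaves a)))"
        using lax_map_ten_factor[OF less.prems[unfolded t] nl] by blast
      have "leaves a + leaves v < leaves s + leaves t"
        by (simp add: fac(1) t leaves_comb)
      then obtain f where f: "NF a v f \<psi>" using less.hyps[OF _ fac(2)] by blast
      have "leaves (comb One D) + leaves w < leaves s + leaves t"
        using leaves_pos[of a] leaves_pos[of v]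
        by (simp add: fac(1) t leaves_comb del: leaves_pos leaves_neq_0)
      then obtain g where g: "NF (comb One D) w g \<chi>" using less.hyps[OF _ fac(3)] by blast
      have "NF s t ((f \<boxtimes> g) \<cdot> split_arr C (I a) (Is D)) \<phi>"
        unfolding fac(4) t using NF_ten[OF f g] by (simp only: fac(1))
      then show ?thesis by blast
    next
      case False
      then have t: "t = Gen \<or> t = One" by (cases t) auto
      then have lt: "leaves t = 1" by auto
      have f: "\<phi> \<in> extensional {..<leaves s}" "\<And>i. i < leaves s \<Longrightarrow> \<phi> i = 0" "\<phi> ` marks s = marks t"
        "\<And>i. i \<in> marks s \<Longrightarrow> i + 1 < leaves s \<Longrightarrow> \<phi> i < \<phi> (i + 1)"
        using less.prems lt by (auto simp: PiE_def Pi_def)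
      \<comment> \<open>\<open>\<phi>\<close> is constant, so a marked first leaf has no successor,
        and a source starting with \<open>Ten One u\<close> would fall under the left unit rule. A
        single leaf is left, and marks distinguish \<open>Gen\<close> from
        \<open>One\<close>.\<close>
      have s: "s = t"
      proof (cases s rule: tree_head_cases)
        case (1 D)
        have z: "0 \<in> marks s" using marks_comb_head[of 0 Gen D] 1 by simp
        have "\<not> 1 < leaves s" using f(4)[OF z] f(2)[of 1] by auto
        then have "D = []" using 1 by (cases D) (auto simp: leaves_comb)
        then show ?thesis using 1 t z f(3) by auto
      next
        case 2
        then show ?thesis using t f(3) by auto
      next
        case (3 u D)
        then have "\<phi> 0 = \<phi> 1" using f(2) by (simp add: leaves_comb)
        then show ?thesis using nl 3 by blast
      qed
      have "\<phi> = (\<lambda>i\<in>{..<1}. i)"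
        by (rule extensional_eqI[OF f(1)]) (use f(2) s lt in auto)
      then show ?thesis using s t NF_gen NF_unit by blast
    qed
  qed
qed

end

section \<open>The free functor\<close>

lemma strict_functorD:
  assumes "strict_skew_monoidal_functor C D F"
  shows "x \<in> Obj C \<Longrightarrow> fst F x \<in> Obj D"
    "x \<in> Obj C \<Longrightarrow> snd F (Id C x) = Id D (fst F x)"
    "f \<in> Arr C \<Longrightarrow> g \<in> Arr C \<Longrightarrow> Dom C g = Cod C f \<Longrightarrow> snd F (Comp C g f) = Comp D (snd F g) (snd F f)"
    "x \<in> Obj C \<Longrightarrow> y \<in> Obj C \<Longrightarrow> fst F (Tensor C x y) = Tensor D (fst F x) (fst F y)"
    "f \<in> Arr C \<Longrightarrow> g \<in> Arr C \<Longrightarrow> snd F (Tensor_Arr C f g) = Tensor_Arr D (snd F f) (snd F g)"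
    "fst F (Unit C) = Unit D"
    "x \<in> Obj C \<Longrightarrow> y \<in> Obj C \<Longrightarrow> z \<in> Obj C \<Longrightarrow>
      snd F (Assoc C x y z) = Assoc D (fst F x) (fst F y) (fst F z)"
    "x \<in> Obj C \<Longrightarrow> snd F (Lunit C x) = Lunit D (fst F x)"
    "x \<in> Obj C \<Longrightarrow> snd F (Runit C x) = Runit D (fst F x)"
  using assms by (auto simp: strict_skew_monoidal_functor_def is_functor_def)

context skew_monoidal_category
begin

lemma strict_functor_comb_ob:
  assumes "strict_skew_monoidal_functor C D F" "x \<in> Obj C" "set E \<subseteq> Obj C"
  shows "fst F (comb_ob C x E) = comb_ob D (fst F x) (map (fst F) E)"
  using assms(3) by (induction E) (simp_all add: strict_functorD[OF assms(1)] assms(2))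

lemma strict_functor_whisker:
  assumes "strict_skew_monoidal_functor C D F" "f \<in> Arr C" "set E \<subseteq> Obj C"
  shows "snd F (whisker C f E) = whisker D (snd F f) (map (fst F) E)"
  using assms(3) by (induction E) (simp_all add: strict_functorD[OF assms(1)] assms(2))

lemma strict_functor_split_arr:
  assumes "strict_skew_monoidal_functor C D F" "x \<in> Obj C" "set E \<subseteq> Obj C"
  shows "snd F (split_arr C x E) = split_arr D (fst F x) (map (fst F) E)"
  using assms(3)
  by (induction E)
    (simp_all add: strict_functorD[OF assms(1)] strict_functor_comb_ob[OF assms(1)] assms(2))

end

context pointed_skew_monoidal_category
begin

definition free_ob :: "fsk_obj \<Rightarrow> 'o" where
  "free_ob A = I (tree_of A)"

text \<open>The description denotes an arrow because \<open>NF_total\<close> and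
  \<open>NF_unique\<close> give exactly one over each arrow of Fsk.\<close>

definition free_arr :: "fsk_arr \<Rightarrow> 'a" where
  "free_arr x = (THE f. NF (tree_of (fst x)) (tree_of (snd (snd x))) f (fst (snd x)))"

lemma free_ob_fsk_of [simp]: "free_ob (fsk_of t) = I t"
  by (simp only: free_ob_def tree_of_fsk_of)

lemma free_arr_NF: "NF s t f \<phi> \<Longrightarrow> free_arr (fsk_of s, \<phi>, fsk_of t) = f"
  unfolding free_arr_def fst_conv snd_conv tree_of_fsk_of
  by (rule the_equality) (auto intro: NF_unique)

lemma fsk_objectsE:
  assumes "A \<in> fsk_objects"
  obtains t where "A = fsk_of t"
  using fsk_of_surj[OF assms] by metis

lemma Arr_FskE:
  assumes "x \<in> Arr Fsk"
  obtains s t \<phi> f where "x = (fsk_of s, \<phi>, fsk_of t)" "NF s t f \<phi>"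
proof -
  obtain A \<phi> B where x: "x = (A, \<phi>, B)" by (cases x) auto
  then have AB: "A \<in> fsk_objects" "B \<in> fsk_objects" "lax_map A B \<phi>" using assms by simp_all
  obtain s where s: "A = fsk_of s" using AB(1) by (rule fsk_objectsE)
  obtain t where t: "B = fsk_of t" using AB(2) by (rule fsk_objectsE)
  obtain f where "NF s t f \<phi>" using NF_total AB(3) unfolding s t by blast
  then show ?thesis using that x unfolding s t by blast
qed

lemma NF_Arr: "NF s t f \<phi> \<Longrightarrow> (fsk_of s, \<phi>, fsk_of t) \<in> Arr Fsk"
  unfolding Arr_Fsk using NF_arr(4) fsk_of_obj by blast

definition free_functor :: "(fsk_obj \<Rightarrow> 'o) \<times> (fsk_arr \<Rightarrow> 'a)" where
  "free_functor = (restrict free_ob (Obj Fsk), restrict free_arr (Arr Fsk))"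

lemma free_functor_ob: "fst free_functor (fsk_of t) = I t"
  using fsk_of_obj[of t] by (simp only: free_functor_def fst_conv Fsk_simps restrict_apply if_True free_ob_fsk_of)

lemma free_functor_arr: "NF s t f \<phi> \<Longrightarrow> snd free_functor (fsk_of s, \<phi>, fsk_of t) = f"
  using NF_Arr free_arr_NF by (simp only: free_functor_def snd_conv restrict_apply if_True)

text \<open>Each clause asks for the arrow over a known function; the closure properties of
  \<open>NF\<close> exhibit it, and \<open>free_arr_NF\<close> identifies it as the value.\<close>

lemma free_functor_strict: "strict_skew_monoidal_functor Fsk C free_functor"
  unfolding strict_skew_monoidal_functor_def is_functor_def
proof (intro conjI ballI impI)
  show "fst free_functor \<in> Obj Fsk \<rightarrow>\<^sub>E Obj C"
    by (auto simp: free_functor_def free_ob_def)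
  show "snd free_functor \<in> Arr Fsk \<rightarrow>\<^sub>E Arr C"
  proof (rule PiE_I)
    fix x assume "x \<in> Arr Fsk"
    then show "snd free_functor x \<in> Arr C"
      by (rule Arr_FskE) (simp only: free_functor_arr NF_arr(1))
  qed (simp add: free_functor_def)
next
  fix x assume "x \<in> Arr Fsk"
  then obtain s t \<phi> f where x: "x = (fsk_of s, \<phi>, fsk_of t)" "NF s t f \<phi>" by (rule Arr_FskE)
  show "Dom C (snd free_functor x) = fst free_functor (Dom Fsk x)"
    "Cod C (snd free_functor x) = fst free_functor (Cod Fsk x)"
    using NF_arr(2,3)[OF x(2)]
    by (simp_all only: x(1) Fsk_simps free_functor_arr[OF x(2)] free_functor_ob)
next
  fix A assume "A \<in> Obj Fsk"
  then obtain t where t: "A = fsk_of t" unfolding Fsk_simps by (rule fsk_objectsE)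
  show "snd free_functor (Id Fsk A) = Id C (fst free_functor A)"
    by (simp only: t Fsk_simps fst_conv free_functor_arr[OF NF_id] free_functor_ob)
  show "snd free_functor (Lunit Fsk A) = Lunit C (fst free_functor A)"
    by (simp only: t Fsk_simps fst_conv fsk_unit_eq fsk_of_Ten free_functor_arr[OF NF_lunit_arr] free_functor_ob)
  show "snd free_functor (Runit Fsk A) = Runit C (fst free_functor A)"
    by (simp only: t Fsk_simps fst_conv fsk_unit_eq fsk_of_Ten free_functor_arr[OF NF_runit_arr] free_functor_ob)
next
  fix x y assume "x \<in> Arr Fsk" "y \<in> Arr Fsk" and eq: "Dom Fsk y = Cod Fsk x"
  then obtain s t \<phi> f t' w \<psi> g where x: "x = (fsk_of s, \<phi>, fsk_of t)" "NF s t f \<phi>"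
    and y: "y = (fsk_of t', \<psi>, fsk_of w)" "NF t' w g \<psi>"
    by (metis Arr_FskE)
  have "fsk_of t' = fsk_of t" using eq unfolding x(1) y(1) Fsk_simps .
  \<comment> \<open>Composability gives equal objects only; injectivity of \<open>fsk_of\<close>
    makes the trees equal, so the derivations compose.\<close>
  then have t: "t' = t" by (rule fsk_of_inject)
  show "snd free_functor (Comp Fsk y x) = snd free_functor y \<cdot> snd free_functor x"
    by (simp only: x(1) y(1) t Fsk_simps fst_conv free_functor_arr[OF x(2)]
        free_functor_arr[OF y(2)[unfolded t]] free_functor_arr[OF NF_comp[OF x(2) y(2)[unfolded t]]])
next
  fix A B assume "A \<in> Obj Fsk" "B \<in> Obj Fsk"
  then obtain s t where A: "A = fsk_of s" "B = fsk_of t" unfolding Fsk_simps by (metis fsk_objectsE)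
  show "fst free_functor (Tensor Fsk A B) = fst free_functor A \<otimes> fst free_functor B"
    by (simp only: A Fsk_simps fsk_of_Ten free_functor_ob interp.simps)
  fix D assume "D \<in> Obj Fsk"
  then obtain w where D: "D = fsk_of w" unfolding Fsk_simps by (rule fsk_objectsE)
  show "snd free_functor (Assoc Fsk A B D) =
    Assoc C (fst free_functor A) (fst free_functor B) (fst free_functor D)"
    by (simp only: A D Fsk_simps fst_conv fsk_of_Ten free_functor_arr[OF NF_assoc] free_functor_ob)
next
  fix x y assume "x \<in> Arr Fsk" "y \<in> Arr Fsk"
  then obtain s t \<phi> f s' t' \<psi> g where x: "x = (fsk_of s, \<phi>, fsk_of t)" "NF s t f \<phi>"
    and y: "y = (fsk_of s', \<psi>, fsk_of t')" "NF s' t' g \<psi>"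
    by (metis Arr_FskE)
  show "snd free_functor (Tensor_Arr Fsk x y) = snd free_functor x \<boxtimes> snd free_functor y"
    by (simp only: x(1) y(1) Fsk_simps fst_conv fsk_of_Ten free_functor_arr[OF NF_tensor[OF x(2) y(2)]]
        free_functor_arr[OF x(2)] free_functor_arr[OF y(2)])
next
  show "fst free_functor (Unit Fsk) = Unit C"
    by (simp only: Fsk_simps fsk_unit_eq free_functor_ob interp.simps)
qed

section \<open>Uniqueness of the functor\<close>

lemma strict_functor_interp:
  assumes F: "strict_skew_monoidal_functor Fsk C F" "fst F fsk_generator = c"
  shows "fst F (fsk_of t) = I t"
proof (induction t)
  case Gen
  show ?case using F(2) by (simp only: fsk_generator_eq interp.simps)
next
  case One
  show ?case using strict_functorD(6)[OF F(1)] by (simp only: Fsk_simps fsk_unit_eq interp.simps)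
next
  case (Ten s t)
  then show ?case using strict_functorD(4)[OF F(1), of "fsk_of s" "fsk_of t"] fsk_of_obj
    by (simp only: Fsk_simps fsk_of_Ten interp.simps)
qed

text \<open>A strict functor preserves every ingredient of the rules, \<open>whisker\<close> and
  \<open>split_arr\<close> included, so its value on an arrow of Fsk can be read off from any
  derivation.\<close>

lemma strict_functor_NF:
  assumes F: "strict_skew_monoidal_functor Fsk C F" "fst F fsk_generator = c"
    and "NF s t f \<phi>"
  shows "snd F (fsk_of s, \<phi>, fsk_of t) = f"
  using assms(3)
proof (induction rule: NF.induct)
  interpret Fsk: skew_monoidal_category Fsk by (rule Fsk_skew_monoidal)
  note obs = strict_functor_interp[OF F]
  have Obs: "fsk_of t \<in> Obj Fsk" "set (map fsk_of D) \<subseteq> Obj Fsk" for t D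
    using fsk_of_obj by (auto simp only: Fsk_simps set_map)
  have mobs: "map (fst F) (map fsk_of D) = Is D" for D
    by (simp only: map_map comp_def obs)
  {
    case NF_gen
    show ?case using strict_functorD(2)[OF F(1) Obs(1), of Gen]
      by (simp only: Fsk_simps fst_conv obs[of Gen, unfolded leaves.simps] leaves.simps interp.simps)
  next
    case NF_unit
    show ?case using strict_functorD(2)[OF F(1) Obs(1), of One]
      by (simp only: Fsk_simps fst_conv obs[of One, unfolded leaves.simps] leaves.simps interp.simps)
  next
    case (NF_lunit t D w f \<phi>)
    let ?l = "Lunit Fsk (fsk_of t)"
    have l: "?l \<in> Arr Fsk" using Obs by (intro Fsk.lunit_arr)
    have "snd F (Comp Fsk (fsk_of (comb t D), \<phi>, fsk_of w) (whisker Fsk ?l (map fsk_of D))) =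
      snd F (fsk_of (comb t D), \<phi>, fsk_of w) \<cdot> snd F (whisker Fsk ?l (map fsk_of D))"
      using NF_Arr[OF NF_lunit.hyps] l Obs
      by (intro strict_functorD(3)[OF F(1)] Fsk.whisker_arr)
        (simp_all only: Fsk.whisker_arr Fsk.lunit_arr Fsk_simps(2) comb_ob_Fsk)
    also have "snd F (whisker Fsk ?l (map fsk_of D)) = whisker C (Lunit C (I t)) (Is D)"
      by (simp only: Fsk.strict_functor_whisker[OF F(1) l Obs(2)] strict_functorD(8)[OF F(1) Obs(1)] obs mobs)
    finally show ?case unfolding comp_whisker_lunit_Fsk NF_lunit.IH .
  next
    case (NF_ten s t f \<phi> D w g \<psi>)
    let ?x = "(fsk_of s, \<phi>, fsk_of t)" and ?y = "(fsk_of (comb One D), \<psi>, fsk_of w)"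
    have xy: "?x \<in> Arr Fsk" "?y \<in> Arr Fsk" using NF_ten.hyps by (blast intro: NF_Arr)+
    have "snd F (Comp Fsk (Tensor_Arr Fsk ?x ?y) (split_arr Fsk (fsk_of s) (map fsk_of D))) =
      snd F (Tensor_Arr Fsk ?x ?y) \<cdot> snd F (split_arr Fsk (fsk_of s) (map fsk_of D))"
      using xy Obs
      by (intro strict_functorD(3)[OF F(1)] Fsk.split_arr_arr Fsk.tensor_arr)
        (simp_all only: Fsk.split_arr_arr Fsk.tensor_arr Fsk_simps(2,3,7) comb_ob_Fsk_unit)
    also have "snd F (Tensor_Arr Fsk ?x ?y) = f \<boxtimes> g"
      by (simp only: strict_functorD(5)[OF F(1) xy] NF_ten.IH)
    also have "snd F (split_arr Fsk (fsk_of s) (map fsk_of D)) = split_arr C (I s) (Is D)"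
      by (simp only: Fsk.strict_functor_split_arr[OF F(1) Obs] obs mobs)
    finally show ?case unfolding comp_split_arr_Fsk .
  }
qed

proposition free_functor_unique:
  assumes F: "strict_skew_monoidal_functor Fsk C F" "fst F fsk_generator = c"
  shows "F = free_functor"
proof -
  note ext = strict_skew_monoidal_functor_def is_functor_def PiE_def
  have "fst F = fst free_functor"
  proof (rule extensional_eqI)
    show "fst F \<in> extensional (Obj Fsk)" "fst free_functor \<in> extensional (Obj Fsk)"
      using F(1) free_functor_strict by (simp_all add: ext)
    fix A assume "A \<in> Obj Fsk"
    then obtain t where t: "A = fsk_of t" unfolding Fsk_simps by (rule fsk_objectsE)
    show "fst F A = fst free_functor A"
      by (simp only: t strict_functor_interp[OF F] free_functor_ob)
  qed
  moreover have "snd F = snd free_functor"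
  proof (rule extensional_eqI)
    show "snd F \<in> extensional (Arr Fsk)" "snd free_functor \<in> extensional (Arr Fsk)"
      using F(1) free_functor_strict by (simp_all add: ext)
    fix x assume "x \<in> Arr Fsk"
    then obtain s t \<phi> f where x: "x = (fsk_of s, \<phi>, fsk_of t)" "NF s t f \<phi>" by (rule Arr_FskE)
    show "snd F x = snd free_functor x"
      by (simp only: x(1) strict_functor_NF[OF F x(2)] free_functor_arr[OF x(2)])
  qed
  ultimately show ?thesis by (rule prod_eqI)
qed

end

theorem theorem11p3:
  shows "skew_monoidal_category Fsk \<and> fsk_generator \<in> Obj Fsk \<and>
    (\<forall>(C :: ('o, 'a) skew_monoidal) c. skew_monoidal_category C \<and> c \<in> Obj C \<longrightarrow>
       (\<exists>!F. strict_skew_monoidal_functor Fsk C F \<and> fst F fsk_generator = c))"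
proof (intro conjI allI impI)
  show "skew_monoidal_category Fsk" by (rule Fsk_skew_monoidal)
  show "fsk_generator \<in> Obj Fsk" by (simp add: fsk_generator_obj)
  fix C :: "('o, 'a) skew_monoidal" and c
  assume "skew_monoidal_category C \<and> c \<in> Obj C"
  then interpret pointed_skew_monoidal_category C c
    by (simp add: pointed_skew_monoidal_category_def pointed_skew_monoidal_category_axioms_def)
  have "fst free_functor fsk_generator = c"
    unfolding fsk_generator_eq free_functor_ob by simp
  then show "\<exists>!F. strict_skew_monoidal_functor Fsk C F \<and> fst F fsk_generator = c"
    using free_functor_strict free_functor_unique by blast
qed

end
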